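(* Let $\Psi\in\mathrm{VConv}_n(U,\mathcal{M}(U))$ be locally determined. Then there exists a unique function $\psi\in C(U)$ such that for $f\in\mathrm{Conv}(U,\mathbb{R})$ \begin{align*} \Psi(f)[B]=\int_{B}\psi(x)d\mathrm{MA}(f,x)\quad\text{for all relatively compact Borel sets}~B\subset U. \end{align*} Moreover, $\psi$ is given by \begin{align*} \psi(x)=\frac{1}{\omega_n}\Psi(h_{B_1(0)}(\cdot-x)|_U)[\{x\}]\quad\text{for}~ x\in U. \end{align*}
   Context: $U\subset\mathbb{R}^n$ is open convex, $\mathrm{Conv}(U,\mathbb{R})$ the finite-valued convex functions on $U$ (uniform convergence on compacts), $\mathcal{M}(U)$ the complex Radon measures on $U$ (weak*-topology). $\mathrm{VConv}_n(U,\mathcal{M}(U))$ is the space of continuous valuations $\Psi:\mathrm{Conv}(U,\mathbb{R})\to\mathcal{M}(U)$ with $\Psi(f+l)=\Psi(f)$ for affine $l$ and $\Psi(tf)=t^n\Psi(f)$ for $t\ge0$. $\Psi$ is locally determined if $f\equiv h$ on open $V\subset U$ implies $\Psi(f)[B\cap V]=\Psi(h)[B\cap V]$ for relatively compact Borel $B\subset U$. $\mathrm{MA}$ is the real Monge-Amp\`ere measure, $\omega_n$ the volume of the unit ball $B_1(0)$, and $h_{B_1(0)}=|\cdot|$ its support function. *)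

theory Defs
  imports "HOL-Analysis.Analysis"
begin

text \<open>Complex Radon measures on an open set U of R^n, represented by a Jordan
  decomposition into four nonnegative locally finite Borel measures concentrated on U:
  mu = (M1 - M2) + i (M3 - M4).\<close>

type_synonym 'a cmeasure = "'a measure \<times> 'a measure \<times> 'a measure \<times> 'a measure"

definition pos_radon_on :: "'a::euclidean_space set \<Rightarrow> 'a measure \<Rightarrow> bool" where
  "pos_radon_on U M \<longleftrightarrow> sets M = sets borel \<and>
     (\<forall>K. compact K \<and> K \<subseteq> U \<longrightarrow> emeasure M K < \<infinity>) \<and>
     emeasure M (UNIV - U) = 0"

definition cradon_on :: "'a::euclidean_space set \<Rightarrow> 'a cmeasure \<Rightarrow> bool" where
  "cradon_on U \<mu> \<longleftrightarrow> (case \<mu> of (M1, M2, M3, M4) \<Rightarrow>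
     pos_radon_on U M1 \<and> pos_radon_on U M2 \<and> pos_radon_on U M3 \<and> pos_radon_on U M4)"

definition cmeas :: "'a cmeasure \<Rightarrow> 'a set \<Rightarrow> complex" where
  "cmeas \<mu> B = (case \<mu> of (M1, M2, M3, M4) \<Rightarrow>
     Complex (measure M1 B - measure M2 B) (measure M3 B - measure M4 B))"

definition cint :: "'a cmeasure \<Rightarrow> ('a \<Rightarrow> real) \<Rightarrow> complex" where
  "cint \<mu> \<phi> = (case \<mu> of (M1, M2, M3, M4) \<Rightarrow>
     Complex ((\<integral>x. \<phi> x \<partial>M1) - (\<integral>x. \<phi> x \<partial>M2)) ((\<integral>x. \<phi> x \<partial>M3) - (\<integral>x. \<phi> x \<partial>M4)))"

definition relcompact_borel :: "'a::euclidean_space set \<Rightarrow> 'a set \<Rightarrow> bool" where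
  "relcompact_borel U B \<longleftrightarrow> B \<in> sets borel \<and> compact (closure B) \<and> closure B \<subseteq> U"

definition test_fun :: "'a::euclidean_space set \<Rightarrow> ('a \<Rightarrow> real) \<Rightarrow> bool" where
  "test_fun U \<phi> \<longleftrightarrow> continuous_on UNIV \<phi> \<and> compact (closure {x. \<phi> x \<noteq> 0}) \<and>
     closure {x. \<phi> x \<noteq> 0} \<subseteq> U"

definition ceq_on :: "'a::euclidean_space set \<Rightarrow> 'a cmeasure \<Rightarrow> 'a cmeasure \<Rightarrow> bool" where
  "ceq_on U \<mu> \<nu> \<longleftrightarrow> (\<forall>B. relcompact_borel U B \<longrightarrow> cmeas \<mu> B = cmeas \<nu> B)"

definition conv_loc_unif :: "'a::euclidean_space set \<Rightarrow> (nat \<Rightarrow> 'a \<Rightarrow> real) \<Rightarrow> ('a \<Rightarrow> real) \<Rightarrow> bool" where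
  "conv_loc_unif U fs f \<longleftrightarrow> (\<forall>K. compact K \<and> K \<subseteq> U \<longrightarrow> uniform_limit K fs f sequentially)"

text \<open>The valuation space VConv_n(U, M(U)), n = CARD('n).  Continuity is sequential
  continuity, which is equivalent since Conv(U,R) is metrizable.\<close>
definition VConv_meas :: "(real^'n) set \<Rightarrow> ((real^'n \<Rightarrow> real) \<Rightarrow> (real^'n) cmeasure) \<Rightarrow> bool" where
  "VConv_meas U \<Psi> \<longleftrightarrow>
     (\<forall>f. convex_on U f \<longrightarrow> cradon_on U (\<Psi> f)) \<and>
     (\<forall>f g. convex_on U f \<and> convex_on U g \<and> (\<forall>x\<in>U. f x = g x) \<longrightarrow> ceq_on U (\<Psi> f) (\<Psi> g)) \<and>
     (\<forall>f g. convex_on U f \<and> convex_on U g \<and> convex_on U (\<lambda>x. min (f x) (g x)) \<longrightarrow>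
        (\<forall>B. relcompact_borel U B \<longrightarrow>
           cmeas (\<Psi> (\<lambda>x. max (f x) (g x))) B + cmeas (\<Psi> (\<lambda>x. min (f x) (g x))) B
             = cmeas (\<Psi> f) B + cmeas (\<Psi> g) B)) \<and>
     (\<forall>fs f. (\<forall>k. convex_on U (fs k)) \<and> convex_on U f \<and> conv_loc_unif U fs f \<longrightarrow>
        (\<forall>\<phi>. test_fun U \<phi> \<longrightarrow> (\<lambda>k. cint (\<Psi> (fs k)) \<phi>) \<longlonglongrightarrow> cint (\<Psi> f) \<phi>)) \<and>
     (\<forall>f a c. convex_on U f \<longrightarrow> ceq_on U (\<Psi> (\<lambda>x. f x + (a \<bullet> x + c))) (\<Psi> f)) \<and>
     (\<forall>f (t::real). convex_on U f \<and> t \<ge> 0 \<longrightarrow>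
        (\<forall>B. relcompact_borel U B \<longrightarrow>
           cmeas (\<Psi> (\<lambda>x. t * f x)) B = complex_of_real (t ^ CARD('n)) * cmeas (\<Psi> f) B))"

definition locally_determined :: "(real^'n) set \<Rightarrow> ((real^'n \<Rightarrow> real) \<Rightarrow> (real^'n) cmeasure) \<Rightarrow> bool" where
  "locally_determined U \<Psi> \<longleftrightarrow>
     (\<forall>f h V. convex_on U f \<and> convex_on U h \<and> open V \<and> V \<subseteq> U \<and> (\<forall>x\<in>V. f x = h x) \<longrightarrow>
        (\<forall>B. relcompact_borel U B \<longrightarrow> cmeas (\<Psi> f) (B \<inter> V) = cmeas (\<Psi> h) (B \<inter> V)))"

definition subdiff :: "('a::euclidean_space \<Rightarrow> real) \<Rightarrow> 'a set \<Rightarrow> 'a \<Rightarrow> 'a set" where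
  "subdiff f U x = {p. \<forall>y\<in>U. f y \<ge> f x + p \<bullet> (y - x)}"

definition MA :: "'a::euclidean_space set \<Rightarrow> ('a \<Rightarrow> real) \<Rightarrow> 'a measure" where
  "MA U f = measure_of UNIV (sets borel)
     (\<lambda>B. emeasure lebesgue (\<Union>x\<in>B \<inter> U. subdiff f U x))"

definition omega :: "'a::euclidean_space itself \<Rightarrow> real" where
  "omega _ = measure (lborel :: 'a measure) (ball 0 1)"

end

theory Submission
  imports Defs
begin

text \<open>Write \<open>h\<^sub>P\<close> for the support function of a convex body \<open>P\<close>. For a fixed point \<open>x\<close> and a fixed
  test function \<open>\<phi>\<close>, the map \<open>P \<mapsto> \<integral>\<phi> d\<Psi>(h\<^sub>P(\<cdot> - x))\<close> is a translation invariant valuation that is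
  homogeneous of degree \<open>n\<close>. Homogeneity makes it bounded on the subsets of the unit cube: otherwise
  the functions \<open>h\<^bsub>P\<^esub>/k\<close> with \<open>P\<close> in the cube would tend to 0 while their images do not. Cutting \<open>P\<close>
  by a fine grid, the boundary cells then contribute nothing in the limit, and the valuation is a
  multiple of volume. In particular it vanishes on lower dimensional \<open>P\<close>. Near each of its points a
  maximum \<open>f\<close> of finitely many affine functions is a cone \<open>h\<^sub>P(\<cdot> - x)\<close> up to a constant, so by locality
  \<open>\<Psi>(f)\<close> is concentrated on the vertices of \<open>f\<close>, with mass \<open>\<psi>(x)\<close> times the volume of the subdifferential
  at \<open>x\<close>; hence \<open>\<Psi>(f) = \<psi> MA(f)\<close>. Both sides are weakly continuous in \<open>f\<close>, and such maxima are dense.\<close>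

section \<open>Complex Radon measures\<close>

text \<open>Valuation property, affine invariance, homogeneity and locality concern values on
  relatively compact Borel sets, while continuity concerns integrals of test functions. A complex
  measure here is four locally finite measures, possibly of infinite total mass, so both
  translations between the two languages are built to stay within relatively compact sets.

  The obstacle on the way to volume is that the value on lower dimensional bodies is unknown at
  first, so faces cannot be discarded. Half-open grid cells avoid overlaps exactly, and subtracting
  a multiple of volume makes full cells contribute 0; a body enlarged by m then meets only o(m^n)
  cells that count, while homogeneity makes its value scale like m^n.

  The density is read off from the unit cube and not from the ball because the support function of
  the cube is a maximum of finitely many affine functions, to which locality applies; the ball
  returns only when the finished representation is evaluated at |. - x|.

  Monge-Ampere integrals become Lebesgue integrals over slopes, so that their weak continuity is
  dominated convergence on one fixed space.\<close>

lemma relcompact_borel_subset: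
  assumes "relcompact_borel U B" "C \<in> sets borel" "C \<subseteq> B"
  shows "relcompact_borel U C"
proof -
  have "closure C \<subseteq> closure B" using assms(3) by (rule closure_mono)
  moreover have "compact (closure C)"
    using assms(1) calculation closed_closure compact_Int_closed[of "closure B" "closure C"]
    by (simp add: relcompact_borel_def Int_absorb1)
  ultimately show ?thesis using assms by (auto simp: relcompact_borel_def)
qed

lemma relcompact_borel_compact: "compact K \<Longrightarrow> K \<subseteq> U \<Longrightarrow> relcompact_borel U K"
  by (auto simp: relcompact_borel_def closure_closed compact_imp_closed borel_compact)

lemma pos_radon_finite:
  assumes "pos_radon_on U M" "relcompact_borel U B"
  shows "emeasure M B < \<infinity>"
proof -
  have "emeasure M B \<le> emeasure M (closure B)"
    using assms by (intro emeasure_mono closure_subset) (auto simp: pos_radon_on_def)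
  also have "\<dots> < \<infinity>" using assms by (auto simp: pos_radon_on_def relcompact_borel_def)
  finally show ?thesis .
qed

text \<open>Relative compactness of the union keeps all four masses finite; \<open>measure\<close>
  sends infinite mass to 0, and additivity could fail there.\<close>

lemma cmeas_sums:
  assumes mu: "cradon_on U \<mu>" and A: "disjoint_family A" "\<And>i::nat. A i \<in> sets borel"
    and B: "relcompact_borel U (\<Union>i. A i)"
  shows "(\<lambda>i. cmeas \<mu> (A i)) sums cmeas \<mu> (\<Union>i. A i)"
proof -
  have *: "(\<lambda>i. measure M (A i)) sums measure M (\<Union>i. A i)" if "pos_radon_on U M" for M
    using that A pos_radon_finite[OF that B]
    by (intro measure_UNION) (auto simp: pos_radon_on_def)
  obtain M1 M2 M3 M4 where [simp]: "\<mu> = (M1,M2,M3,M4)" by (cases \<mu>)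
  show ?thesis using mu
    by (auto simp: cmeas_def cradon_on_def sums_complex_iff intro!: sums_diff *)
qed

lemma cmeas_empty [simp]: "cmeas \<mu> {} = 0"
  by (cases \<mu>) (auto simp: cmeas_def complex_eq_iff)

lemma cmeas_Un:
  assumes mu: "cradon_on U \<mu>" and "relcompact_borel U A" "relcompact_borel U B" "A \<inter> B = {}"
  shows "cmeas \<mu> (A \<union> B) = cmeas \<mu> A + cmeas \<mu> B"
proof -
  have *: "measure M (A \<union> B) = measure M A + measure M B" if "pos_radon_on U M" for M
    using that assms pos_radon_finite[OF that assms(2)] pos_radon_finite[OF that assms(3)]
    by (intro measure_Union) (auto simp: pos_radon_on_def relcompact_borel_def)
  obtain M1 M2 M3 M4 where [simp]: "\<mu> = (M1,M2,M3,M4)" by (cases \<mu>)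
  show ?thesis using mu
    by (auto simp: cmeas_def cradon_on_def complex_eq_iff *)
qed

text \<open>\<^term>\<open>cint \<mu> \<phi>\<close> is a limit of combinations of values of \<^term>\<open>cmeas \<mu>\<close> that do not depend
  on \<^term>\<open>\<mu>\<close>, so linear relations between set functions carry over to integrals.\<close>

definition level_sum :: "('a \<Rightarrow> real) \<Rightarrow> nat \<Rightarrow> ('a set \<Rightarrow> complex) \<Rightarrow> complex" where
  "level_sum \<phi> k m = (\<Sum>j\<in>range (\<lambda>x. \<lfloor>real (Suc k) * \<phi> x\<rfloor>) - {0}.
     complex_of_real (real_of_int j / real (Suc k)) * m {x. \<lfloor>real (Suc k) * \<phi> x\<rfloor> = j})"

lemma test_fun_bounded:
  assumes "test_fun U \<phi>"
  obtains c where "c \<ge> 0" "\<And>x. \<bar>\<phi> x\<bar> \<le> c"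
proof -
  let ?K = "closure {x. \<phi> x \<noteq> 0}"
  have "compact (\<phi> ` ?K)"
    using assms by (intro compact_continuous_image) (auto simp: test_fun_def intro: continuous_on_subset)
  then have "bounded (\<phi> ` ?K)" by (rule compact_imp_bounded)
  then obtain c where c: "\<forall>y\<in>\<phi> ` ?K. \<bar>y\<bar> \<le> c"
    unfolding bounded_real by blast
  have "\<bar>\<phi> x\<bar> \<le> max c 0" for x
  proof (cases "\<phi> x = 0")
    case False
    then have "x \<in> ?K" using closure_subset[of "{x. \<phi> x \<noteq> 0}"] by auto
    then have "\<bar>\<phi> x\<bar> \<le> c" using c by blast
    then show ?thesis by simp
  qed auto
  then show ?thesis using that[of "max c 0"] by auto
qed

text \<open>Boundedness makes \<open>level_sum\<close> a finite sum; over an infinite index set it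
  would be 0 by convention.\<close>

lemma finite_range_floor:
  assumes "\<And>x. \<bar>\<phi> x\<bar> \<le> (c::real)"
  shows "finite (range (\<lambda>x. \<lfloor>real (Suc k) * \<phi> x\<rfloor>))"
proof -
  have "\<lfloor>real (Suc k) * \<phi> x\<rfloor> \<in> {\<lfloor>- (real (Suc k) * c)\<rfloor>..\<lfloor>real (Suc k) * c\<rfloor>}" for x
  proof -
    have "\<bar>real (Suc k) * \<phi> x\<bar> \<le> real (Suc k) * c"
      using assms[of x] by (auto simp: abs_mult intro: mult_left_mono)
    then have "- (real (Suc k) * c) \<le> real (Suc k) * \<phi> x" "real (Suc k) * \<phi> x \<le> real (Suc k) * c"
      by linarith+
    from this[THEN floor_mono] show ?thesis by (simp only: atLeastAtMost_iff)
  qed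
  then have "range (\<lambda>x. \<lfloor>real (Suc k) * \<phi> x\<rfloor>) \<subseteq> {\<lfloor>- (real (Suc k) * c)\<rfloor>..\<lfloor>real (Suc k) * c\<rfloor>}" by blast
  then show ?thesis by (rule finite_subset) simp
qed

lemma floor_approx:
  "\<bar>real_of_int \<lfloor>real (Suc k) * t\<rfloor> / real (Suc k) - t\<bar> \<le> inverse (real (Suc k))"
proof -
  have "\<bar>real_of_int \<lfloor>real (Suc k) * t\<rfloor> - real (Suc k) * t\<bar> \<le> 1" by linarith
  then have "\<bar>real_of_int \<lfloor>real (Suc k) * t\<rfloor> - real (Suc k) * t\<bar> / real (Suc k) \<le> 1 / real (Suc k)"
    by (intro divide_right_mono) auto
  moreover have "real_of_int \<lfloor>real (Suc k) * t\<rfloor> / real (Suc k) - t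
      = (real_of_int \<lfloor>real (Suc k) * t\<rfloor> - real (Suc k) * t) / real (Suc k)"
    by (simp add: field_simps)
  ultimately show ?thesis by (simp add: inverse_eq_divide)
qed

lemma floor_approx_tendsto:
  "(\<lambda>k. real_of_int \<lfloor>real (Suc k) * t\<rfloor> / real (Suc k)) \<longlonglongrightarrow> t"
proof -
  have "(\<lambda>k. real_of_int \<lfloor>real (Suc k) * t\<rfloor> / real (Suc k) - t) \<longlonglongrightarrow> 0"
    by (rule tendsto_rabs_zero_cancel, rule tendsto_sandwich[OF _ _ tendsto_const LIMSEQ_inverse_real_of_nat])
       (intro always_eventually allI abs_ge_zero floor_approx)+
  then show ?thesis by (rule LIM_zero_cancel)
qed

text \<open>The level 0 contains everything outside the support, so only the other levels are sure
  to be relatively compact; they lie inside the set where \<phi> does not vanish.\<close>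

lemma level_set_relcompact:
  assumes "test_fun U \<phi>" "j \<noteq> 0"
  shows "relcompact_borel U {x. \<lfloor>real (Suc k) * \<phi> x\<rfloor> = j}"
proof (rule relcompact_borel_subset)
  show "relcompact_borel U (closure {x. \<phi> x \<noteq> 0})"
    using assms by (intro relcompact_borel_compact) (auto simp: test_fun_def)
  have [measurable]: "\<phi> \<in> borel_measurable borel"
    using assms by (auto simp: test_fun_def intro: borel_measurable_continuous_onI)
  show "{x. \<lfloor>real (Suc k) * \<phi> x\<rfloor> = j} \<in> sets borel" by measurable
  have "{x. \<lfloor>real (Suc k) * \<phi> x\<rfloor> = j} \<subseteq> {x. \<phi> x \<noteq> 0}" using assms(2) by auto
  then show "{x. \<lfloor>real (Suc k) * \<phi> x\<rfloor> = j} \<subseteq> closure {x. \<phi> x \<noteq> 0}"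
    using closure_subset[of "{x. \<phi> x \<noteq> 0}"] by auto
qed

lemma integral_level_sum:
  fixes M :: "'a::euclidean_space measure"
  assumes phi: "test_fun U \<phi>" and M: "pos_radon_on U M"
  shows "(\<lambda>k. \<Sum>j\<in>range (\<lambda>x. \<lfloor>real (Suc k) * \<phi> x\<rfloor>) - {0}.
     (real_of_int j / real (Suc k)) * measure M {x. \<lfloor>real (Suc k) * \<phi> x\<rfloor> = j})
     \<longlonglongrightarrow> (\<integral>x. \<phi> x \<partial>M)"
proof -
  obtain c where c: "c \<ge> 0" "\<And>x. \<bar>\<phi> x\<bar> \<le> c" by (rule test_fun_bounded[OF phi]) blast
  let ?K = "closure {x. \<phi> x \<noteq> 0}"
  have K: "relcompact_borel U ?K"
    using phi by (intro relcompact_borel_compact) (auto simp: test_fun_def)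
  have sM: "sets M = sets borel" using M by (auto simp: pos_radon_on_def)
  have sp: "space M = UNIV" using sets_eq_imp_space_eq[OF sM] by simp
  have [measurable]: "\<phi> \<in> borel_measurable borel"
    using phi by (auto simp: test_fun_def intro: borel_measurable_continuous_onI)
  define s where "s k x = real_of_int \<lfloor>real (Suc k) * \<phi> x\<rfloor> / real (Suc k)" for k x
  have meas: "\<phi> \<in> borel_measurable M" "s k \<in> borel_measurable M" for k
    unfolding s_def measurable_cong_sets[OF sM refl] by measurable
  have close: "\<bar>s k x - \<phi> x\<bar> \<le> inverse (real (Suc k))" for k x
    unfolding s_def by (rule floor_approx)
  have "(\<lambda>k. \<integral>x. s k x \<partial>M) \<longlonglongrightarrow> (\<integral>x. \<phi> x \<partial>M)"
  \<comment> \<open>Rounding keeps 0 at 0 and moves other values by at most 1/(k+1) \<le> 1, so c +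
    1 on the support dominates every approximant.\<close>
  proof (rule integral_dominated_convergence[where w = "\<lambda>x. (c + 1) * indicator ?K x"])
    show "AE x in M. (\<lambda>k. s k x) \<longlonglongrightarrow> \<phi> x"
      unfolding s_def by (intro AE_I2 floor_approx_tendsto)
    show "AE x in M. norm (s k x) \<le> (c + 1) * indicator ?K x" for k
    proof (intro AE_I2)
      fix x
      show "norm (s k x) \<le> (c + 1) * indicator ?K x"
      proof (cases "\<phi> x = 0")
        case True then show ?thesis using c by (auto simp: s_def indicator_def)
      next
        case False
        then have "x \<in> ?K" using closure_subset[of "{x. \<phi> x \<noteq> 0}"] by auto
        moreover have "inverse (real (Suc k)) \<le> 1" by (simp add: inverse_le_1_iff)
        moreover have "\<bar>s k x\<bar> \<le> c + inverse (real (Suc k))" using close[of k x] c(2)[of x] by linarith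
        ultimately show ?thesis by (simp del: of_nat_Suc)
      qed
    qed
    show "integrable M (\<lambda>x. (c + 1) * indicator ?K x)"
      using pos_radon_finite[OF M K] by (intro integrable_mult_right integrable_real_indicator) (auto simp: sM)
  qed (use meas in auto)
  moreover have "(\<integral>x. s k x \<partial>M) = (\<Sum>j\<in>range (\<lambda>x. \<lfloor>real (Suc k) * \<phi> x\<rfloor>) - {0}.
     (real_of_int j / real (Suc k)) * measure M {x. \<lfloor>real (Suc k) * \<phi> x\<rfloor> = j})" for k
  proof -
    let ?J = "range (\<lambda>x. \<lfloor>real (Suc k) * \<phi> x\<rfloor>) - {0}"
    let ?L = "\<lambda>j. {x. \<lfloor>real (Suc k) * \<phi> x\<rfloor> = j}"
    have fin: "finite ?J" using finite_range_floor[of \<phi>, OF c(2)] by blast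
    have "s k x = (\<Sum>j\<in>?J. (real_of_int j / real (Suc k)) * indicator (?L j) x)" for x
    proof -
      have "(\<Sum>j\<in>?J. (real_of_int j / real (Suc k)) * indicator (?L j) x)
        = (\<Sum>j\<in>?J. if j = \<lfloor>real (Suc k) * \<phi> x\<rfloor> then real_of_int j / real (Suc k) else 0)"
        by (intro sum.cong) (auto simp: indicator_def)
      also have "\<dots> = s k x" using fin by (simp add: sum.delta s_def)
      finally show ?thesis ..
    qed
    then have "(\<integral>x. s k x \<partial>M) = (\<integral>x. (\<Sum>j\<in>?J. (real_of_int j / real (Suc k)) * indicator (?L j) x) \<partial>M)" by simp
    also have "\<dots> = (\<Sum>j\<in>?J. \<integral>x. (real_of_int j / real (Suc k)) * indicator (?L j) x \<partial>M)"
    proof (rule Bochner_Integration.integral_sum)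
      fix j assume "j \<in> ?J"
      then have L: "relcompact_borel U (?L j)" using level_set_relcompact[OF phi] by auto
      show "integrable M (\<lambda>x. (real_of_int j / real (Suc k)) * indicator (?L j) x)"
        using pos_radon_finite[OF M L] L
        by (intro integrable_mult_right integrable_real_indicator) (auto simp: sM relcompact_borel_def)
    qed
    finally show ?thesis by (simp add: sp)
  qed
  ultimately show ?thesis by simp
qed

lemma level_sum_tendsto_cint:
  assumes phi: "test_fun U \<phi>" and mu: "cradon_on U \<mu>"
  shows "(\<lambda>k. level_sum \<phi> k (cmeas \<mu>)) \<longlonglongrightarrow> cint \<mu> \<phi>"
proof -
  obtain M1 M2 M3 M4 where [simp]: "\<mu> = (M1,M2,M3,M4)" by (cases \<mu>)
  have r: "pos_radon_on U M1" "pos_radon_on U M2" "pos_radon_on U M3" "pos_radon_on U M4"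
    using mu by (auto simp: cradon_on_def)
  let ?S = "\<lambda>M k. \<Sum>j\<in>range (\<lambda>x. \<lfloor>real (Suc k) * \<phi> x\<rfloor>) - {0}.
     (real_of_int j / real (Suc k)) * measure M {x. \<lfloor>real (Suc k) * \<phi> x\<rfloor> = j}"
  have ls: "level_sum \<phi> k (cmeas \<mu>) = Complex (?S M1 k - ?S M2 k) (?S M3 k - ?S M4 k)" for k
    by (simp add: level_sum_def cmeas_def complex_eq_iff sum_subtractf[symmetric] right_diff_distrib diff_divide_distrib
        del: of_nat_Suc)
  have ci: "cint \<mu> \<phi> = Complex ((\<integral>x. \<phi> x \<partial>M1) - (\<integral>x. \<phi> x \<partial>M2)) ((\<integral>x. \<phi> x \<partial>M3) - (\<integral>x. \<phi> x \<partial>M4))"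
    by (simp add: cint_def)
  show ?thesis unfolding ls ci by (rule tendsto_Complex[OF
      tendsto_diff[OF integral_level_sum[OF phi r(1)] integral_level_sum[OF phi r(2)]]
      tendsto_diff[OF integral_level_sum[OF phi r(3)] integral_level_sum[OF phi r(4)]]])
qed

lemma level_sum_cong:
  assumes "test_fun U \<phi>" "\<And>B. relcompact_borel U B \<Longrightarrow> m B = m' B"
  shows "level_sum \<phi> k m = level_sum \<phi> k m'"
  unfolding level_sum_def using assms level_set_relcompact[OF assms(1)]
  by (intro sum.cong refl arg_cong2[where f = "(*)"]) auto

lemma level_sum_add: "level_sum \<phi> k (\<lambda>B. m B + m' B) = level_sum \<phi> k m + level_sum \<phi> k m'"
  by (simp add: level_sum_def sum.distrib algebra_simps)

lemma level_sum_mult: "level_sum \<phi> k (\<lambda>B. c * m B) = c * level_sum \<phi> k m"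
  by (simp add: level_sum_def sum_distrib_left algebra_simps)

lemma cint_add_eqI:
  assumes phi: "test_fun U \<phi>" and r: "cradon_on U a" "cradon_on U b" "cradon_on U c" "cradon_on U d"
    and eq: "\<And>B. relcompact_borel U B \<Longrightarrow> cmeas a B + cmeas b B = cmeas c B + cmeas d B"
  shows "cint a \<phi> + cint b \<phi> = cint c \<phi> + cint d \<phi>"
proof -
  have lim: "(\<lambda>k. level_sum \<phi> k (cmeas a) + level_sum \<phi> k (cmeas b)) \<longlonglongrightarrow> cint a \<phi> + cint b \<phi>"
       "(\<lambda>k. level_sum \<phi> k (cmeas c) + level_sum \<phi> k (cmeas d)) \<longlonglongrightarrow> cint c \<phi> + cint d \<phi>"
    by (intro tendsto_add level_sum_tendsto_cint[OF phi] r)+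
  have eq: "level_sum \<phi> k (cmeas a) + level_sum \<phi> k (cmeas b)
      = level_sum \<phi> k (cmeas c) + level_sum \<phi> k (cmeas d)" for k
    using level_sum_cong[OF phi eq, where k = k] by (simp add: level_sum_add)
  show ?thesis by (rule LIMSEQ_unique[OF lim(1)[unfolded eq] lim(2)])
qed

lemma cint_scaleI:
  assumes phi: "test_fun U \<phi>" and r: "cradon_on U a" "cradon_on U b"
    and eq: "\<And>B. relcompact_borel U B \<Longrightarrow> cmeas a B = c * cmeas b B"
  shows "cint a \<phi> = c * cint b \<phi>"
proof -
  have lim: "(\<lambda>k. level_sum \<phi> k (cmeas a)) \<longlonglongrightarrow> cint a \<phi>"
       "(\<lambda>k. c * level_sum \<phi> k (cmeas b)) \<longlonglongrightarrow> c * cint b \<phi>"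
    by (intro tendsto_mult tendsto_const level_sum_tendsto_cint[OF phi] r)+
  have eq: "level_sum \<phi> k (cmeas a) = c * level_sum \<phi> k (cmeas b)" for k
    using level_sum_cong[OF phi eq, where k = k] by (simp add: level_sum_mult)
  show ?thesis by (rule LIMSEQ_unique[OF lim(1)[unfolded eq] lim(2)])
qed

text \<open>Among the level sets only the one through x carries mass, so the level sum is the
  rounded value of \<phi> at x times c.\<close>

lemma cint_point_mass:
  assumes phi: "test_fun U \<phi>" and r: "cradon_on U a"
    and eq: "\<And>B. relcompact_borel U B \<Longrightarrow> cmeas a B = (if x \<in> B then c else 0)"
  shows "cint a \<phi> = complex_of_real (\<phi> x) * c"
proof -
  obtain b where b: "\<And>x. \<bar>\<phi> x\<bar> \<le> b" by (rule test_fun_bounded[OF phi]) blast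
  have "level_sum \<phi> k (cmeas a) = complex_of_real (real_of_int \<lfloor>real (Suc k) * \<phi> x\<rfloor> / real (Suc k)) * c" for k
  proof -
    let ?J = "range (\<lambda>x. \<lfloor>real (Suc k) * \<phi> x\<rfloor>) - {0}"
    have fin: "finite ?J" using finite_range_floor[of \<phi>, OF b] by blast
    have "level_sum \<phi> k (cmeas a) = level_sum \<phi> k (\<lambda>B. if x \<in> B then c else 0)"
      by (rule level_sum_cong[OF phi eq])
    also have "\<dots> = (\<Sum>j\<in>?J. if j = \<lfloor>real (Suc k) * \<phi> x\<rfloor>
        then complex_of_real (real_of_int j / real (Suc k)) * c else 0)"
      unfolding level_sum_def by (intro sum.cong) auto
    also have "\<dots> = (if \<lfloor>real (Suc k) * \<phi> x\<rfloor> \<in> ?J then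
        complex_of_real (real_of_int \<lfloor>real (Suc k) * \<phi> x\<rfloor> / real (Suc k)) * c else 0)"
      using fin by (rule sum.delta)
    \<comment> \<open>If \<phi> x is rounded to 0, the level through x is excluded from the sum,
      which agrees with the coefficient 0.\<close>
    finally show ?thesis by (cases "\<lfloor>real (Suc k) * \<phi> x\<rfloor> = 0") (simp_all del: of_nat_Suc)
  qed
  moreover have "(\<lambda>k. complex_of_real (real_of_int \<lfloor>real (Suc k) * \<phi> x\<rfloor> / real (Suc k)) * c)
     \<longlonglongrightarrow> complex_of_real (\<phi> x) * c"
    by (intro tendsto_mult tendsto_of_real tendsto_const floor_approx_tendsto)
  ultimately have "(\<lambda>k. level_sum \<phi> k (cmeas a)) \<longlonglongrightarrow> complex_of_real (\<phi> x) * c" by (simp only:)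
  then show ?thesis
    using LIMSEQ_unique[OF level_sum_tendsto_cint[OF phi r]] by blast
qed

section \<open>Determining a complex measure locally and by test functions\<close>

text \<open>Locality of a valuation yields equalities near each point only. B need not be compact,
  so a countable subcover is taken from Lindelof's theorem, made disjoint, and the pieces are summed
  by countable additivity.\<close>

lemma cmeas_eq_if_locally_eq:
  assumes mu: "cradon_on U \<mu>" "cradon_on U \<nu>" and B: "relcompact_borel U B"
    and cover: "\<And>y. y \<in> B \<Longrightarrow> \<exists>V. open V \<and> y \<in> V \<and>
      (\<forall>C. relcompact_borel U C \<and> C \<subseteq> V \<inter> B \<longrightarrow> cmeas \<mu> C = cmeas \<nu> C)"
  shows "cmeas \<mu> B = cmeas \<nu> B"
proof -
  let ?F = "{V. open V \<and> (\<forall>C. relcompact_borel U C \<and> C \<subseteq> V \<inter> B \<longrightarrow> cmeas \<mu> C = cmeas \<nu> C)}"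
  obtain F' where F': "F' \<subseteq> ?F" "countable F'" "\<Union>F' = \<Union>?F"
  proof (rule Lindelof[of ?F])
    show "open S" if "S \<in> ?F" for S using that by blast
  qed
  have BF: "B \<subseteq> \<Union>F'" unfolding F'(3) using cover by blast
  show ?thesis
  proof (cases "F' = {}")
    case True then show ?thesis using BF by auto
  next
    case False
    define V where "V = from_nat_into F'"
    have V: "V i \<in> ?F" for i using F'(1) from_nat_into[OF False] by (auto simp: V_def)
    have rV: "range V = F'" using F'(2) False by (simp add: V_def range_from_nat_into)
    define A where "A i = disjointed V i \<inter> B" for i
    have Bs: "B \<in> sets borel" using B by (auto simp: relcompact_borel_def)
    have "disjointed V i \<in> sets borel" for i
      using V by (intro sets.range_disjointed_sets[of V borel, THEN subsetD]) auto
    then have As: "A i \<in> sets borel" for i using Bs by (auto simp: A_def)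
    have dis: "disjoint_family A"
      using disjoint_family_disjointed[of V] by (auto simp: A_def disjoint_family_on_def)
    have U: "(\<Union>i. A i) = B" using BF rV UN_disjointed_eq[of V] by (auto simp: A_def)
    have s: "(\<lambda>i. cmeas \<mu> (A i)) sums cmeas \<mu> B" "(\<lambda>i. cmeas \<nu> (A i)) sums cmeas \<nu> B"
      using cmeas_sums[OF mu(1) dis As] cmeas_sums[OF mu(2) dis As] B U by auto
    have "cmeas \<mu> (A i) = cmeas \<nu> (A i)" for i
    proof -
      have "A i \<subseteq> V i \<inter> B" using disjointed_subset[of V i] by (auto simp: A_def)
      moreover have "relcompact_borel U (A i)"
        using relcompact_borel_subset[OF B As] by (auto simp: A_def)
      ultimately show ?thesis using V[of i] by blast
    qed
    then show ?thesis using s sums_unique2 by simp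
  qed
qed

text \<open>Tent functions of growing slope around C decrease to its indicator. A single sequence
  serves all measures at once, as it has to: a complex measure has four parts, and two complex
  measures are compared along it.\<close>

lemma compact_indicator_approx:
  fixes C U :: "'a::euclidean_space set"
  assumes "open U" "compact C" "C \<subseteq> U" "C \<noteq> {}"
  obtains \<phi> :: "nat \<Rightarrow> 'a \<Rightarrow> real" where "\<And>k. test_fun U (\<phi> k)"
    "\<And>M. pos_radon_on U M \<Longrightarrow> (\<lambda>k. \<integral>x. \<phi> k x \<partial>M) \<longlonglongrightarrow> measure M C"
proof -
  obtain e where e: "e > 0" "(\<Union>x\<in>C. cball x e) \<subseteq> U"
    using compact_subset_open_imp_cball_epsilon_subset[OF assms(2,1,3)] .
  define K where "K = {x. infdist x C \<le> e}"
  have K: "compact K" unfolding K_def by (intro compact_infdist_le assms e)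
  have KU: "K \<subseteq> U"
  proof
    fix x assume "x \<in> K"
    obtain y where "y \<in> C" "infdist x C = dist x y"
      using infdist_attains_inf[of C x] assms compact_imp_closed by blast
    then have "x \<in> cball y e" using \<open>x \<in> K\<close> by (auto simp: K_def dist_commute)
    then show "x \<in> U" using e \<open>y \<in> C\<close> by blast
  qed
  \<comment> \<open>The summand 1/e confines the support to the closed e-neighbourhood K already for
    k = 0; the summand k lets the tents shrink to C. Since \<open>infdist\<close> to the empty set
    is 0, C is taken nonempty.\<close>
  define \<phi> where "\<phi> k x = max 0 (1 - (real k + 1/e) * infdist x C)" for k x
  have out: "x \<in> K" if "\<phi> k x \<noteq> 0" for k x
  proof -
    have "(real k + 1/e) * infdist x C < 1" using that by (auto simp: \<phi>_def max_def split: if_splits)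
    moreover have "(1/e) * infdist x C \<le> (real k + 1/e) * infdist x C"
      by (intro mult_right_mono infdist_nonneg) auto
    ultimately show ?thesis using e by (auto simp: K_def field_simps)
  qed
  have cont: "continuous_on UNIV (\<phi> k)" for k
    unfolding \<phi>_def by (intro continuous_intros)
  have test: "test_fun U (\<phi> k)" for k
  proof -
    have "closure {x. \<phi> k x \<noteq> 0} \<subseteq> K"
      using out by (intro closure_minimal compact_imp_closed K) auto
    then show ?thesis using cont K KU compact_Int_closed[OF K closed_closure[of "{x. \<phi> k x \<noteq> 0}"]]
      unfolding test_fun_def by (auto simp: Int_absorb1)
  qed
  have bnd: "\<bar>\<phi> k x\<bar> \<le> indicator K x" for k x
  proof (cases "x \<in> K")
    case True
    have "(real k + 1/e) * infdist x C \<ge> 0" using e infdist_nonneg by (intro mult_nonneg_nonneg) auto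
    then show ?thesis using True by (auto simp: \<phi>_def)
  next
    case False then show ?thesis using out by fastforce
  qed
  have lim: "(\<lambda>k. \<phi> k x) \<longlonglongrightarrow> indicator C x" for x
  proof (cases "x \<in> C")
    case True then show ?thesis by (auto simp: \<phi>_def)
  next
    case False
    then have pos: "infdist x C > 0"
      using assms compact_imp_closed by (metis in_closed_iff_infdist_zero infdist_nonneg order_le_less)
    obtain N where N: "real N > 1 / infdist x C" using reals_Archimedean2 by blast
    have "\<phi> k x = 0" if "k \<ge> N" for k
    proof -
      have "1 / infdist x C \<le> real k + 1/e" using N that e by (smt (verit) of_nat_le_iff zero_le_divide_1_iff)
      then have "1 \<le> (real k + 1/e) * infdist x C" using pos by (simp add: field_simps)
      then show ?thesis by (auto simp: \<phi>_def)
    qed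
    then have "eventually (\<lambda>k. \<phi> k x = 0) sequentially" by (auto simp: eventually_sequentially)
    then show ?thesis using False by (simp add: tendsto_eventually)
  qed
  have "(\<lambda>k. \<integral>x. \<phi> k x \<partial>M) \<longlonglongrightarrow> measure M C" if M: "pos_radon_on U M" for M
  proof -
    have sM: "sets M = sets borel" using M by (auto simp: pos_radon_on_def)
    have sp: "space M = UNIV" using sets_eq_imp_space_eq[OF sM] by simp
    have [measurable]: "\<phi> k \<in> borel_measurable M" for k
      unfolding measurable_cong_sets[OF sM refl] using cont by (rule borel_measurable_continuous_onI)
    have "(\<lambda>k. \<integral>x. \<phi> k x \<partial>M) \<longlonglongrightarrow> (\<integral>x. indicator C x \<partial>M)"
    proof (rule integral_dominated_convergence[where w = "indicator K"])
      show "integrable M (indicator K :: _ \<Rightarrow> real)"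
        using pos_radon_finite[OF M relcompact_borel_compact[OF K KU]] K
        by (intro integrable_real_indicator) (auto simp: sM borel_compact)
      show "indicator C \<in> borel_measurable M"
        using assms by (intro borel_measurable_indicator) (auto simp: sM borel_compact)
    qed (use bnd lim in auto)
    then show ?thesis by (simp add: sp)
  qed
  then show ?thesis using that test by blast
qed

lemma cint_tendsto_cmeas_compact:
  fixes C U :: "'a::euclidean_space set"
  assumes "open U" "compact C" "C \<subseteq> U" "C \<noteq> {}"
  obtains \<phi> :: "nat \<Rightarrow> 'a \<Rightarrow> real" where "\<And>k. test_fun U (\<phi> k)"
    "\<And>\<mu>. cradon_on U \<mu> \<Longrightarrow> (\<lambda>k. cint \<mu> (\<phi> k)) \<longlonglongrightarrow> cmeas \<mu> C"
proof -
  obtain \<phi> :: "nat \<Rightarrow> 'a \<Rightarrow> real" where phi: "\<And>k. test_fun U (\<phi> k)"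
    "\<And>M. pos_radon_on U M \<Longrightarrow> (\<lambda>k. \<integral>x. \<phi> k x \<partial>M) \<longlonglongrightarrow> measure M C"
    using compact_indicator_approx[OF assms] by metis
  show ?thesis
  proof (rule that[OF phi(1)])
    fix \<mu> :: "'a cmeasure" assume "cradon_on U \<mu>"
    moreover obtain M1 M2 M3 M4 where [simp]: "\<mu> = (M1,M2,M3,M4)" by (cases \<mu>)
    ultimately have "pos_radon_on U M1" "pos_radon_on U M2" "pos_radon_on U M3" "pos_radon_on U M4"
      by (auto simp: cradon_on_def)
    then show "(\<lambda>k. cint \<mu> (\<phi> k)) \<longlonglongrightarrow> cmeas \<mu> C"
      by (simp add: cint_def cmeas_def) (intro tendsto_Complex tendsto_diff phi; assumption)
  qed
qed

text \<open>Test integrals determine the values on compact sets, and Dynkin's argument with the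
  closed sets as generator passes to Borel sets. Everything is intersected with the closure K of B,
  and complements are formed inside K, so that all masses stay finite.\<close>

lemma ceq_on_if_cint_eq:
  fixes U :: "'a::euclidean_space set"
  assumes U: "open U" and r: "cradon_on U \<mu>" "cradon_on U \<nu>"
    and eq: "\<And>\<phi>. test_fun U \<phi> \<Longrightarrow> cint \<mu> \<phi> = cint \<nu> \<phi>"
  shows "ceq_on U \<mu> \<nu>"
proof -
  have comp: "cmeas \<mu> C = cmeas \<nu> C" if C: "compact C" "C \<subseteq> U" for C
  proof (cases "C = {}")
    case False
    obtain \<phi> :: "nat \<Rightarrow> 'a \<Rightarrow> real" where phi: "\<And>k. test_fun U (\<phi> k)"
      "\<And>\<mu>. cradon_on U \<mu> \<Longrightarrow> (\<lambda>k. cint \<mu> (\<phi> k)) \<longlonglongrightarrow> cmeas \<mu> C"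
      using cint_tendsto_cmeas_compact[OF U C False] by metis
    have "(\<lambda>k. cint \<mu> (\<phi> k)) = (\<lambda>k. cint \<nu> (\<phi> k))" using eq phi(1) by blast
    then show ?thesis using phi(2)[OF r(1)] phi(2)[OF r(2)] LIMSEQ_unique by metis
  qed auto
  have "cmeas \<mu> B = cmeas \<nu> B" if B: "relcompact_borel U B" for B
  proof -
    define K where "K = closure B"
    have K: "compact K" "K \<subseteq> U" using B by (auto simp: K_def relcompact_borel_def)
    have Kr: "relcompact_borel U K" by (rule relcompact_borel_compact[OF K])
    have sub: "relcompact_borel U (A \<inter> K)" if "A \<in> sets borel" for A
      using that Kr by (intro relcompact_borel_subset[OF Kr]) (auto simp: relcompact_borel_def)
    have stab: "Int_stable {S :: 'a set. closed S}" "{S :: 'a set. closed S} \<subseteq> Pow UNIV"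
      by (auto simp: Int_stable_def closed_Int)
    have "B \<in> sigma_sets UNIV {S. closed S}"
      using B by (simp add: relcompact_borel_def borel_eq_closed)
    with stab have "cmeas \<mu> (B \<inter> K) = cmeas \<nu> (B \<inter> K)"
    proof (induction rule: sigma_sets_induct_disjoint)
      case (basic A) then show ?case using K by (intro comp) (auto intro: compact_Int_closed simp: Int_commute)
    next
      case empty then show ?case by simp
    next
      case (compl A)
      have A: "A \<in> sets borel" using compl(1) by (simp add: borel_eq_closed)
      have *: "cmeas m K = cmeas m (A \<inter> K) + cmeas m ((UNIV - A) \<inter> K)" if "cradon_on U m" for m
      proof -
        have "cmeas m (A \<inter> K \<union> (UNIV - A) \<inter> K) = cmeas m (A \<inter> K) + cmeas m ((UNIV - A) \<inter> K)"
          using A by (intro cmeas_Un[OF that] sub) auto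
        moreover have "A \<inter> K \<union> (UNIV - A) \<inter> K = K" by blast
        ultimately show ?thesis by simp
      qed
      show ?case using *[OF r(1)] *[OF r(2)] comp[OF K] compl(2) by simp
    next
      case (union A)
      have A: "A i \<in> sets borel" for i using union(2) by (auto simp: borel_eq_closed)
      have dis: "disjoint_family (\<lambda>i. A i \<inter> K)" using union(1) by (auto simp: disjoint_family_on_def)
      have "(\<lambda>i. cmeas m (A i \<inter> K)) sums cmeas m (\<Union>i. A i \<inter> K)" if "cradon_on U m" for m
        using A Kr by (intro cmeas_sums[OF that dis] relcompact_borel_subset[OF Kr])
          (auto simp: relcompact_borel_def)
      from this[OF r(1)] this[OF r(2)] show ?case using union(3) sums_unique2 by auto
    qed
    moreover have "B \<inter> K = B" using closure_subset[of B] by (auto simp: K_def)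
    ultimately show ?thesis by simp
  qed
  then show ?thesis by (auto simp: ceq_on_def)
qed

section \<open>Complex measures with a continuous density\<close>

text \<open>Positive and negative parts of \<open>Re\<close> and \<open>Im\<close> serve as the four
  densities. The cut-off to U is there because \<psi> is arbitrary outside U and need not be
  measurable on the whole space.\<close>

definition density_cmeasure :: "'a::euclidean_space set \<Rightarrow> 'a measure \<Rightarrow> ('a \<Rightarrow> complex) \<Rightarrow> 'a cmeasure" where
  "density_cmeasure U M \<psi> =
    (density M (\<lambda>x. ennreal (max 0 (Re (indicator U x *\<^sub>R \<psi> x)))), density M (\<lambda>x. ennreal (max 0 (- Re (indicator U x *\<^sub>R \<psi> x)))),
     density M (\<lambda>x. ennreal (max 0 (Im (indicator U x *\<^sub>R \<psi> x)))), density M (\<lambda>x. ennreal (max 0 (- Im (indicator U x *\<^sub>R \<psi> x)))))"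

lemma pos_radon_density:
  fixes g :: "'a::euclidean_space \<Rightarrow> real"
  assumes M: "pos_radon_on U M" and g: "g \<in> borel_measurable borel" "continuous_on U g" "\<And>x. x \<notin> U \<Longrightarrow> g x = 0"
    and U: "open U"
  shows "pos_radon_on U (density M (\<lambda>x. ennreal (g x)))"
proof -
  have sM: "sets M = sets borel" using M by (auto simp: pos_radon_on_def)
  have [measurable]: "g \<in> borel_measurable M" unfolding measurable_cong_sets[OF sM refl] by (rule g)
  have "emeasure (density M (\<lambda>x. ennreal (g x))) K < \<infinity>" if K: "compact K" "K \<subseteq> U" for K
  proof -
    have Ks: "K \<in> sets M" using K by (simp add: sM borel_compact)
    have "compact (g ` K)" using K g by (auto intro!: compact_continuous_image intro: continuous_on_subset)
    then obtain c where c: "\<forall>y\<in>g ` K. \<bar>y\<bar> \<le> c"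
      using compact_imp_bounded[of "g ` K"] unfolding bounded_real by blast
    have "emeasure (density M (\<lambda>x. ennreal (g x))) K = (\<integral>\<^sup>+x. ennreal (g x) * indicator K x \<partial>M)"
      using Ks by (intro emeasure_density) auto
    also have "\<dots> \<le> (\<integral>\<^sup>+x. ennreal c * indicator K x \<partial>M)"
      using c by (intro nn_integral_mono) (auto simp: indicator_def intro!: ennreal_leI)
    also have "\<dots> = ennreal c * emeasure M K" using Ks by (simp add: nn_integral_cmult_indicator)
    also have "\<dots> < \<infinity>" using M K by (auto simp: pos_radon_on_def ennreal_mult_less_top)
    finally show ?thesis .
  qed
  moreover have "emeasure (density M (\<lambda>x. ennreal (g x))) (UNIV - U) = 0"
  proof -
    have "UNIV - U \<in> sets M" using U unfolding sM by (intro sets.Diff) auto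
    then have "emeasure (density M (\<lambda>x. ennreal (g x))) (UNIV - U) = (\<integral>\<^sup>+x. ennreal (g x) * indicator (UNIV - U) x \<partial>M)"
      by (intro emeasure_density) auto
    also have "\<dots> = (\<integral>\<^sup>+x. 0 \<partial>M)" by (intro nn_integral_cong) (auto simp: indicator_def g)
    finally show ?thesis by simp
  qed
  ultimately show ?thesis using sM by (simp add: pos_radon_on_def)
qed

lemma measurable_indicator_psi:
  fixes \<psi> :: "'a::euclidean_space \<Rightarrow> complex"
  assumes "open U" "continuous_on U \<psi>"
  shows "(\<lambda>x. indicator U x *\<^sub>R \<psi> x) \<in> borel_measurable borel"
  using assms by (intro borel_measurable_continuous_on_indicator) auto

lemma cradon_density:
  fixes \<psi> :: "'a::euclidean_space \<Rightarrow> complex"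
  assumes U: "open U" and M: "pos_radon_on U M" and psi: "continuous_on U \<psi>"
  shows "cradon_on U (density_cmeasure U M \<psi>)"
proof -
  have *: "pos_radon_on U (density M (\<lambda>x. ennreal (max 0 (h (indicator U x *\<^sub>R \<psi> x)))))"
    if h: "continuous_on UNIV h" "h 0 = 0" for h :: "complex \<Rightarrow> real"
  proof (rule pos_radon_density[OF M _ _ _ U])
    have hm: "h \<in> borel_measurable borel" using h(1) by (rule borel_measurable_continuous_onI)
    have "(\<lambda>x. h (indicator U x *\<^sub>R \<psi> x)) \<in> borel_measurable borel"
      by (rule measurable_compose[OF measurable_indicator_psi[OF U psi] hm])
    then show "(\<lambda>x. max 0 (h (indicator U x *\<^sub>R \<psi> x))) \<in> borel_measurable borel"
      by (intro borel_measurable_max) auto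
    have "continuous_on U (\<lambda>x. h (\<psi> x))"
      using continuous_on_compose2[OF h(1) psi] by simp
    then have "continuous_on U (\<lambda>x. max 0 (h (\<psi> x)))" by (intro continuous_intros)
    then show "continuous_on U (\<lambda>x. max 0 (h (indicator U x *\<^sub>R \<psi> x)))"
      by (rule continuous_on_eq) simp
  qed (use h in simp)
  show ?thesis unfolding density_cmeasure_def cradon_on_def
    using *[of Re] *[of "\<lambda>z. - Re z"] *[of Im] *[of "\<lambda>z. - Im z"] by (simp add: continuous_intros)
qed

text \<open>Stated for bounded Borel u vanishing off a compact subset of U, which covers both test
  functions and indicators of relatively compact Borel sets.\<close>

lemma integral_density_cmeasure:
  fixes \<psi> :: "'a::euclidean_space \<Rightarrow> complex" and u :: "'a \<Rightarrow> real"
  assumes U: "open U" and M: "pos_radon_on U M" and psi: "continuous_on U \<psi>"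
    and u: "u \<in> borel_measurable borel" "\<And>x. \<bar>u x\<bar> \<le> c" "\<And>x. x \<notin> K \<Longrightarrow> u x = 0" and K: "compact K" "K \<subseteq> U"
  shows "cint (density_cmeasure U M \<psi>) u = (\<integral>x. u x *\<^sub>R \<psi> x \<partial>M)"
proof -
  have sM: "sets M = sets borel" using M by (auto simp: pos_radon_on_def)
  define \<psi>' where "\<psi>' x = indicator U x *\<^sub>R \<psi> x" for x
  have [measurable]: "\<psi>' \<in> borel_measurable M" "u \<in> borel_measurable M"
    unfolding measurable_cong_sets[OF sM refl] \<psi>'_def using measurable_indicator_psi[OF U psi] u by auto
  define w where "w x = u x *\<^sub>R \<psi>' x" for x
  have [measurable]: "w \<in> borel_measurable M" unfolding w_def by measurable
  have "compact (\<psi> ` K)" using K psi by (auto intro!: compact_continuous_image intro: continuous_on_subset)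
  then obtain b where b: "\<forall>y\<in>\<psi> ` K. norm y \<le> b"
    using compact_imp_bounded[of "\<psi> ` K"] unfolding bounded_iff by blast
  have wb: "norm (w x) \<le> norm (c * b * indicator K x)" for x
  proof (cases "x \<in> K")
    case True
    then have "norm (\<psi>' x) \<le> b" using b K by (auto simp: \<psi>'_def)
    then have "\<bar>u x\<bar> * norm (\<psi>' x) \<le> c * b" using u(2)[of x] by (intro mult_mono) auto
    then show ?thesis using True by (simp add: w_def)
  next
    case False then show ?thesis using u(3) by (simp add: w_def)
  qed
  have "integrable M (\<lambda>x. c * b * indicator K x)"
    using pos_radon_finite[OF M relcompact_borel_compact[OF K]] K
    by (intro integrable_mult_right integrable_real_indicator) (auto simp: sM borel_compact)
  then have iw: "integrable M w"
    by (rule Bochner_Integration.integrable_bound) (use wb in auto)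
  have int: "integrable M (\<lambda>x. max 0 (h (\<psi>' x)) *\<^sub>R u x)"
    if "\<And>z. \<bar>h z\<bar> \<le> norm z" "h \<in> borel_measurable borel" for h :: "complex \<Rightarrow> real"
  proof (rule Bochner_Integration.integrable_bound[OF iw])
    have [measurable]: "(\<lambda>x. h (\<psi>' x)) \<in> borel_measurable M" by (rule measurable_compose[OF _ that(2)]) measurable
    show "(\<lambda>x. max 0 (h (\<psi>' x)) *\<^sub>R u x) \<in> borel_measurable M" by measurable
    have "\<bar>max 0 (h z)\<bar> \<le> norm z" for z using that(1)[of z] by auto
    then show "AE x in M. norm (max 0 (h (\<psi>' x)) *\<^sub>R u x) \<le> norm (w x)"
      by (intro AE_I2) (simp add: w_def abs_mult mult.commute mult_left_mono)
  qed
  have dens: "(\<integral>x. u x \<partial>density M (\<lambda>x. ennreal (max 0 (h (\<psi>' x))))) = (\<integral>x. max 0 (h (\<psi>' x)) *\<^sub>R u x \<partial>M)"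
    if "h \<in> borel_measurable borel" for h :: "complex \<Rightarrow> real"
  proof (rule integral_density)
    have [measurable]: "(\<lambda>x. h (\<psi>' x)) \<in> borel_measurable M" by (rule measurable_compose[OF _ that]) measurable
    show "(\<lambda>x. max 0 (h (\<psi>' x))) \<in> borel_measurable M" by measurable
  qed auto
  \<comment> \<open>Here h stands for \<open>Re\<close> or \<open>Im\<close>, for which real
    homogeneity lets u x move inside; the two densities recombine because max 0 t - max 0 (-t) =
    t.\<close>
  have part: "(\<integral>x. u x \<partial>density M (\<lambda>x. ennreal (max 0 (h (\<psi>' x))))) - (\<integral>x. u x \<partial>density M (\<lambda>x. ennreal (max 0 (- h (\<psi>' x)))))
      = (\<integral>x. h (w x) \<partial>M)"
    if h: "\<And>z. \<bar>h z\<bar> \<le> norm z" "h \<in> borel_measurable borel" "\<And>r z. h (r *\<^sub>R z) = r * h z" for h :: "complex \<Rightarrow> real"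
  proof -
    have h': "\<And>z. \<bar>- h z\<bar> \<le> norm z" "(\<lambda>z. - h z) \<in> borel_measurable borel" using h by auto
    have "(\<integral>x. max 0 (h (\<psi>' x)) *\<^sub>R u x \<partial>M) - (\<integral>x. max 0 (- h (\<psi>' x)) *\<^sub>R u x \<partial>M)
      = (\<integral>x. max 0 (h (\<psi>' x)) *\<^sub>R u x - max 0 (- h (\<psi>' x)) *\<^sub>R u x \<partial>M)"
      by (intro Bochner_Integration.integral_diff[symmetric] int[OF h(1,2)] int[OF h'])
    also have "\<dots> = (\<integral>x. h (w x) \<partial>M)"
      by (intro Bochner_Integration.integral_cong) (auto simp: w_def h(3) max_def algebra_simps)
    finally show ?thesis using dens[OF h(2)] dens[OF h'(2)] by simp
  qed
  have "cint (density_cmeasure U M \<psi>) u = Complex (\<integral>x. Re (w x) \<partial>M) (\<integral>x. Im (w x) \<partial>M)"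
    unfolding cint_def density_cmeasure_def
    using part[of Re] part[of Im] by (simp add: \<psi>'_def abs_Re_le_cmod abs_Im_le_cmod)
  also have "\<dots> = (\<integral>x. w x \<partial>M)"
    using iw by (simp add: complex_eq_iff)
  also have "\<dots> = (\<integral>x. u x *\<^sub>R \<psi> x \<partial>M)"
  proof (rule Bochner_Integration.integral_cong[OF refl])
    fix x show "w x = u x *\<^sub>R \<psi> x" using u(3)[of x] K by (cases "x \<in> K") (auto simp: w_def \<psi>'_def)
  qed
  finally show ?thesis .
qed

lemma cint_density_cmeasure:
  fixes \<psi> :: "'a::euclidean_space \<Rightarrow> complex"
  assumes "open U" "pos_radon_on U M" "continuous_on U \<psi>" "test_fun U \<phi>"
  shows "cint (density_cmeasure U M \<psi>) \<phi> = (\<integral>x. \<phi> x *\<^sub>R \<psi> x \<partial>M)"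
proof -
  obtain c where c: "\<And>x. \<bar>\<phi> x\<bar> \<le> c" by (rule test_fun_bounded[OF assms(4)]) blast
  show ?thesis
  proof (rule integral_density_cmeasure[OF assms(1-3) _ c])
    show "\<phi> \<in> borel_measurable borel"
      using assms(4) by (auto simp: test_fun_def intro: borel_measurable_continuous_onI)
    show "\<phi> x = 0" if "x \<notin> closure {x. \<phi> x \<noteq> 0}" for x
      using that closure_subset[of "{x. \<phi> x \<noteq> 0}"] by auto
  qed (use assms(4) in \<open>auto simp: test_fun_def\<close>)
qed

lemma cmeas_density_cmeasure:
  fixes \<psi> :: "'a::euclidean_space \<Rightarrow> complex"
  assumes "open U" "pos_radon_on U M" "continuous_on U \<psi>" "relcompact_borel U B"
  shows "cmeas (density_cmeasure U M \<psi>) B = set_lebesgue_integral M B \<psi>"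
proof -
  have sp: "space M = UNIV" using assms(2) sets_eq_imp_space_eq[of M borel] by (simp add: pos_radon_on_def)
  have "cmeas (density_cmeasure U M \<psi>) B = cint (density_cmeasure U M \<psi>) (indicator B)"
    by (simp add: cmeas_def cint_def density_cmeasure_def sp)
  also have "\<dots> = (\<integral>x. indicator B x *\<^sub>R \<psi> x \<partial>M)"
  proof (rule integral_density_cmeasure[OF assms(1-3), where c = 1 and K = "closure B"])
    show "indicator B x = (0::real)" if "x \<notin> closure B" for x
      using that closure_subset[of B] by (auto simp: indicator_def)
  qed (use assms(4) in \<open>auto simp: relcompact_borel_def indicator_def\<close>)
  finally show ?thesis by (simp add: set_lebesgue_integral_def)
qed

text \<open>Off y the set C is null, so only the atom counts. Measurability is asked of g cut off to
  C because the densities to come are controlled on U only.\<close>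

lemma integral_concentrated:
  fixes g :: "'a::euclidean_space \<Rightarrow> complex"
  assumes M: "sets M = sets borel" and C: "C \<in> sets borel" and null: "emeasure M (C - {y}) = 0"
    and fin: "emeasure M {y} < \<infinity>" and g: "(\<lambda>x. indicator C x *\<^sub>R g x) \<in> borel_measurable borel"
  shows "(\<integral>x. indicator C x *\<^sub>R g x \<partial>M) = measure M (C \<inter> {y}) *\<^sub>R g y"
proof -
  have sp: "space M = UNIV" using sets_eq_imp_space_eq[OF M] by simp
  have ae: "AE x in M. indicator C x *\<^sub>R g x = indicator (C \<inter> {y}) x *\<^sub>R g y"
  proof (rule AE_I[OF _ null])
    show "C - {y} \<in> sets M" using C unfolding M by (intro sets.Diff) auto
  qed (auto simp: indicator_def)
  have m: "C \<inter> {y} \<in> sets M" using C unfolding M by (intro sets.Int) auto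
  have "emeasure M (C \<inter> {y}) \<le> emeasure M {y}" unfolding M by (intro emeasure_mono) (auto simp: M)
  then have int: "integrable M (indicator (C \<inter> {y}) :: 'a \<Rightarrow> real)"
    using m fin by (intro integrable_real_indicator) (auto intro: le_less_trans)
  have "(\<integral>x. indicator C x *\<^sub>R g x \<partial>M) = (\<integral>x. indicator (C \<inter> {y}) x *\<^sub>R g y \<partial>M)"
  proof (rule integral_cong_AE[OF _ _ ae])
    show "(\<lambda>x. indicator C x *\<^sub>R g x) \<in> borel_measurable M"
      unfolding measurable_cong_sets[OF M refl] by (rule g)
    show "(\<lambda>x. indicator (C \<inter> {y}) x *\<^sub>R g y) \<in> borel_measurable M"
      using m by (intro borel_measurable_scaleR borel_measurable_indicator) auto
  qed
  also have "\<dots> = (\<integral>x. indicator (C \<inter> {y}) x \<partial>M) *\<^sub>R g y"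
    by (rule integral_scaleR_left[OF int])
  also have "(\<integral>x. indicator (C \<inter> {y}) x \<partial>M) = measure M (C \<inter> {y})" by (simp add: sp)
  finally show ?thesis .
qed

section \<open>Support functions\<close>

definition support_fun :: "'a::euclidean_space set \<Rightarrow> 'a \<Rightarrow> real" where
  "support_fun P v = (SUP p\<in>P. p \<bullet> v)"

lemma support_fun_upper: "bounded P \<Longrightarrow> p \<in> P \<Longrightarrow> p \<bullet> v \<le> support_fun P v"
  unfolding support_fun_def by (intro cSUP_upper bounded_inner_imp_bdd_above)

lemma support_fun_least: "P \<noteq> {} \<Longrightarrow> (\<And>p. p \<in> P \<Longrightarrow> p \<bullet> v \<le> c) \<Longrightarrow> support_fun P v \<le> c"
  unfolding support_fun_def by (intro cSUP_least)

lemma support_fun_attained: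
  assumes "compact P" "P \<noteq> {}"
  obtains p where "p \<in> P" "support_fun P v = p \<bullet> v"
proof -
  obtain p where p: "p \<in> P" "\<forall>q\<in>P. q \<bullet> v \<le> p \<bullet> v"
    using continuous_attains_sup[OF assms continuous_on_inner[OF continuous_on_id continuous_on_const]] by blast
  have "support_fun P v = p \<bullet> v"
    using p assms by (intro antisym support_fun_least support_fun_upper compact_imp_bounded) auto
  then show ?thesis using that p by blast
qed

lemma support_fun_Un:
  assumes "bounded P" "bounded Q" "P \<noteq> {}" "Q \<noteq> {}"
  shows "support_fun (P \<union> Q) v = max (support_fun P v) (support_fun Q v)"
proof (rule antisym)
  show "support_fun (P \<union> Q) v \<le> max (support_fun P v) (support_fun Q v)"
    using assms by (intro support_fun_least) (auto simp: le_max_iff_disj support_fun_upper)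
  show "max (support_fun P v) (support_fun Q v) \<le> support_fun (P \<union> Q) v"
    using assms by (auto intro!: support_fun_least support_fun_upper)
qed

text \<open>A connected set is not the union of two disjoint nonempty closed sets.\<close>

lemma convex_Un_Int_nonempty:
  fixes P Q :: "'a::real_normed_vector set"
  assumes "compact P" "compact Q" "P \<noteq> {}" "Q \<noteq> {}" "convex (P \<union> Q)"
  shows "P \<inter> Q \<noteq> {}"
proof
  assume "P \<inter> Q = {}"
  moreover have "connected (P \<union> Q)" using assms(5) by (rule convex_connected)
  ultimately show False
    using assms(1-4) unfolding connected_closed
    by (auto dest!: compact_imp_closed)
qed

text \<open>A segment between maximisers p in P and q in Q stays in P \<union> Q and crosses P
  \<inter> Q, and along it the linear functional is at least the smaller of its end values. Together
  with \<open>support_fun_Un\<close> this turns unions and intersections of bodies into maxima and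
  minima of functions.\<close>

lemma support_fun_Int:
  assumes P: "compact P" and Q: "compact Q" and ne: "P \<noteq> {}" "Q \<noteq> {}" and c: "convex (P \<union> Q)"
  shows "support_fun (P \<inter> Q) v = min (support_fun P v) (support_fun Q v)"
proof (rule antisym)
  have bP: "bounded P" "bounded Q" using P Q by (auto intro: compact_imp_bounded)
  show "support_fun (P \<inter> Q) v \<le> min (support_fun P v) (support_fun Q v)"
    using bP convex_Un_Int_nonempty[OF P Q ne c] by (auto intro!: support_fun_least support_fun_upper)
  obtain p where p: "p \<in> P" "support_fun P v = p \<bullet> v" by (rule support_fun_attained[OF P ne(1)])
  obtain q where q: "q \<in> Q" "support_fun Q v = q \<bullet> v" by (rule support_fun_attained[OF Q ne(2)])
  have seg: "closed_segment p q \<subseteq> P \<union> Q"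
    using c p q by (simp add: closed_segment_subset)
  have "closed_segment p q \<inter> P \<union> closed_segment p q \<inter> Q = closed_segment p q" using seg by blast
  \<comment> \<open>The connectedness argument is applied to the two closed parts of the segment,
    whose union is the convex segment itself.\<close>
  then have "(closed_segment p q \<inter> P) \<inter> (closed_segment p q \<inter> Q) \<noteq> {}"
    by (intro convex_Un_Int_nonempty[of "closed_segment p q \<inter> P"]) (use p q P Q in \<open>auto intro: compact_Int\<close>)
  then obtain r where r: "r \<in> P \<inter> Q" "r \<in> closed_segment p q" by blast
  then obtain u where u: "0 \<le> u" "u \<le> 1" "r = (1 - u) *\<^sub>R p + u *\<^sub>R q" by (auto simp: in_segment)
  have "min (p \<bullet> v) (q \<bullet> v) = (1 - u) * min (p \<bullet> v) (q \<bullet> v) + u * min (p \<bullet> v) (q \<bullet> v)"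
    by (simp add: algebra_simps)
  also have "\<dots> \<le> (1 - u) * (p \<bullet> v) + u * (q \<bullet> v)"
    using u by (intro add_mono mult_left_mono) auto
  also have "\<dots> = r \<bullet> v" by (simp add: u inner_left_distrib)
  also have "\<dots> \<le> support_fun (P \<inter> Q) v"
    using r bP by (intro support_fun_upper) (auto simp: bounded_Int)
  finally show "min (support_fun P v) (support_fun Q v) \<le> support_fun (P \<inter> Q) v"
    using p q by simp
qed

lemma support_fun_translation:
  assumes "bounded P" "P \<noteq> {}"
  shows "support_fun ((+) a ` P) v = support_fun P v + a \<bullet> v"
proof (rule antisym)
  show "support_fun ((+) a ` P) v \<le> support_fun P v + a \<bullet> v"
    using assms by (intro support_fun_least) (auto simp: inner_add_left support_fun_upper)
  have "support_fun P v \<le> support_fun ((+) a ` P) v - a \<bullet> v"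
  proof (intro support_fun_least assms)
    fix p assume "p \<in> P"
    then have "(a + p) \<bullet> v \<le> support_fun ((+) a ` P) v"
      using assms by (intro support_fun_upper bounded_translation) auto
    then show "p \<bullet> v \<le> support_fun ((+) a ` P) v - a \<bullet> v" by (simp add: inner_add_left)
  qed
  then show "support_fun P v + a \<bullet> v \<le> support_fun ((+) a ` P) v" by simp
qed

lemma support_fun_scaleR:
  assumes "bounded P" "P \<noteq> {}" "t > 0"
  shows "support_fun ((*\<^sub>R) t ` P) v = t * support_fun P v"
proof (rule antisym)
  show "support_fun ((*\<^sub>R) t ` P) v \<le> t * support_fun P v"
    using assms by (intro support_fun_least) (auto simp: support_fun_upper)
  have "support_fun P v \<le> support_fun ((*\<^sub>R) t ` P) v / t"
  proof (intro support_fun_least assms)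
    fix p assume "p \<in> P"
    then have "(t *\<^sub>R p) \<bullet> v \<le> support_fun ((*\<^sub>R) t ` P) v"
      using assms by (intro support_fun_upper bounded_scaling) auto
    then show "p \<bullet> v \<le> support_fun ((*\<^sub>R) t ` P) v / t" using assms by (simp add: field_simps)
  qed
  then show "t * support_fun P v \<le> support_fun ((*\<^sub>R) t ` P) v" using assms by (simp add: field_simps)
qed

lemma support_fun_pos_homogeneous:
  assumes "bounded P" "P \<noteq> {}" "t \<ge> 0"
  shows "support_fun P (t *\<^sub>R v) = t * support_fun P v"
proof (cases "t = 0")
  case True
  then show ?thesis using assms by (simp add: support_fun_def)
next
  case False
  have "support_fun P (t *\<^sub>R v) = support_fun ((*\<^sub>R) t ` P) v"
    by (simp add: support_fun_def image_image)
  then show ?thesis using support_fun_scaleR[of P t v] assms False by simp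
qed

lemma support_fun_convex_hull:
  assumes "bounded S" "S \<noteq> {}"
  shows "support_fun (convex hull S) v = support_fun S v"
proof (rule antisym)
  have "convex {p. p \<bullet> v \<le> support_fun S v}"
    using convex_halfspace_le[of v] by (simp add: inner_commute)
  then have "convex hull S \<subseteq> {p. p \<bullet> v \<le> support_fun S v}"
    using assms by (intro hull_minimal) (auto intro: support_fun_upper)
  then show "support_fun (convex hull S) v \<le> support_fun S v"
    using assms by (intro support_fun_least) auto
  show "support_fun S v \<le> support_fun (convex hull S) v"
    using assms by (intro support_fun_least support_fun_upper bounded_convex_hull hull_inc)
qed

lemma convex_on_support_fun:
  assumes "bounded P" "P \<noteq> {}" "convex U"
  shows "convex_on U (\<lambda>y. support_fun P (y - x))"
proof (rule convex_onI)
  fix t y z assume t: "0 < (t::real)" "t < 1"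
  show "support_fun P ((1 - t) *\<^sub>R y + t *\<^sub>R z - x)
      \<le> (1 - t) * support_fun P (y - x) + t * support_fun P (z - x)"
  proof (intro support_fun_least assms)
    fix p assume p: "p \<in> P"
    have "p \<bullet> ((1 - t) *\<^sub>R y + t *\<^sub>R z - x) = (1 - t) * (p \<bullet> (y - x)) + t * (p \<bullet> (z - x))"
      by (simp add: inner_diff_right inner_add_right algebra_simps)
    also have "\<dots> \<le> (1 - t) * support_fun P (y - x) + t * support_fun P (z - x)"
      using t p assms by (intro add_mono mult_left_mono support_fun_upper) auto
    finally show "p \<bullet> ((1 - t) *\<^sub>R y + t *\<^sub>R z - x) \<le> \<dots>" .
  qed
qed (rule assms)

lemma abs_support_fun_le:
  assumes "P \<subseteq> cball 0 r" "P \<noteq> {}"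
  shows "\<bar>support_fun P v\<bar> \<le> r * norm v"
proof -
  have b: "bounded P" using assms bounded_subset bounded_cball by blast
  have *: "\<bar>p \<bullet> v\<bar> \<le> r * norm v" if "p \<in> P" for p
    using that assms Cauchy_Schwarz_ineq2[of p v] mult_right_mono[of "norm p" r "norm v"] by fastforce
  obtain p where p: "p \<in> P" using assms by blast
  show ?thesis using support_fun_least[of P v "r * norm v"] *[THEN abs_le_D1] assms(2)
      support_fun_upper[OF b p, of v] *[OF p] by fastforce
qed

text \<open>Sublinearity gives h(u) \<le> h(v) + h(u - v); the bound controls how a cone changes
  when its apex moves.\<close>

lemma support_fun_lipschitz:
  assumes "P \<subseteq> cball 0 r" "P \<noteq> {}"
  shows "\<bar>support_fun P u - support_fun P v\<bar> \<le> r * norm (u - v)"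
proof -
  have b: "bounded P" using assms bounded_subset bounded_cball by blast
  have "support_fun P u \<le> support_fun P v + r * norm (u - v)" for u v
  proof (rule support_fun_least[OF assms(2)])
    fix p assume p: "p \<in> P"
    have "p \<bullet> u = p \<bullet> v + p \<bullet> (u - v)" by (simp add: inner_diff_right)
    moreover have "p \<bullet> v \<le> support_fun P v" "p \<bullet> (u - v) \<le> support_fun P (u - v)"
      using support_fun_upper[OF b p] by auto
    moreover have "support_fun P (u - v) \<le> r * norm (u - v)"
      using abs_support_fun_le[OF assms, of "u - v"] by simp
    ultimately show "p \<bullet> u \<le> support_fun P v + r * norm (u - v)" by linarith
  qed
  from this[of u v] this[of v u] show ?thesis by (simp add: norm_minus_commute abs_le_iff)
qed

lemma support_fun_cball: "support_fun (cball 0 1) v = norm v"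
proof (rule antisym)
  show "support_fun (cball 0 1) v \<le> norm v"
    using abs_support_fun_le[of "cball 0 1" 1 v] by auto
  have "sgn v \<bullet> v \<le> support_fun (cball 0 1) v"
    by (intro support_fun_upper) (auto simp: norm_sgn)
  moreover have "sgn v \<bullet> v = norm v"
    by (cases "v = 0") (auto simp: sgn_div_norm power2_norm_eq_inner[symmetric] power2_eq_square)
  ultimately show "norm v \<le> support_fun (cball 0 1) v" by simp
qed

section \<open>Cutting valuations along a grid\<close>

lemma sum_PiE_insert:
  assumes "i \<notin> S"
  shows "(\<Sum>k\<in>PiE (insert i S) F. g k) = (\<Sum>j\<in>F i. \<Sum>k\<in>PiE S F. g (k(i := j)))"
proof -
  have "(\<Sum>k\<in>PiE (insert i S) F. g k) = (\<Sum>(j, k)\<in>F i \<times> PiE S F. g (k(i := j)))"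
    unfolding PiE_insert_eq
    by (subst sum.reindex[OF inj_combinator[OF assms]]) (auto simp: case_prod_beta intro: sum.cong)
  then show ?thesis by (simp add: sum.cartesian_product)
qed

text \<open>Closed faces of the grid cell at k: T marks the coordinates pinned to the upper end.
  Coordinates outside S are free, so that the grid can be introduced one direction at a
  time.\<close>

definition slab :: "'a::euclidean_space set \<Rightarrow> 'a set \<Rightarrow> ('a \<Rightarrow> nat) \<Rightarrow> 'a set" where
  "slab S T k = {p. (\<forall>i\<in>S - T. real (k i) \<le> p \<bullet> i \<and> p \<bullet> i \<le> real (k i) + 1) \<and> (\<forall>i\<in>T. p \<bullet> i = real (k i) + 1)}"

text \<open>Inclusion-exclusion over the upper faces turns a valuation into the contribution of the
  half-open grid cell with index \<^term>\<open>k\<close>.\<close>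

definition cell_val :: "('a::euclidean_space set \<Rightarrow> complex) \<Rightarrow> 'a set \<Rightarrow> ('a \<Rightarrow> nat) \<Rightarrow> 'a set \<Rightarrow> complex" where
  "cell_val G S k R = (\<Sum>T\<in>Pow S. (- 1) ^ card T * G (R \<inter> slab S T k))"

text \<open>The subsets of \<open>insert i S\<close> split into those without i, which cut R to a
  closed slab, and those with i, which cut it to the upper face and flip the sign.\<close>

lemma cell_val_insert:
  assumes "finite S" "i \<notin> S"
  shows "cell_val G (insert i S) (k(i := j)) R
    = cell_val G S k (R \<inter> {p. real j \<le> p \<bullet> i \<and> p \<bullet> i \<le> real j + 1})
      - cell_val G S k (R \<inter> {p. p \<bullet> i = real j + 1})"
proof -
  have dis: "Pow S \<inter> insert i ` Pow S = {}" using assms by auto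
  have inj: "inj_on (insert i) (Pow S)" using assms by (auto simp: inj_on_def)
  have 1: "slab (insert i S) T (k(i := j)) = {p. real j \<le> p \<bullet> i \<and> p \<bullet> i \<le> real j + 1} \<inter> slab S T k"
    if "T \<in> Pow S" for T
  proof -
    have "i \<notin> T" using that assms by auto
    have "insert i S - T = insert i (S - T)" using \<open>i \<notin> T\<close> by auto
    moreover have "(k(i := j)) x = k x" if "x \<in> S - T \<or> x \<in> T" for x using that assms \<open>T \<in> Pow S\<close> by auto
    ultimately show ?thesis unfolding slab_def by auto
  qed
  have 2: "slab (insert i S) (insert i T) (k(i := j)) = {p. p \<bullet> i = real j + 1} \<inter> slab S T k"
    if "T \<in> Pow S" for T
  proof -
    have "i \<notin> T" using that assms by auto
    have "insert i S - insert i T = S - T" using assms by auto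
    moreover have "(k(i := j)) x = k x" if "x \<in> S - T \<or> x \<in> T" for x using that assms \<open>T \<in> Pow S\<close> by auto
    ultimately show ?thesis unfolding slab_def by auto
  qed
  have card: "card (insert i T) = Suc (card T)" if "T \<in> Pow S" for T
    using that assms by (subst card_insert_disjoint) (auto intro: finite_subset)
  have "cell_val G (insert i S) (k(i := j)) R =
     (\<Sum>T\<in>Pow S. (- 1) ^ card T * G (R \<inter> slab (insert i S) T (k(i := j))))
   + (\<Sum>T\<in>Pow S. (- 1) ^ card (insert i T) * G (R \<inter> slab (insert i S) (insert i T) (k(i := j))))"
    unfolding cell_val_def Pow_insert using assms dis
    by (subst sum.union_disjoint) (auto simp: sum.reindex[OF inj])
  also have "\<dots> = (\<Sum>T\<in>Pow S. (- 1) ^ card T * G (R \<inter> {p. real j \<le> p \<bullet> i \<and> p \<bullet> i \<le> real j + 1} \<inter> slab S T k))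
   + (\<Sum>T\<in>Pow S. - ((- 1) ^ card T * G (R \<inter> {p. p \<bullet> i = real j + 1} \<inter> slab S T k)))"
    by (intro arg_cong2[where f = "(+)"] sum.cong refl) (simp_all add: 1 2 card Int_assoc)
  finally show ?thesis by (simp add: cell_val_def sum_negf)
qed

text \<open>Additivity is demanded for cuts by axis-parallel hyperplanes, the ones that produce a
  grid. The value on the empty set is fixed because cells and slices may miss the body.\<close>

locale cut_valuation =
  fixes G :: "'a::euclidean_space set \<Rightarrow> complex"
  assumes empty: "G {} = 0"
    and cut: "\<And>P i a. compact P \<Longrightarrow> convex P \<Longrightarrow> i \<in> Basis \<Longrightarrow>
       G P + G (P \<inter> {p. p \<bullet> i = a}) = G (P \<inter> {p. p \<bullet> i \<le> a}) + G (P \<inter> {p. a \<le> p \<bullet> i})"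
begin

lemma compact_convex_slices:
  assumes "compact P" "convex P"
  shows "compact (P \<inter> {p. p \<bullet> i \<le> a})" "convex (P \<inter> {p. p \<bullet> i \<le> a})"
    "compact (P \<inter> {p. a \<le> p \<bullet> i})" "convex (P \<inter> {p. a \<le> p \<bullet> i})"
    "compact (P \<inter> {p. p \<bullet> i = a})" "convex (P \<inter> {p. p \<bullet> i = a})"
  using assms
  by (auto simp: inner_commute[of _ i] intro!: compact_Int_closed convex_Int closed_halfspace_le
      closed_halfspace_ge closed_hyperplane convex_halfspace_le convex_halfspace_ge convex_hyperplane)

text \<open>Telescoping: the half-open slab at height j contributes the difference between the parts
  of P above heights j and j + 1.\<close>

lemma slice_sum:
  assumes P: "compact P" "convex P" and i: "i \<in> Basis" and N: "\<And>p. p \<in> P \<Longrightarrow> 0 \<le> p \<bullet> i \<and> p \<bullet> i < real N"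
  shows "G P = (\<Sum>j<N. G (P \<inter> {p. real j \<le> p \<bullet> i \<and> p \<bullet> i \<le> real j + 1}) - G (P \<inter> {p. p \<bullet> i = real j + 1}))"
proof -
  define u where "u j = G (P \<inter> {p. real j \<le> p \<bullet> i})" for j
  have "G (P \<inter> {p. real j \<le> p \<bullet> i \<and> p \<bullet> i \<le> real j + 1}) - G (P \<inter> {p. p \<bullet> i = real j + 1}) = u j - u (Suc j)" for j
  proof -
    let ?Q = "P \<inter> {p. real j \<le> p \<bullet> i}"
    have "G ?Q + G (?Q \<inter> {p. p \<bullet> i = real j + 1}) = G (?Q \<inter> {p. p \<bullet> i \<le> real j + 1}) + G (?Q \<inter> {p. real j + 1 \<le> p \<bullet> i})"
      using compact_convex_slices[OF P] i by (intro cut)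
    moreover have "?Q \<inter> {p. p \<bullet> i = real j + 1} = P \<inter> {p. p \<bullet> i = real j + 1}"
      "?Q \<inter> {p. p \<bullet> i \<le> real j + 1} = P \<inter> {p. real j \<le> p \<bullet> i \<and> p \<bullet> i \<le> real j + 1}"
      "?Q \<inter> {p. real j + 1 \<le> p \<bullet> i} = P \<inter> {p. real (Suc j) \<le> p \<bullet> i}" by auto
    ultimately show ?thesis unfolding u_def by (simp add: algebra_simps)
  qed
  moreover have "(\<Sum>j<N. u j - u (Suc j)) = u 0 - u N"
    by (rule sum_lessThan_telescope')
  \<comment> \<open>The strict bound p \<bullet> i < N empties the last term; with equality the top
    face would be left over.\<close>
  moreover have "P \<inter> {p. real 0 \<le> p \<bullet> i} = P" "P \<inter> {p. real N \<le> p \<bullet> i} = {}" using N by force+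
  then have "u 0 = G P" "u N = 0" unfolding u_def using empty by auto
  ultimately show ?thesis by simp
qed

text \<open>Induction over the directions: slices in a new direction are again compact and convex,
  so the hypothesis resolves them into cells of the remaining directions.\<close>

lemma cell_sum:
  assumes "finite S" "S \<subseteq> Basis" "compact R" "convex R"
    "\<And>p i. p \<in> R \<Longrightarrow> i \<in> Basis \<Longrightarrow> 0 \<le> p \<bullet> i \<and> p \<bullet> i < real N"
  shows "G R = (\<Sum>k\<in>PiE S (\<lambda>_. {..<N}). cell_val G S k R)"
  using assms
proof (induction S arbitrary: R rule: finite_induct)
  case empty
  then show ?case by (simp add: cell_val_def slab_def)
next
  case (insert i S)
  let ?A = "\<lambda>j. R \<inter> {p. real j \<le> p \<bullet> i \<and> p \<bullet> i \<le> real j + 1}" and ?B = "\<lambda>j. R \<inter> {p. p \<bullet> i = real j + 1}"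
  have A: "compact (?A j)" "convex (?A j)" for j
  proof -
    have "?A j = (R \<inter> {p. real j \<le> p \<bullet> i}) \<inter> {p. p \<bullet> i \<le> real j + 1}" by auto
    then show "compact (?A j)" "convex (?A j)"
      using compact_convex_slices(1,2)[OF compact_convex_slices(3,4)[OF insert.prems(2,3)]] by auto
  qed
  have "(\<Sum>k\<in>PiE (insert i S) (\<lambda>_. {..<N}). cell_val G (insert i S) k R)
    = (\<Sum>j<N. \<Sum>k\<in>PiE S (\<lambda>_. {..<N}). cell_val G S k (?A j) - cell_val G S k (?B j))"
    by (simp add: sum_PiE_insert[OF insert.hyps(2)] cell_val_insert[OF insert.hyps])
  also have "\<dots> = (\<Sum>j<N. G (?A j) - G (?B j))"
  proof (intro sum.cong refl)
    fix j
    have "G (?A j) = (\<Sum>k\<in>PiE S (\<lambda>_. {..<N}). cell_val G S k (?A j))"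
      using insert.prems A by (intro insert.IH) auto
    moreover have "G (?B j) = (\<Sum>k\<in>PiE S (\<lambda>_. {..<N}). cell_val G S k (?B j))"
      using insert.prems compact_convex_slices(5,6)[OF insert.prems(2,3)] by (intro insert.IH) auto
    ultimately show "(\<Sum>k\<in>PiE S (\<lambda>_. {..<N}). cell_val G S k (?A j) - cell_val G S k (?B j)) = G (?A j) - G (?B j)"
      by (simp add: sum_subtractf)
  qed
  also have "\<dots> = G R" using insert.prems by (intro slice_sum[symmetric]) auto
  finally show ?case ..
qed

end

section \<open>Grid cells and the number that meet the boundary of a body\<close>

definition grid_point :: "('a::euclidean_space \<Rightarrow> nat) \<Rightarrow> 'a" where
  "grid_point k = (\<Sum>i\<in>Basis. real (k i) *\<^sub>R i)"

lemma grid_point_inner [simp]: "i \<in> Basis \<Longrightarrow> grid_point k \<bullet> i = real (k i)"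
  by (simp add: grid_point_def)

abbreviation unit_cube :: "'a::euclidean_space set" where
  "unit_cube \<equiv> cbox 0 One"

lemma slab_translation:
  assumes "T \<subseteq> Basis"
  shows "slab Basis T k = (+) (grid_point k) ` slab Basis T (\<lambda>_. 0)"
proof -
  have "p \<in> slab Basis T k \<longleftrightarrow> p - grid_point k \<in> slab Basis T (\<lambda>_. 0)" for p
    using assms by (auto simp: slab_def inner_diff_left algebra_simps subset_iff)
  moreover have "p \<in> (+) (grid_point k) ` A \<longleftrightarrow> p - grid_point k \<in> A" for p and A :: "'a set"
    by (force simp: image_iff algebra_simps)
  ultimately show ?thesis by blast
qed

lemma slab_Basis_empty: "slab Basis {} k = cbox (grid_point k) (grid_point k + One)"
  by (auto simp: slab_def cbox_def inner_add_left)

lemma slab_subset: "T \<subseteq> Basis \<Longrightarrow> slab Basis T k \<subseteq> cbox (grid_point k) (grid_point k + One)"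
  by (force simp: slab_def cbox_def inner_add_left)

lemma slab_zero_subset: "T \<subseteq> Basis \<Longrightarrow> slab Basis T (\<lambda>_. 0) \<subseteq> unit_cube"
  by (force simp: slab_def cbox_def)

lemma compact_convex_slab:
  assumes "T \<subseteq> Basis"
  shows "compact (slab Basis T k)" "convex (slab Basis T k)"
proof -
  \<comment> \<open>A face is a degenerate box whose lower corner is raised to the upper one in the
    directions of T.\<close>
  have eq: "slab Basis T k = cbox (\<Sum>i\<in>Basis. (if i \<in> T then real (k i) + 1 else real (k i)) *\<^sub>R i) (grid_point k + One)"
    using assms by (fastforce simp: slab_def cbox_def inner_add_left)
  show "compact (slab Basis T k)" "convex (slab Basis T k)" unfolding eq by auto
qed

text \<open>Continuity from above: closed neighbourhoods of a compact set decrease to the set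
  itself, starting from finite measure.\<close>

lemma measure_nbhd_tendsto_0:
  fixes F :: "'a::euclidean_space set"
  assumes "compact F" "F \<noteq> {}" "negligible F" "c > 0"
  shows "(\<lambda>m. measure lebesgue {x. infdist x F \<le> c / real (Suc m)}) \<longlonglongrightarrow> 0"
proof -
  define A where "A m = {x. infdist x F \<le> c / real (Suc m)}" for m
  have cA: "compact (A m)" for m unfolding A_def using assms by (intro compact_infdist_le) auto
  have "decseq A"
    unfolding decseq_def
  proof (intro allI impI)
    fix m n :: nat assume "m \<le> n"
    then have "c / real (Suc n) \<le> c / real (Suc m)" using assms(4) by (intro divide_left_mono) auto
    then show "A n \<subseteq> A m" unfolding A_def by auto
  qed
  have "(\<Inter>m. A m) = F"
  proof
    show "F \<subseteq> (\<Inter>m. A m)" using assms by (auto simp: A_def)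
    show "(\<Inter>m. A m) \<subseteq> F"
    proof
      fix x assume x: "x \<in> (\<Inter>m. A m)"
      have lim: "(\<lambda>m. c * inverse (real (Suc m))) \<longlonglongrightarrow> c * 0"
        by (intro tendsto_mult tendsto_const LIMSEQ_inverse_real_of_nat)
      have "infdist x F \<le> c * inverse (real (Suc m))" for m
        using x by (simp add: A_def divide_inverse)
      then have "infdist x F \<le> c * 0" using LIMSEQ_le_const[OF lim] by blast
      then have "infdist x F = 0" using infdist_nonneg[of x F] by simp
      then show "x \<in> F"
        using assms(1,2) by (simp add: in_closed_iff_infdist_zero compact_imp_closed)
    qed
  qed
  moreover have "(\<lambda>m. measure lebesgue (A m)) \<longlonglongrightarrow> measure lebesgue (\<Inter>m. A m)"
  proof (rule Lim_measure_decseq)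
    show "range A \<subseteq> sets lebesgue" using cA lmeasurable_compact fmeasurableD by blast
    show "emeasure lebesgue (A m) \<noteq> \<infinity>" for m
      using lmeasurable_compact[OF cA[of m]] by (auto simp: fmeasurable_def)
  qed fact
  ultimately show ?thesis using negligible_imp_measure0[OF assms(3)] by (simp add: A_def)
qed

lemma frontier_compact_nonempty:
  fixes P :: "'a::euclidean_space set"
  assumes "compact P" "P \<noteq> {}"
  shows "frontier P \<noteq> {}"
  unfolding frontier_eq_empty using assms not_compact_UNIV[where 'a = 'a] by metis

text \<open>A cell shrunk by 1/m that meets both P and its complement is connected, so it meets the
  frontier and stays in a neighbourhood of it. The shrunken open cells are disjoint with volume
  1/m^n each, so their number is at most m^n times the volume of the neighbourhood.\<close>

lemma card_boundary_cells:
  fixes P :: "'a::euclidean_space set"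
  assumes P: "compact P" "P \<noteq> {}" and m: "m > 0" and I: "finite I" "I \<subseteq> PiE Basis F"
    and meet: "\<And>k. k \<in> I \<Longrightarrow> cbox (grid_point k) (grid_point k + One) \<inter> (*\<^sub>R) m ` P \<noteq> {}"
    and out: "\<And>k. k \<in> I \<Longrightarrow> \<not> cbox (grid_point k) (grid_point k + One) \<subseteq> (*\<^sub>R) m ` P"
  shows "real (card I) \<le> m ^ DIM('a) * measure lebesgue {x. infdist x (frontier P) \<le> real (DIM('a)) / m}"
proof -
  let ?N = "{x. infdist x (frontier P) \<le> real (DIM('a)) / m}"
  define Q where "Q k = (*\<^sub>R) (1/m) ` cbox (grid_point k) (grid_point k + One)" for k :: "'a \<Rightarrow> nat"
  define B where "B k = (*\<^sub>R) (1/m) ` box (grid_point k) (grid_point k + One)" for k :: "'a \<Rightarrow> nat"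
  have fr: "compact (frontier P)" "frontier P \<noteq> {}"
    using compact_frontier[OF P(1)] frontier_compact_nonempty[OF P] by auto
  have cN: "compact ?N" using fr m by (intro compact_infdist_le) auto
  have QN: "Q k \<subseteq> ?N" if k: "k \<in> I" for k
  proof -
    have inv: "(1/m) *\<^sub>R p \<in> P \<longleftrightarrow> p \<in> (*\<^sub>R) m ` P" for p
      using m by (auto simp: image_iff intro: bexI[of _ "(1/m) *\<^sub>R p"])
    have "Q k \<inter> P \<noteq> {}" using meet[OF k] m unfolding Q_def by (auto simp: inv)
    moreover have "Q k - P \<noteq> {}" using out[OF k] unfolding Q_def by (auto simp: inv)
    moreover have "connected (Q k)"
      unfolding Q_def by (intro convex_connected convex_scaling convex_box)
    ultimately obtain z where z: "z \<in> Q k" "z \<in> frontier P"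
      using connected_Int_frontier[of "Q k" P] by blast
    show ?thesis
    proof
      fix x assume "x \<in> Q k"
      then obtain x' z' where xz: "x' \<in> cbox (grid_point k) (grid_point k + One)" "x = (1/m) *\<^sub>R x'"
         "z' \<in> cbox (grid_point k) (grid_point k + One)" "z = (1/m) *\<^sub>R z'"
        using z(1) unfolding Q_def by blast
      \<comment> \<open>The l1 norm bounds the diameter of a unit cell by the dimension, the
        constant in the radius of the neighbourhood.\<close>
      have "norm (x' - z') \<le> (\<Sum>b\<in>Basis. \<bar>(x' - z') \<bullet> b\<bar>)" by (rule norm_le_l1)
      also have "\<dots> \<le> (\<Sum>b\<in>(Basis::'a set). 1)"
      proof (rule sum_mono)
        fix b :: 'a assume b: "b \<in> Basis"
        have "real (k b) \<le> x' \<bullet> b" "x' \<bullet> b \<le> real (k b) + 1" "real (k b) \<le> z' \<bullet> b" "z' \<bullet> b \<le> real (k b) + 1"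
          using xz(1,3) b by (auto simp: mem_box inner_add_left)
        then show "\<bar>(x' - z') \<bullet> b\<bar> \<le> 1" by (auto simp: inner_diff_left)
      qed
      finally have "norm (x' - z') \<le> real (DIM('a))" by simp
      then have "dist x z \<le> real (DIM('a)) / m"
        using m xz by (simp add: dist_norm flip: scaleR_diff_right) (simp add: field_simps)
      then show "x \<in> ?N" using infdist_le[OF z(2), of x] by simp
    qed
  qed
  have mB: "measure lebesgue (B k) = 1 / m ^ DIM('a)" for k
  proof -
    have "measure lebesgue (B k) = (1/m) ^ DIM('a) * measure lebesgue (box (grid_point k) (grid_point k + One))"
      unfolding B_def using measure_lebesgue_affine[of "1/m" 0 "box (grid_point k) (grid_point k + One)"] m
      by simp
    also have "measure lebesgue (box (grid_point k) (grid_point k + One)) = 1"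
      using measure_lborel_box[of "grid_point k" "grid_point k + One"] by (simp add: measure_completion inner_add_left)
    finally show ?thesis by (simp add: power_one_over)
  qed
  have Bm: "B k \<in> lmeasurable" for k
    unfolding B_def by (intro lmeasurable_open bounded_scaling bounded_box open_scaling open_box) (use m in auto)
  have dis: "pairwise (\<lambda>i j. disjnt (B i) (B j)) I"
  proof (rule pairwiseI)
    fix k l assume kl: "k \<in> I" "l \<in> I" "k \<noteq> l"
    \<comment> \<open>Members of \<open>PiE\<close> take the same default value off
      \<open>Basis\<close>, so different indices differ in some coordinate and belong to disjoint
      open cells.\<close>
    have "\<exists>b\<in>Basis. k b \<noteq> l b"
    proof (rule ccontr)
      assume "\<not> (\<exists>b\<in>Basis. k b \<noteq> l b)"
      then have "k = l" using kl(1,2) I(2) by (intro PiE_ext[of k Basis F l]) auto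
      then show False using kl(3) by simp
    qed
    then obtain b where b: "b \<in> Basis" "k b \<noteq> l b" by blast
    have False if x: "x \<in> box (grid_point k) (grid_point k + One)" "y \<in> box (grid_point l) (grid_point l + One)"
       "(1/m) *\<^sub>R x = (1/m) *\<^sub>R y" for x y
    proof -
      have "x = y" using x(3) m by simp
      then have "real (k b) < x \<bullet> b" "x \<bullet> b < real (k b) + 1" "real (l b) < x \<bullet> b" "x \<bullet> b < real (l b) + 1"
        using x(1,2) b by (auto simp: mem_box inner_add_left)
      then show False using b(2) by linarith
    qed
    then show "disjnt (B k) (B l)" unfolding B_def disjnt_iff by blast
  qed
  have "real (card I) / m ^ DIM('a) = (\<Sum>k\<in>I. measure lebesgue (B k))" by (simp add: mB)
  also have "\<dots> = measure lebesgue (\<Union>k\<in>I. B k)"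
    using I(1) Bm dis by (intro measure_UNION'[symmetric])
  also have "\<dots> \<le> measure lebesgue ?N"
  proof (rule measure_mono_fmeasurable)
    have "B k \<subseteq> Q k" for k unfolding B_def Q_def using box_subset_cbox by blast
    then show "(\<Union>k\<in>I. B k) \<subseteq> ?N" using QN by blast
    show "(\<Union>k\<in>I. B k) \<in> sets lebesgue" using I(1) Bm by (intro sets.finite_UN) auto
    show "?N \<in> lmeasurable" by (rule lmeasurable_compact[OF cN])
  qed
  finally show ?thesis using m by (simp add: field_simps)
qed

text \<open>C bounds the value on all compact convex subsets of the unit cube, hence by translation
  on every compact convex piece of a grid cell.\<close>

locale volume_valuation = cut_valuation G for G :: "'a::euclidean_space set \<Rightarrow> complex" +
  fixes C :: real
  assumes trans: "\<And>P a. compact P \<Longrightarrow> convex P \<Longrightarrow> G ((+) a ` P) = G P"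
    and hom: "\<And>P t. compact P \<Longrightarrow> convex P \<Longrightarrow> t > 0 \<Longrightarrow> G ((*\<^sub>R) t ` P) = complex_of_real (t ^ DIM('a)) * G P"
    and bd: "\<And>P. compact P \<Longrightarrow> convex P \<Longrightarrow> P \<subseteq> unit_cube \<Longrightarrow> norm (G P) \<le> C"
begin

text \<open>Each of the 2^n signed terms can be translated into the unit cube, where C bounds
  it.\<close>

lemma norm_cell_val_le:
  assumes "compact R" "convex R"
  shows "norm (cell_val G Basis k R) \<le> 2 ^ DIM('a) * C"
proof -
  have "norm (G (R \<inter> slab Basis T k)) \<le> C" if T: "T \<subseteq> Basis" for T
  proof -
    let ?R = "R \<inter> slab Basis T k"
    have c: "compact ?R" "convex ?R"
      using assms compact_convex_slab[OF T] by (auto intro: compact_Int convex_Int)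
    have "(+) (- grid_point k) ` ?R \<subseteq> slab Basis T (\<lambda>_. 0)"
      by (auto simp: slab_translation[OF T, of k])
    then have "norm (G ((+) (- grid_point k) ` ?R)) \<le> C"
      using slab_zero_subset[OF T] c by (intro bd compact_translation convex_translation) auto
    then show ?thesis by (simp only: trans[OF c])
  qed
  then have "norm (cell_val G Basis k R) \<le> (\<Sum>T\<in>Pow (Basis::'a set). C)"
    unfolding cell_val_def by (intro order_trans[OF norm_sum] sum_mono) (auto simp: norm_mult norm_power)
  then show ?thesis by (simp add: card_Pow)
qed

lemma cell_val_full:
  assumes "cbox (grid_point k) (grid_point k + One) \<subseteq> R"
  shows "cell_val G Basis k R = cell_val G Basis (\<lambda>_. 0) unit_cube"
  unfolding cell_val_def
proof (intro sum.cong refl arg_cong2[where f = "(*)"])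
  fix T :: "'a set" assume "T \<in> Pow Basis"
  then have T: "T \<subseteq> Basis" by simp
  have "R \<inter> slab Basis T k = slab Basis T k" using slab_subset[OF T] assms by blast
  also have "G \<dots> = G (slab Basis T (\<lambda>_. 0))"
    using compact_convex_slab[OF T] by (simp add: slab_translation[OF T, of k] trans)
  also have "slab Basis T (\<lambda>_. 0) = unit_cube \<inter> slab Basis T (\<lambda>_. 0)" using slab_zero_subset[OF T] by blast
  finally show "G (R \<inter> slab Basis T k) = G (unit_cube \<inter> slab Basis T (\<lambda>_. 0))" .
qed

lemma cell_val_outside:
  assumes "cbox (grid_point k) (grid_point k + One) \<inter> R = {}"
  shows "cell_val G Basis k R = 0"
  unfolding cell_val_def
proof (intro sum.neutral ballI)
  fix T :: "'a set" assume "T \<in> Pow Basis"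
  then have "R \<inter> slab Basis T k = {}" using slab_subset[of T k] assms by blast
  then show "(- 1) ^ card T * G (R \<inter> slab Basis T k) = 0" by (simp add: empty)
qed

text \<open>Instead of refining the grid, the body is enlarged and homogeneity divides the
  enlargement out again. Full and missed cells contribute 0; the number of the others is controlled
  by the measure of a shrinking neighbourhood of the frontier, and the frontier of a convex body is
  null.\<close>

lemma zero_if_unit_cell_zero:
  assumes zero: "cell_val G Basis (\<lambda>_. 0) unit_cube = 0" and P: "compact P" "convex P"
  shows "G P = 0"
proof (cases "P = {}")
  case False
  obtain r where r: "P \<subseteq> cball 0 r" "r > 0" using compact_imp_bounded[OF P(1)] bounded_subset_ballD[of P 0]
    by (meson ball_subset_cball order_trans)
  \<comment> \<open>Grid indices are natural numbers, so the body is moved into the nonnegative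
    orthant.\<close>
  define P' where "P' = (+) (r *\<^sub>R One) ` P"
  have P': "compact P'" "convex P'" "P' \<noteq> {}"
    using P False unfolding P'_def by (auto intro: compact_translation convex_translation)
  have pos: "0 \<le> p \<bullet> i" "p \<bullet> i \<le> 2 * r" if "p \<in> P'" "i \<in> Basis" for p i
  proof -
    obtain q where q: "q \<in> P" "p = r *\<^sub>R One + q" using \<open>p \<in> P'\<close> unfolding P'_def by blast
    have "\<bar>q \<bullet> i\<bar> \<le> r" using Basis_le_norm[OF that(2), of q] r q by fastforce
    then show "0 \<le> p \<bullet> i" "p \<bullet> i \<le> 2 * r" using q that(2) by (auto simp: inner_add_left)
  qed
  let ?A = "\<lambda>m. {x. infdist x (frontier P') \<le> real (DIM('a)) / real (Suc m)}"
  have bound: "norm (G P') \<le> (2 ^ DIM('a) * C) * measure lebesgue (?A m)" for m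
  proof -
    define R where "R = (*\<^sub>R) (real (Suc m)) ` P'"
    have R: "compact R" "convex R" unfolding R_def using P' by (auto intro: compact_scaling convex_scaling)
    obtain N where N: "real N > real (Suc m) * (2 * r)" using reals_Archimedean2 by blast
    have RN: "0 \<le> p \<bullet> i \<and> p \<bullet> i < real N" if "p \<in> R" "i \<in> Basis" for p i
    proof -
      obtain q where q: "q \<in> P'" "p = real (Suc m) *\<^sub>R q" using \<open>p \<in> R\<close> unfolding R_def by blast
      have "real (Suc m) * (q \<bullet> i) \<le> real (Suc m) * (2 * r)" using pos[OF q(1) that(2)] by (intro mult_left_mono) auto
      moreover have "0 \<le> real (Suc m) * (q \<bullet> i)" using pos[OF q(1) that(2)] by (intro mult_nonneg_nonneg) auto
      ultimately have "0 \<le> real (Suc m) * (q \<bullet> i) \<and> real (Suc m) * (q \<bullet> i) < real N" using N by linarith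
      then show ?thesis using q by (simp only: inner_scaleR_left)
    qed
    let ?F = "PiE (Basis :: 'a set) (\<lambda>_. {..<N})"
    define I where "I = {k\<in>?F. cbox (grid_point k) (grid_point k + One) \<inter> R \<noteq> {} \<and>
        \<not> cbox (grid_point k) (grid_point k + One) \<subseteq> R}"
    have finF: "finite ?F" by (intro finite_PiE) auto
    have finI: "finite I" using finF unfolding I_def by auto
    have "G R = (\<Sum>k\<in>?F. cell_val G Basis k R)" using R RN by (intro cell_sum) auto
    also have "\<dots> = (\<Sum>k\<in>I. cell_val G Basis k R)"
    proof (rule sum.mono_neutral_right[OF finF])
      show "I \<subseteq> ?F" unfolding I_def by blast
      show "\<forall>k\<in>?F - I. cell_val G Basis k R = 0"
      proof
        fix k assume k: "k \<in> ?F - I"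
        show "cell_val G Basis k R = 0"
        proof (cases "cbox (grid_point k) (grid_point k + One) \<subseteq> R")
          case True then show ?thesis using cell_val_full zero by simp
        next
          case False
          then have "cbox (grid_point k) (grid_point k + One) \<inter> R = {}" using k unfolding I_def by blast
          then show ?thesis by (rule cell_val_outside)
        qed
      qed
    qed
    also have "norm \<dots> \<le> (\<Sum>k\<in>I. 2 ^ DIM('a) * C)"
      by (intro order_trans[OF norm_sum] sum_mono norm_cell_val_le R)
    also have "\<dots> = real (card I) * (2 ^ DIM('a) * C)" by simp
    also have "\<dots> \<le> (real (Suc m) ^ DIM('a) * measure lebesgue (?A m)) * (2 ^ DIM('a) * C)"
    proof (intro mult_right_mono)
      show "real (card I) \<le> real (Suc m) ^ DIM('a) * measure lebesgue (?A m)"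
        using P' finI by (intro card_boundary_cells[where F = "\<lambda>_. {..<N}"]) (auto simp: I_def R_def simp del: of_nat_Suc)
      have "0 \<le> C" using bd[of "{}"] by (simp add: empty)
      then show "0 \<le> 2 ^ DIM('a) * C" by simp
    qed
    finally have "norm (G R) \<le> (real (Suc m) ^ DIM('a) * measure lebesgue (?A m)) * (2 ^ DIM('a) * C)" .
    moreover have "norm (G R) = real (Suc m) ^ DIM('a) * norm (G P')"
      unfolding R_def using hom[OF P'(1,2), of "real (Suc m)"] by (simp add: norm_mult norm_power del: of_nat_Suc)
    ultimately have "real (Suc m) ^ DIM('a) * norm (G P') \<le> real (Suc m) ^ DIM('a) * ((2 ^ DIM('a) * C) * measure lebesgue (?A m))"
      by (simp only: mult_ac)
    then show ?thesis by (simp del: of_nat_Suc)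
  qed
  have "(\<lambda>m. (2 ^ DIM('a) * C) * measure lebesgue (?A m)) \<longlonglongrightarrow> (2 ^ DIM('a) * C) * 0"
  proof (intro tendsto_mult tendsto_const measure_nbhd_tendsto_0)
    show "frontier P' \<noteq> {}" using P' by (intro frontier_compact_nonempty)
    show "negligible (frontier P')" using P'(2) by (rule negligible_convex_frontier)
  qed (use P' in \<open>auto intro: compact_frontier\<close>)
  then have "norm (G P') \<le> (2 ^ DIM('a) * C) * 0" by (rule LIMSEQ_le_const) (use bound in blast)
  then have "G P' = 0" by simp
  then show ?thesis unfolding P'_def by (simp add: trans[OF P])
qed (simp add: empty)

end

lemma measure_lebesgue_scaleR:
  fixes S :: "'a::euclidean_space set"
  shows "measure lebesgue ((*\<^sub>R) t ` S) = \<bar>t\<bar> ^ DIM('a) * measure lebesgue S"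
  using measure_lebesgue_affine[of t 0 S] by simp

lemma (in volume_valuation) eq_volume:
  assumes P: "compact P" "convex P"
  shows "G P = complex_of_real (measure lebesgue P) * G unit_cube"
proof -
  \<comment> \<open>c is the contribution of the half-open unit cell. It is not yet known to equal
    \<open>G unit_cube\<close>, since the upper faces might have nonzero value; equality falls out
    at the end because the cube has volume 1.\<close>
  define c where "c = cell_val G Basis (\<lambda>_. 0) unit_cube"
  define E where "E P = G P - c * complex_of_real (measure lebesgue P)" for P
  interpret E: volume_valuation E "C + norm c"
  proof
    show "E {} = 0" by (simp add: E_def empty)
    show "E P + E (P \<inter> {p. p \<bullet> i = a}) = E (P \<inter> {p. p \<bullet> i \<le> a}) + E (P \<inter> {p. a \<le> p \<bullet> i})"
      if P: "compact P" "convex P" and i: "i \<in> Basis" for P i a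
    proof -
      let ?A = "P \<inter> {p. p \<bullet> i \<le> a}" and ?B = "P \<inter> {p. a \<le> p \<bullet> i}"
      have m: "?A \<in> lmeasurable" "?B \<in> lmeasurable"
        by (intro lmeasurable_compact compact_convex_slices P)+
      have "?A \<union> ?B = P" "?A \<inter> ?B = P \<inter> {p. p \<bullet> i = a}" by auto
      with measure_Un3[OF m] have "measure lebesgue P + measure lebesgue (P \<inter> {p. p \<bullet> i = a})
        = measure lebesgue ?A + measure lebesgue ?B" by simp
      then have "c * complex_of_real (measure lebesgue P + measure lebesgue (P \<inter> {p. p \<bullet> i = a}))
        = c * complex_of_real (measure lebesgue ?A + measure lebesgue ?B)" by simp
      then show ?thesis using cut[OF P i, of a] by (simp add: E_def algebra_simps)
    qed
    show "E ((+) a ` P) = E P" if "compact P" "convex P" for P a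
      using trans[OF that] by (simp add: E_def measure_translation)
    show "E ((*\<^sub>R) t ` P) = complex_of_real (t ^ DIM('a)) * E P" if "compact P" "convex P" "t > 0" for P t
      using hom[OF that] that by (simp add: E_def measure_lebesgue_scaleR algebra_simps)
    show "norm (E P) \<le> C + norm c" if "compact P" "convex P" "P \<subseteq> unit_cube" for P
    proof -
      have "measure lebesgue P \<le> measure lebesgue (unit_cube :: 'a set)"
        using that lmeasurable_compact by (intro measure_mono_fmeasurable) auto
      then have "measure lebesgue P \<le> 1" by (simp add: measure_completion)
      then have "norm (c * complex_of_real (measure lebesgue P)) \<le> norm c"
        by (simp add: norm_mult mult_left_le)
      then show ?thesis using bd[OF that] norm_triangle_ineq4[of "G P" "c * complex_of_real (measure lebesgue P)"]
        unfolding E_def by linarith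
    qed
  qed
  \<comment> \<open>For volume, all faces with T nonempty lie in hyperplanes, so only the full cube
    is left.\<close>
  have "cell_val (\<lambda>P. complex_of_real (measure lebesgue P)) Basis (\<lambda>_. 0) (unit_cube :: 'a set) = 1"
  proof -
    have "measure lebesgue (unit_cube \<inter> slab Basis T (\<lambda>_. 0)) = 0" if T: "T \<in> Pow Basis - {{}}" for T :: "'a set"
    proof -
      obtain i where i: "i \<in> T" "i \<in> Basis" using T by blast
      have "negligible {x. i \<bullet> x = 1}" using i by (intro negligible_hyperplane) auto
      then have "negligible (unit_cube \<inter> slab Basis T (\<lambda>_. 0))"
        by (rule negligible_subset) (use i in \<open>auto simp: slab_def inner_commute\<close>)
      then show ?thesis by (rule negligible_imp_measure0)
    qed
    then have "cell_val (\<lambda>P. complex_of_real (measure lebesgue P)) Basis (\<lambda>_. 0) (unit_cube :: 'a set)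
      = (\<Sum>T\<in>{{}}. (- 1) ^ card T * complex_of_real (measure lebesgue ((unit_cube :: 'a set) \<inter> slab Basis T (\<lambda>_. 0))))"
      unfolding cell_val_def by (intro sum.mono_neutral_right) auto
    moreover have "slab Basis {} (\<lambda>_. 0) = (unit_cube :: 'a set)"
      by (simp add: slab_Basis_empty grid_point_def)
    ultimately show ?thesis by (simp add: measure_completion)
  qed
  moreover have "cell_val E Basis (\<lambda>_. 0) unit_cube = cell_val G Basis (\<lambda>_. 0) unit_cube
      - c * cell_val (\<lambda>P. complex_of_real (measure lebesgue P)) Basis (\<lambda>_. 0) (unit_cube :: 'a set)"
    by (simp add: cell_val_def E_def sum_distrib_left sum_subtractf algebra_simps)
  ultimately have "cell_val E Basis (\<lambda>_. 0) unit_cube = 0" by (simp add: c_def)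
  then have vol: "G P = c * complex_of_real (measure lebesgue P)" if "compact P" "convex P" for P
    using E.zero_if_unit_cell_zero[OF _ that] by (simp add: E_def)
  have "G unit_cube = c" using vol[of unit_cube] by (simp add: measure_completion)
  then show ?thesis using vol[OF P] by (simp add: mult.commute)
qed

section \<open>The Monge-Ampere measure\<close>

lemma open_small_step:
  fixes x v :: "'a::real_normed_vector"
  assumes "open V" "x \<in> V"
  obtains t :: real where "0 < t" "t \<le> 1" "x + t *\<^sub>R v \<in> V"
proof -
  obtain e where e: "e > 0" "ball x e \<subseteq> V" using assms open_contains_ball by blast
  \<comment> \<open>Adding 1 to the norm covers v = 0; the factor 2 makes the final bound
    strict.\<close>
  define t where "t = min 1 (e / (2 * (norm v + 1)))"
  have t: "0 < t" "t \<le> 1" using e by (auto simp: t_def add_nonneg_pos)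
  have "t * norm v \<le> e / (2 * (norm v + 1)) * (norm v + 1)"
    using e by (intro mult_mono) (auto simp: t_def)
  also have "\<dots> = e / 2" using norm_ge_zero[of v] by (simp add: field_simps add_nonneg_eq_0_iff)
  also have "\<dots> < e" using e by simp
  finally have "x + t *\<^sub>R v \<in> V" using e t by (intro subsetD[OF e(2)]) (auto simp: dist_norm)
  then show ?thesis using that t by blast
qed

text \<open>By convexity an affine function that touches f at x and lies below it near x lies below
  it everywhere: a short step from x towards y stays in V, and the inequality there scales up to
  y.\<close>

lemma subdiff_if_local_min:
  assumes f: "convex_on U f" and V: "open V" "V \<subseteq> U" "x \<in> V"
    and min: "\<And>y. y \<in> V \<Longrightarrow> f y \<ge> f x + p \<bullet> (y - x)"
  shows "p \<in> subdiff f U x"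
  unfolding subdiff_def
proof (safe)
  fix y assume y: "y \<in> U"
  obtain t :: real where t: "0 < t" "t \<le> 1" and tV: "x + t *\<^sub>R (y - x) \<in> V"
    using open_small_step[OF V(1,3)] by blast
  from tV have "f x + t * (p \<bullet> (y - x)) \<le> f (x + t *\<^sub>R (y - x))"
    using min[of "x + t *\<^sub>R (y - x)"] by simp
  also have "x + t *\<^sub>R (y - x) = (1 - t) *\<^sub>R x + t *\<^sub>R y" by (simp add: algebra_simps)
  also have "f \<dots> \<le> (1 - t) * f x + t * f y"
    using f V y t by (intro convex_onD) auto
  finally have "t * (p \<bullet> (y - x)) \<le> t * (f y - f x)" by (simp add: algebra_simps)
  then show "f x + p \<bullet> (y - x) \<le> f y" using t by simp
qed

lemma subdiff_cong_local:
  assumes "convex_on U f" "convex_on U h" "open V" "V \<subseteq> U" "x \<in> V" "\<And>y. y \<in> V \<Longrightarrow> f y = h y"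
  shows "subdiff f U x = subdiff h U x"
proof -
  have "subdiff f U x \<subseteq> subdiff h U x"
    if "convex_on U h" "\<And>y. y \<in> V \<Longrightarrow> f y = h y" for f h :: "_ \<Rightarrow> real"
  proof
    fix p assume p: "p \<in> subdiff f U x"
    show "p \<in> subdiff h U x"
    proof (rule subdiff_if_local_min[OF that(1) assms(3-5)])
      fix y assume "y \<in> V"
      then show "h y \<ge> h x + p \<bullet> (y - x)"
        using p assms(4,5) that(2)[of y] that(2)[of x] unfolding subdiff_def by fastforce
    qed
  qed
  from this[of h f] this[of f h] assms show ?thesis by auto
qed

lemma subdiff_monotone:
  assumes "p \<in> subdiff f U x" "q \<in> subdiff f U y" "x \<in> U" "y \<in> U"
  shows "(p - q) \<bullet> (x - y) \<ge> 0"
proof -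
  have "f y \<ge> f x + p \<bullet> (y - x)" "f x \<ge> f y + q \<bullet> (x - y)" using assms by (auto simp: subdiff_def)
  then show ?thesis by (simp add: inner_diff_left inner_diff_right algebra_simps)
qed

text \<open>The subgradient inequality is tested at distance d in the direction of p itself.\<close>

lemma norm_subdiff_le:
  assumes "p \<in> subdiff f U x" "d > 0" "cball x d \<subseteq> U" "\<And>y. y \<in> cball x d \<Longrightarrow> \<bar>f y\<bar> \<le> M"
  shows "norm p \<le> 2 * M / d"
proof (cases "p = 0")
  case True
  have "M \<ge> 0" using assms(4)[of x] assms(2) by (smt (verit) centre_in_cball)
  then show ?thesis using True assms by simp
next
  case False
  let ?y = "x + (d / norm p) *\<^sub>R p"
  have y: "?y \<in> cball x d" using False assms by (simp add: dist_norm)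
  then have "?y \<in> U" using assms(3) by blast
  then have "f ?y \<ge> f x + p \<bullet> (?y - x)" using assms(1) unfolding subdiff_def by blast
  moreover have "p \<bullet> (?y - x) = d * norm p" using False by (simp add: power2_norm_eq_inner[symmetric] power2_eq_square)
  ultimately have "d * norm p \<le> 2 * M" using assms(4)[OF y] assms(4)[of x] assms(2) by (simp add: abs_le_iff)
  then show ?thesis using assms by (simp add: field_simps)
qed

section \<open>Compact subdifferential images and slopes attained twice\<close>

lemma compact_neighbourhood:
  fixes K U :: "'a::euclidean_space set"
  assumes "compact K" "open U" "K \<subseteq> U"
  obtains d K' where "d > 0" "compact K'" "K' \<subseteq> U" "\<And>x. x \<in> K \<Longrightarrow> cball x d \<subseteq> K'"
proof -
  obtain d where d: "d > 0" "(\<Union>x\<in>K. cball x d) \<subseteq> U"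
    using compact_subset_open_imp_cball_epsilon_subset[OF assms] .
  have eq: "(\<Union>x\<in>K. cball x d) = {x + y | x y. x \<in> K \<and> y \<in> cball 0 d}"
  proof (intro equalityI subsetI)
    fix z assume "z \<in> (\<Union>x\<in>K. cball x d)"
    then obtain x where "x \<in> K" "dist x z \<le> d" by auto
    then show "z \<in> {x + y | x y. x \<in> K \<and> y \<in> cball 0 d}"
      by (intro CollectI exI[of _ x] exI[of _ "z - x"]) (auto simp: dist_norm norm_minus_commute)
  next
    fix z assume "z \<in> {x + y | x y. x \<in> K \<and> y \<in> cball 0 d}"
    then obtain x y where "x \<in> K" "norm y \<le> d" "z = x + y" by auto
    then show "z \<in> (\<Union>x\<in>K. cball x d)" by (intro UN_I[of x]) (auto simp: dist_norm)
  qed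
  have "compact {x + y | x y. x \<in> K \<and> y \<in> cball 0 d}" by (intro compact_sums assms compact_cball)
  then have "compact (\<Union>x\<in>K. cball x d)" by (simp only: eq)
  then show ?thesis using that[of d "\<Union>x\<in>K. cball x d"] d by blast
qed

text \<open>Subgradients on K are bounded through the size of f on a compact neighbourhood, and by
  compactness of K a limit of subgradients is a subgradient at some point of K. Measurability and
  local finiteness of Monge-Ampere masses rest on this.\<close>

lemma compact_subdiff_image:
  fixes f :: "'a::euclidean_space \<Rightarrow> real"
  assumes U: "open U" and f: "convex_on U f" and K: "compact K" "K \<subseteq> U"
  shows "compact (\<Union>x\<in>K. subdiff f U x)"
proof -
  have cont: "continuous_on U f" using U f by (rule convex_on_continuous)
  obtain d K' where d: "d > 0" "compact K'" "K' \<subseteq> U" "\<And>x. x \<in> K \<Longrightarrow> cball x d \<subseteq> K'"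
    using compact_neighbourhood[OF K(1) U K(2)] by metis
  have "compact (f ` K')" using cont d by (auto intro!: compact_continuous_image intro: continuous_on_subset)
  then obtain M where M: "\<forall>y\<in>f ` K'. \<bar>y\<bar> \<le> M"
    using compact_imp_bounded[of "f ` K'"] unfolding bounded_real by blast
  have "norm p \<le> 2 * M / d" if "x \<in> K" "p \<in> subdiff f U x" for x p
    using that d M by (intro norm_subdiff_le[where f = f and U = U and x = x]) blast+
  then have bd: "bounded (\<Union>x\<in>K. subdiff f U x)" unfolding bounded_iff by blast
  have "closed (\<Union>x\<in>K. subdiff f U x)"
    unfolding closed_sequential_limits
  proof (intro allI impI, elim conjE)
    fix p l assume p: "\<forall>n. p n \<in> (\<Union>x\<in>K. subdiff f U x)" "p \<longlonglongrightarrow> l"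
    then have "\<forall>n. \<exists>x. x \<in> K \<and> p n \<in> subdiff f U x" by blast
    from choice[OF this] obtain x where x: "\<And>n. x n \<in> K" "\<And>n. p n \<in> subdiff f U (x n)" by blast
    then obtain x0 r where r: "x0 \<in> K" "strict_mono (r :: nat \<Rightarrow> nat)" "(x \<circ> r) \<longlonglongrightarrow> x0"
      using K(1)[unfolded compact_def, rule_format, of x] by blast
    have "l \<in> subdiff f U x0"
      unfolding subdiff_def
    proof safe
      fix y assume y: "y \<in> U"
      have "(\<lambda>n. f ((x \<circ> r) n)) \<longlonglongrightarrow> f x0"
        using r(1) x(1) K(2) by (intro continuous_on_tendsto_compose[OF cont r(3)]) (auto simp: subset_iff)
      moreover have "(p \<circ> r) \<longlonglongrightarrow> l" using p r by (intro LIMSEQ_subseq_LIMSEQ)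
      ultimately have "(\<lambda>n. f ((x \<circ> r) n) + (p \<circ> r) n \<bullet> (y - (x \<circ> r) n)) \<longlonglongrightarrow> f x0 + l \<bullet> (y - x0)"
        using r by (intro tendsto_intros)
      moreover have "f ((x \<circ> r) n) + (p \<circ> r) n \<bullet> (y - (x \<circ> r) n) \<le> f y" for n
        using x(2)[of "r n"] y by (auto simp: subdiff_def)
      ultimately show "f x0 + l \<bullet> (y - x0) \<le> f y" by (intro LIMSEQ_le_const2) auto
    qed
    then show "l \<in> (\<Union>x\<in>K. subdiff f U x)" using r by blast
  qed
  then show ?thesis using bd by (simp add: compact_eq_bounded_closed)
qed

text \<open>Arbitrarily many disjoint translates of S along i, all of the same measure, fit into one
  bounded set.\<close>

lemma negligible_if_lines_meet_once:
  fixes S :: "'a::euclidean_space set"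
  assumes S: "compact S" and once: "\<And>p t. p \<in> S \<Longrightarrow> t > 0 \<Longrightarrow> p + t *\<^sub>R i \<notin> S"
  shows "negligible S"
proof -
  \<comment> \<open>The shifts 1/(n+1) are distinct, which makes the translates disjoint, and at
    most 1, which keeps them in W.\<close>
  define T where "T n = (+) ((1 / real (Suc n)) *\<^sub>R i) ` S" for n
  define W where "W = {x + y | x y. x \<in> cball 0 (norm i) \<and> y \<in> S}"
  have W: "W \<in> lmeasurable"
    unfolding W_def by (intro lmeasurable_compact compact_sums S compact_cball)
  have T: "T n \<in> lmeasurable" for n
    unfolding T_def by (intro lmeasurable_compact compact_translation S)
  have TW: "T n \<subseteq> W" for n
  proof -
    have "(1 / real (Suc n)) * norm i \<le> 1 * norm i" by (intro mult_right_mono) auto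
    then have "(1 / real (Suc n)) *\<^sub>R i \<in> cball 0 (norm i)" by simp
    then show ?thesis unfolding T_def W_def by blast
  qed
  have dis': "disjnt ((+) (a *\<^sub>R i) ` S) ((+) (b *\<^sub>R i) ` S)" if "a < b" for a b
    unfolding disjnt_iff
  proof (intro allI notI, elim conjE imageE)
    fix z p q assume z: "z = a *\<^sub>R i + p" "p \<in> S" "z = b *\<^sub>R i + q" "q \<in> S"
    then have "p = q + (b - a) *\<^sub>R i" by (simp add: algebra_simps)
    then show False using once[OF z(4), of "b - a"] z(2) that by simp
  qed
  have dis: "disjnt (T m) (T n)" if "m \<noteq> n" for m n
  proof -
    have "1 / real (Suc m) \<noteq> 1 / real (Suc n)" using that by simp
    then consider "1 / real (Suc m) < 1 / real (Suc n)" | "1 / real (Suc n) < 1 / real (Suc m)" by linarith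
    then show ?thesis unfolding T_def by cases (use dis' disjnt_sym in blast)+
  qed
  have "real n * measure lebesgue S \<le> measure lebesgue W" for n
  proof -
    have "real n * measure lebesgue S = (\<Sum>j<n. measure lebesgue (T j))"
      by (simp add: T_def measure_translation)
    also have "\<dots> = measure lebesgue (\<Union>j<n. T j)"
      using T dis by (intro measure_UNION'[symmetric]) (auto simp: pairwise_def)
    also have "\<dots> \<le> measure lebesgue W"
      using TW T W by (intro measure_mono_fmeasurable sets.finite_UN) auto
    finally show ?thesis .
  qed
  then have "measure lebesgue S = 0"
    by (intro real_archimedian_rdiv_eq_0[OF measure_nonneg, where c = "measure lebesgue W"]) auto
  then show ?thesis using lmeasurable_compact[OF S] by (simp add: negligible_iff_measure0)
qed

text \<open>The obstruction to additivity of the set function in \<open>MA\<close>: such a slope can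
  be counted for two disjoint sets.\<close>

definition multi_slopes :: "('a::euclidean_space \<Rightarrow> real) \<Rightarrow> 'a set \<Rightarrow> 'a set" where
  "multi_slopes f U = {p. \<exists>x\<in>U. \<exists>y\<in>U. x \<noteq> y \<and> p \<in> subdiff f U x \<and> p \<in> subdiff f U y}"

text \<open>Two points with the same slope are separated in some coordinate by rationals c < d. The
  slopes occurring on both sides form a compact set N, and monotonicity of the subdifferential
  forbids p and p + t i with t > 0 both to lie in N.\<close>

lemma negligible_multi_slopes:
  fixes f :: "'a::euclidean_space \<Rightarrow> real"
  assumes U: "open U" and f: "convex_on U f"
  shows "negligible (multi_slopes f U)"
proof -
  obtain C where C: "\<And>n. compact (C n)" "\<And>n. C n \<subseteq> U" "\<And>n. C n \<subseteq> interior (C (Suc n))" "\<Union>(range C) = U"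
    "\<And>K. compact K \<Longrightarrow> K \<subseteq> U \<Longrightarrow> \<exists>N. \<forall>n\<ge>N. K \<subseteq> C n"
    using open_Union_compact_subsets[OF U] by metis
  \<comment> \<open>Two thresholds rather than one keep both halves closed, so that N is compact,
    and still strictly separated.\<close>
  define N where "N n i c d = (\<Union>x\<in>C n \<inter> {x. i \<bullet> x \<le> c}. subdiff f U x) \<inter> (\<Union>x\<in>C n \<inter> {x. i \<bullet> x \<ge> d}. subdiff f U x)"
    for n i c d
  have N: "negligible (N n i c d)" if "c < d" for n i c d
  proof (rule negligible_if_lines_meet_once[where i = i])
    show "compact (N n i c d)" unfolding N_def
      using C(2) by (intro compact_Int compact_subdiff_image[OF U f] compact_Int_closed C(1)
        closed_halfspace_le closed_halfspace_ge) auto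
    fix p t assume p: "p \<in> N n i c d" and t: "(t::real) > 0"
    show "p + t *\<^sub>R i \<notin> N n i c d"
    proof
      assume "p + t *\<^sub>R i \<in> N n i c d"
      then obtain x y where "x \<in> C n" "i \<bullet> x \<le> c" "p + t *\<^sub>R i \<in> subdiff f U x"
        "y \<in> C n" "i \<bullet> y \<ge> d" "p \<in> subdiff f U y" using p unfolding N_def by blast
      then have "(p + t *\<^sub>R i - p) \<bullet> (x - y) \<ge> 0" using C(2) by (intro subdiff_monotone[where f = f and U = U]) auto
      then have "i \<bullet> x \<ge> i \<bullet> y" using t by (simp add: inner_diff_right zero_le_mult_iff)
      then show False using \<open>i \<bullet> x \<le> c\<close> \<open>i \<bullet> y \<ge> d\<close> that by linarith
    qed
  qed
  let ?I = "{(n :: nat, i, c, d). i \<in> (Basis::'a set) \<and> c \<in> \<rat> \<and> d \<in> \<rat> \<and> c < (d::real)}"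
  have "?I \<subseteq> UNIV \<times> (Basis::'a set) \<times> \<rat> \<times> \<rat>" by auto
  moreover have "countable ((UNIV :: nat set) \<times> (Basis::'a set) \<times> (\<rat> :: real set) \<times> (\<rat> :: real set))"
    by (intro countable_SIGMA countableI_type countable_rat countable_finite[OF finite_Basis])
  ultimately have cI: "countable ?I" by (rule countable_subset)
  have "negligible (\<Union>((\<lambda>(n, i, c, d). N n i c d) ` ?I))"
  proof (rule negligible_countable_Union)
    show "negligible S" if S: "S \<in> (\<lambda>(n, i, c, d). N n i c d) ` ?I" for S
    proof -
      obtain n i c d where "S = N n i c d" "c < d" using S by auto
      then show ?thesis using N by simp
    qed
  qed (use cI in blast)
  moreover have "multi_slopes f U \<subseteq> \<Union>((\<lambda>(n, i, c, d). N n i c d) ` ?I)"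
  proof
    fix p assume "p \<in> multi_slopes f U"
    then obtain x y where xy: "x \<in> U" "y \<in> U" "x \<noteq> y" "p \<in> subdiff f U x" "p \<in> subdiff f U y"
      unfolding multi_slopes_def by blast
    have "\<exists>x y i. x \<in> U \<and> y \<in> U \<and> p \<in> subdiff f U x \<and> p \<in> subdiff f U y \<and> i \<in> Basis \<and> i \<bullet> x < i \<bullet> y"
    proof -
      obtain i where "i \<in> Basis" "i \<bullet> x \<noteq> i \<bullet> y" using xy(3) euclidean_eq_iff[of x y] by (auto simp: inner_commute)
      then show ?thesis using xy by (meson linorder_neqE_linordered_idom)
    qed
    then obtain x y i where xy: "x \<in> U" "y \<in> U" "p \<in> subdiff f U x" "p \<in> subdiff f U y"
      "i \<in> Basis" "i \<bullet> x < i \<bullet> y" by blast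
    obtain c where c: "c \<in> \<rat>" "i \<bullet> x < c" "c < i \<bullet> y" using Rats_dense_in_real[OF xy(6)] by blast
    obtain d where d: "d \<in> \<rat>" "c < d" "d < i \<bullet> y" using Rats_dense_in_real[OF c(3)] by blast
    obtain n where n: "{x, y} \<subseteq> C n" using C(5)[of "{x,y}"] xy by (metis bot_least finite.emptyI finite_imp_compact finite_insert insert_subset le_refl)
    have "p \<in> N n i c d" unfolding N_def using n xy c d by force
    then show "p \<in> \<Union>((\<lambda>(n, i, c, d). N n i c d) ` ?I)"
      using xy c d by (intro UnionI[OF imageI[of "(n, i, c, d)"]]) auto
  qed
  ultimately show ?thesis by (rule negligible_subset)
qed

text \<open>Exhaustion by compact sets. Open sets are enough to check Borel measurability of
  \<open>slope_point\<close> later.\<close>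

lemma sets_subdiff_image_open:
  fixes f :: "'a::euclidean_space \<Rightarrow> real"
  assumes U: "open U" and f: "convex_on U f" and W: "open W" "W \<subseteq> U"
  shows "(\<Union>x\<in>W. subdiff f U x) \<in> sets lebesgue"
proof -
  obtain C :: "nat \<Rightarrow> 'a set" where C: "\<And>n. compact (C n)" "\<And>n. C n \<subseteq> W"
      "\<And>n. C n \<subseteq> interior (C (Suc n))" "\<Union>(range C) = W"
      "\<And>K. compact K \<Longrightarrow> K \<subseteq> W \<Longrightarrow> \<exists>N. \<forall>n\<ge>N. K \<subseteq> C n"
    using open_Union_compact_subsets[OF W(1)] by metis
  have "(\<Union>x\<in>C n. subdiff f U x) \<in> sets lebesgue" for n
    by (intro fmeasurableD lmeasurable_compact compact_subdiff_image[OF U f] C(1) order_trans[OF C(2) W(2)])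
  then have "(\<Union>n. \<Union>x\<in>C n. subdiff f U x) \<in> sets lebesgue" by (intro sets.countable_UN) auto
  also have "(\<Union>n. \<Union>x\<in>C n. subdiff f U x) = (\<Union>x\<in>W. subdiff f U x)" unfolding C(4)[symmetric] by blast
  finally show ?thesis .
qed

text \<open>Almost every slope in the image of the subdifferential is attained at exactly one point;
  sending such a slope to its point pushes Lebesgue measure forward to the Monge-Ampere measure.\<close>

definition slopes :: "('a::euclidean_space \<Rightarrow> real) \<Rightarrow> 'a set \<Rightarrow> 'a set" where
  "slopes f U = (\<Union>x\<in>U. subdiff f U x) - multi_slopes f U"

definition slope_point :: "('a::euclidean_space \<Rightarrow> real) \<Rightarrow> 'a set \<Rightarrow> 'a \<Rightarrow> 'a" where
  "slope_point f U p = (SOME x. x \<in> U \<and> p \<in> subdiff f U x)"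

lemma slope_point:
  assumes "p \<in> slopes f U"
  shows "slope_point f U p \<in> U" "p \<in> subdiff f U (slope_point f U p)"
proof -
  have "\<exists>x. x \<in> U \<and> p \<in> subdiff f U x" using assms unfolding slopes_def by blast
  from someI_ex[OF this] show "slope_point f U p \<in> U" "p \<in> subdiff f U (slope_point f U p)"
    unfolding slope_point_def by auto
qed

lemma slope_point_eq:
  assumes "x \<in> U" "p \<in> subdiff f U x" "p \<notin> multi_slopes f U"
  shows "p \<in> slopes f U" "slope_point f U p = x"
proof -
  show p: "p \<in> slopes f U" using assms unfolding slopes_def by blast
  show "slope_point f U p = x" using slope_point[OF p] assms unfolding multi_slopes_def by blast
qed

lemma slopes_vimage: "slopes f U \<inter> slope_point f U -` B = (\<Union>x\<in>B \<inter> U. subdiff f U x) - multi_slopes f U"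
proof (intro equalityI subsetI)
  fix p assume p: "p \<in> slopes f U \<inter> slope_point f U -` B"
  then show "p \<in> (\<Union>x\<in>B \<inter> U. subdiff f U x) - multi_slopes f U"
    using slope_point[of p f U] unfolding slopes_def by blast
next
  fix p assume "p \<in> (\<Union>x\<in>B \<inter> U. subdiff f U x) - multi_slopes f U"
  then obtain x where x: "x \<in> B" "x \<in> U" "p \<in> subdiff f U x" "p \<notin> multi_slopes f U" by blast
  from slope_point_eq[OF x(2-4)] x(1) show "p \<in> slopes f U \<inter> slope_point f U -` B" by simp
qed

lemma sets_slopes:
  assumes U: "open U" and f: "convex_on U f"
  shows "slopes f U \<in> sets lebesgue"
  unfolding slopes_def using negligible_multi_slopes[OF U f]
  by (intro sets.Diff sets_subdiff_image_open[OF U f U]) (auto simp: negligible_iff_null_sets)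

text \<open>Preimages of open sets are subdifferential images of open sets with the null set
  \<open>multi_slopes\<close> removed.\<close>

lemma slope_point_measurable:
  fixes f :: "'a::euclidean_space \<Rightarrow> real"
  assumes U: "open U" and f: "convex_on U f"
  shows "slope_point f U \<in> measurable (restrict_space lebesgue (slopes f U)) borel"
proof (rule borel_measurableI)
  fix S :: "'a set" assume S: "open S"
  have "slope_point f U -` S \<inter> space (restrict_space lebesgue (slopes f U)) = slopes f U \<inter> slope_point f U -` S"
    by (auto simp: space_restrict_space)
  also have "\<dots> \<in> sets (restrict_space lebesgue (slopes f U))"
  proof -
    have "(\<Union>x\<in>S \<inter> U. subdiff f U x) - multi_slopes f U \<in> sets lebesgue"
      using negligible_multi_slopes[OF U f] S U
      by (intro sets.Diff sets_subdiff_image_open[OF U f]) (auto simp: negligible_iff_null_sets)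
    then show ?thesis
      using sets_slopes[OF U f] unfolding slopes_vimage[symmetric] by (subst sets_restrict_space_iff) auto
  qed
  finally show "slope_point f U -` S \<inter> space (restrict_space lebesgue (slopes f U))
      \<in> sets (restrict_space lebesgue (slopes f U))" .
qed

text \<open>\<open>measure_of\<close> returns the zero measure when its set function is not
  countably additive, so \<open>MA\<close> has the intended values only once additivity is known. A
  push-forward is a measure, and it agrees with the set function because the slopes that it leaves
  out form a null set.\<close>

lemma MA_eq_distr:
  fixes f :: "'a::euclidean_space \<Rightarrow> real"
  assumes U: "open U" and f: "convex_on U f"
  shows "MA U f = distr (restrict_space lebesgue (slopes f U)) borel (slope_point f U)" (is "_ = ?M")
    and "B \<in> sets borel \<Longrightarrow> emeasure (MA U f) B = emeasure lebesgue (\<Union>x\<in>B \<inter> U. subdiff f U x)"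
proof -
  have eq: "emeasure ?M B = emeasure lebesgue (\<Union>x\<in>B \<inter> U. subdiff f U x)" if B: "B \<in> sets borel" for B
  proof -
    let ?A = "slopes f U \<inter> slope_point f U -` B"
    have vs: "slope_point f U -` B \<inter> space (restrict_space lebesgue (slopes f U)) = ?A"
      by (auto simp: space_restrict_space)
    have "emeasure ?M B = emeasure (restrict_space lebesgue (slopes f U)) ?A"
      using emeasure_distr[OF slope_point_measurable[OF U f] B] unfolding vs .
    also have "\<dots> = emeasure lebesgue ?A"
      using sets_slopes[OF U f] by (intro emeasure_restrict_space) auto
    also have "\<dots> = emeasure lebesgue (?A \<union> ((\<Union>x\<in>B \<inter> U. subdiff f U x) \<inter> multi_slopes f U))"
    proof (rule emeasure_Un_null_set[symmetric])
      have "?A \<in> sets (restrict_space lebesgue (slopes f U))"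
        using measurable_sets[OF slope_point_measurable[OF U f] B] unfolding vs .
      then show "?A \<in> sets lebesgue"
        using sets_slopes[OF U f] by (subst (asm) sets_restrict_space_iff) auto
      show "(\<Union>x\<in>B \<inter> U. subdiff f U x) \<inter> multi_slopes f U \<in> null_sets lebesgue"
        using negligible_multi_slopes[OF U f] by (simp add: negligible_Int flip: negligible_iff_null_sets)
    qed
    also have "?A \<union> ((\<Union>x\<in>B \<inter> U. subdiff f U x) \<inter> multi_slopes f U) = (\<Union>x\<in>B \<inter> U. subdiff f U x)"
      unfolding slopes_vimage by blast
    finally show ?thesis .
  qed
  have "MA U f = measure_of UNIV (sets borel) (emeasure ?M)"
    unfolding MA_def by (rule measure_of_eq) (simp_all add: sets.sigma_sets_eq[of borel, simplified] eq)
  also have "\<dots> = ?M" using measure_of_of_measure[of ?M] by simp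
  finally show MA: "MA U f = ?M" .
  show "emeasure (MA U f) B = emeasure lebesgue (\<Union>x\<in>B \<inter> U. subdiff f U x)" if "B \<in> sets borel"
    unfolding MA using that by (rule eq)
qed

text \<open>The second part supplies the measurability that dominated convergence asks of the pulled
  back integrands.\<close>

lemma integral_MA:
  fixes f :: "'a::euclidean_space \<Rightarrow> real" and g :: "'a \<Rightarrow> 'b::{banach, second_countable_topology}"
  assumes U: "open U" and f: "convex_on U f" and g: "g \<in> borel_measurable borel"
  shows "(\<integral>x. g x \<partial>MA U f) = (\<integral>p. indicator (slopes f U) p *\<^sub>R g (slope_point f U p) \<partial>lebesgue)"
    and "(\<lambda>p. indicator (slopes f U) p *\<^sub>R g (slope_point f U p)) \<in> borel_measurable lebesgue"
proof -
  show "(\<integral>x. g x \<partial>MA U f) = (\<integral>p. indicator (slopes f U) p *\<^sub>R g (slope_point f U p) \<partial>lebesgue)"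
    unfolding MA_eq_distr(1)[OF U f] integral_distr[OF slope_point_measurable[OF U f] g]
    using sets_slopes[OF U f] by (intro integral_restrict_space) simp
  have "(\<lambda>p. g (slope_point f U p)) \<in> borel_measurable (restrict_space lebesgue (slopes f U))"
    by (rule measurable_compose[OF slope_point_measurable[OF U f] g])
  then show "(\<lambda>p. indicator (slopes f U) p *\<^sub>R g (slope_point f U p)) \<in> borel_measurable lebesgue"
    using sets_slopes[OF U f] by (subst (asm) borel_measurable_restrict_space_iff) auto
qed

section \<open>Radon property and Monge-Ampere measures of cones\<close>

lemma sets_MA [simp]: "sets (MA U f) = sets borel"
  using sets.sigma_sets_eq[of borel] by (simp add: MA_def)

lemma space_MA [simp]: "space (MA U f) = UNIV"
  by (simp add: MA_def)

lemma pos_radon_MA: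
  assumes U: "open U" and f: "convex_on U f"
  shows "pos_radon_on U (MA U f)"
proof -
  have "emeasure (MA U f) K < \<infinity>" if "compact K" "K \<subseteq> U" for K
  proof -
    have "K \<inter> U = K" using that by blast
    then have "emeasure (MA U f) K = emeasure lebesgue (\<Union>x\<in>K. subdiff f U x)"
      using that by (simp only: MA_eq_distr(2)[OF U f] borel_compact)
    moreover have "emeasure lebesgue (\<Union>x\<in>K. subdiff f U x) \<noteq> top"
      using that by (intro fmeasurableD2 lmeasurable_compact compact_subdiff_image[OF U f])
    ultimately show ?thesis by (simp only: less_top infinity_ennreal_def)
  qed
  moreover have "emeasure (MA U f) (UNIV - U) = 0"
  proof -
    have "(UNIV - U) \<inter> U = {}" by blast
    moreover have "UNIV - U \<in> sets borel" using U by (intro sets.Diff) auto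
    ultimately show ?thesis using MA_eq_distr(2)[OF U f, of "UNIV - U"] by simp
  qed
  ultimately show ?thesis by (simp add: pos_radon_on_def)
qed

text \<open>The classical fact that a body is the subdifferential of its support function at the
  origin. A slope outside P is separated from P, and positive homogeneity lets the contradiction be
  found at a point of U close to x.\<close>

lemma subdiff_support_fun:
  fixes P :: "'a::euclidean_space set"
  assumes U: "open U" and x: "x \<in> U" and P: "compact P" "convex P" "P \<noteq> {}"
  shows "subdiff (\<lambda>y. support_fun P (y - x)) U x = P"
proof (intro equalityI subsetI)
  have b: "bounded P" using P compact_imp_bounded by blast
  fix p assume "p \<in> P"
  then have "p \<bullet> v \<le> support_fun P v" for v using b support_fun_upper by blast
  then show "p \<in> subdiff (\<lambda>y. support_fun P (y - x)) U x"
    using P by (auto simp: subdiff_def support_fun_def)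
next
  have b: "bounded P" using P compact_imp_bounded by blast
  fix p assume p: "p \<in> subdiff (\<lambda>y. support_fun P (y - x)) U x"
  show "p \<in> P"
  proof (rule ccontr)
    assume "p \<notin> P"
    then obtain a c where ac: "a \<bullet> p < c" "\<forall>q\<in>P. a \<bullet> q > c"
      using separating_hyperplane_closed_point[of P p] P compact_imp_closed by blast
    have lt: "support_fun P (- a) \<le> - c"
      using ac P by (intro support_fun_least) (auto simp: inner_commute less_imp_le)
    obtain t :: real where t: "0 < t" and tU: "x + t *\<^sub>R (- a) \<in> U"
      using open_small_step[OF U x] by blast
    from tU have "support_fun P (t *\<^sub>R (- a)) \<ge> support_fun P 0 + p \<bullet> (t *\<^sub>R (- a))"
      using p by (force simp: subdiff_def)
    then have "t * support_fun P (- a) \<ge> t * (p \<bullet> (- a))"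
      using support_fun_pos_homogeneous[OF b P(3), of t "- a"] support_fun_pos_homogeneous[OF b P(3), of 0 0] t by simp
    then have "support_fun P (- a) \<ge> p \<bullet> (- a)" using t by (simp only: mult_le_cancel_left_pos)
    then show False using lt ac(1) by (simp add: inner_commute)
  qed
qed

text \<open>By homogeneity an affine minorant touching the cone at y also touches it at the apex x.
  So all slopes lie in P, and those attained away from x are attained twice and hence null.\<close>

lemma emeasure_MA_support_fun:
  fixes P :: "'a::euclidean_space set"
  assumes U: "open U" "convex U" and x: "x \<in> U" and P: "compact P" "convex P" "P \<noteq> {}" and B: "B \<in> sets borel"
  shows "emeasure (MA U (\<lambda>y. support_fun P (y - x))) B = (if x \<in> B then emeasure lebesgue P else 0)"
proof -
  let ?f = "\<lambda>y. support_fun P (y - x)"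
  have b: "bounded P" using P compact_imp_bounded by blast
  have f: "convex_on U ?f" using b P U by (intro convex_on_support_fun)
  have sub: "p \<in> subdiff ?f U x" if y: "y \<in> U" and p: "p \<in> subdiff ?f U y" for y p
  proof -
    have h0: "support_fun P 0 = 0" using support_fun_pos_homogeneous[OF b P(3), of 0 0] by simp
    have 1: "support_fun P (z - x) \<ge> support_fun P (y - x) + p \<bullet> (z - y)" if "z \<in> U" for z
      using p that by (auto simp: subdiff_def)
    \<comment> \<open>A step outward on the ray from x through y, for which openness of U leaves
      room, shows that p \<bullet> (y - x) is at most the value of the cone at y.\<close>
    obtain t :: real where t: "0 < t" and tU: "y + t *\<^sub>R (y - x) \<in> U"
      using open_small_step[OF U(1) y] by blast
    from 1[OF tU] have "support_fun P ((1 + t) *\<^sub>R (y - x)) \<ge> support_fun P (y - x) + t * (p \<bullet> (y - x))"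
      by (simp add: algebra_simps)
    then have "t * support_fun P (y - x) \<ge> t * (p \<bullet> (y - x))"
      using support_fun_pos_homogeneous[OF b P(3), of "1 + t" "y - x"] t by (simp add: algebra_simps)
    then have "support_fun P (y - x) \<ge> p \<bullet> (y - x)" using t by simp
    then have "support_fun P (z - x) \<ge> p \<bullet> (z - x)" if "z \<in> U" for z
      using 1[OF that] by (simp add: inner_diff_right)
    then show ?thesis by (auto simp: subdiff_def h0)
  qed
  show ?thesis
  proof (cases "x \<in> B")
    case True
    have "(\<Union>y\<in>B \<inter> U. subdiff ?f U y) \<subseteq> P"
      using sub unfolding subdiff_support_fun[OF U(1) x P] by auto
    moreover have "P \<subseteq> (\<Union>y\<in>B \<inter> U. subdiff ?f U y)"
      using UN_upper[of x "B \<inter> U" "subdiff ?f U"] True x subdiff_support_fun[OF U(1) x P] by simp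
    ultimately have "(\<Union>y\<in>B \<inter> U. subdiff ?f U y) = P" by (rule equalityI)
    then show ?thesis using MA_eq_distr(2)[OF U(1) f B] True by simp
  next
    case False
    have "(\<Union>y\<in>B \<inter> U. subdiff ?f U y) \<subseteq> multi_slopes ?f U"
    proof
      fix p assume "p \<in> (\<Union>y\<in>B \<inter> U. subdiff ?f U y)"
      then obtain y where y: "y \<in> B" "y \<in> U" "p \<in> subdiff ?f U y" by auto
      then have "x \<noteq> y" using False by auto
      with y sub[OF y(2,3)] x show "p \<in> multi_slopes ?f U" unfolding multi_slopes_def by blast
    qed
    then have "negligible (\<Union>y\<in>B \<inter> U. subdiff ?f U y)"
      by (rule negligible_subset[OF negligible_multi_slopes[OF U(1) f]])
    then have "emeasure lebesgue (\<Union>y\<in>B \<inter> U. subdiff ?f U y) = 0"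
      unfolding negligible_iff_null_sets by (rule null_setsD1)
    then show ?thesis unfolding MA_eq_distr(2)[OF U(1) f B] using False by (simp only: if_False)
  qed
qed

lemma emeasure_MA_cong_local:
  assumes U: "open U" and f: "convex_on U f" "convex_on U h" and V: "open V" "V \<subseteq> U" "\<And>y. y \<in> V \<Longrightarrow> f y = h y"
    and B: "B \<in> sets borel" "B \<subseteq> V"
  shows "emeasure (MA U f) B = emeasure (MA U h) B"
proof -
  have "subdiff f U x = subdiff h U x" if "x \<in> B" for x
    using that B V by (intro subdiff_cong_local[OF f V(1,2)]) auto
  then show ?thesis using MA_eq_distr(2)[OF U f(1) B(1)] MA_eq_distr(2)[OF U f(2) B(1)] by simp
qed

section \<open>Weak continuity of the Monge-Ampere measure\<close>

text \<open>As p is attained at x alone, f exceeds its affine minorant by at least some e > 0 on the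
  sphere around x. A perturbation of less than e/3 cannot push the minimum of the perturbed function
  minus p out to the sphere; it lies in the open ball, where a local minimum makes p a
  subgradient.\<close>

lemma subdiff_stable:
  fixes f :: "'a::euclidean_space \<Rightarrow> real"
  assumes U: "open U" and f: "convex_on U f" and fs: "\<And>k. convex_on U (fs k)" and lim: "conv_loc_unif U fs f"
    and x: "x \<in> U" and p: "p \<in> subdiff f U x" "p \<notin> multi_slopes f U" and r: "r > 0" "cball x r \<subseteq> U"
  shows "eventually (\<lambda>k. \<exists>y\<in>cball x r. p \<in> subdiff (fs k) U y) sequentially"
proof -
  define u where "u y = f y - f x - p \<bullet> (y - x)" for y
  have cont: "continuous_on U f" using U f by (rule convex_on_continuous)
  have "sphere x r \<noteq> {}" using r by simp
  moreover have "sphere x r \<subseteq> U" using r(2) sphere_cball[of x r] by blast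
  then have "continuous_on (sphere x r) u"
    unfolding u_def by (intro continuous_intros continuous_on_subset[OF cont])
  ultimately obtain z where z: "z \<in> sphere x r" "\<And>y. y \<in> sphere x r \<Longrightarrow> u z \<le> u y"
    using continuous_attains_inf[of "sphere x r" u] by auto
  define e where "e = u z"
  have zU: "z \<in> U" "z \<noteq> x" using z r by auto
  have e: "e > 0"
  proof (rule ccontr)
    assume "\<not> e > 0"
    then have le: "f z \<le> f x + p \<bullet> (z - x)" unfolding e_def u_def by simp
    have "f y \<ge> f z + p \<bullet> (y - z)" if "y \<in> U" for y
    proof -
      have "f y \<ge> f x + p \<bullet> (y - x)" using p(1) that by (auto simp: subdiff_def)
      then show ?thesis using le by (simp add: inner_diff_right)
    qed
    then have "p \<in> subdiff f U z" by (auto simp: subdiff_def)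
    then have "p \<in> multi_slopes f U" using p(1) zU x unfolding multi_slopes_def by blast
    then show False using p(2) by simp
  qed
  have "uniform_limit (cball x r) fs f sequentially" using lim r unfolding conv_loc_unif_def by auto
  then have "eventually (\<lambda>k. \<forall>y\<in>cball x r. dist (fs k y) (f y) < e / 3) sequentially"
    by (rule uniform_limit_iff[THEN iffD1, rule_format]) (use e in simp)
  then show ?thesis
  proof eventually_elim
    case (elim k)
    define w where "w y = fs k y - p \<bullet> y" for y
    have "continuous_on (cball x r) w"
      unfolding w_def using r convex_on_continuous[OF U fs[of k]]
      by (intro continuous_intros) (auto intro: continuous_on_subset)
    moreover have "cball x r \<noteq> {}" using r by simp
    ultimately obtain y where y: "y \<in> cball x r" "\<And>y'. y' \<in> cball x r \<Longrightarrow> w y \<le> w y'"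
      using continuous_attains_inf[of "cball x r" w] by auto
    have "y \<notin> sphere x r"
    proof
      assume s: "y \<in> sphere x r"
      have "e \<le> u y" unfolding e_def by (rule z(2)[OF s])
      moreover have "\<bar>fs k y - f y\<bar> < e / 3" "\<bar>fs k x - f x\<bar> < e / 3"
        using elim y(1) r by (auto simp: dist_real_def)
      moreover have "w y \<le> w x" using y(2)[of x] r by simp
      \<comment> \<open>A minimiser on the sphere would give u y < w y - w x + 2e/3 \<le> 2e/3,
        against u y \<ge> e.\<close>
      ultimately show False unfolding u_def w_def inner_diff_right by linarith
    qed
    then have yb: "y \<in> ball x r" using y(1) by auto
    have "p \<in> subdiff (fs k) U y"
    proof (rule subdiff_if_local_min[OF fs open_ball _ yb])
      show "ball x r \<subseteq> U" using r ball_subset_cball by blast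
      fix y' assume "y' \<in> ball x r"
      then have "w y \<le> w y'" using y(2)[of y'] by auto
      then show "fs k y' \<ge> fs k y + p \<bullet> (y' - y)" unfolding w_def by (simp add: inner_diff_right)
    qed
    then show ?case using y(1) by blast
  qed
qed

text \<open>Contact points in K accumulate in K, and the subgradient inequality survives the limit.
  The hypothesis is \<open>frequently\<close> because the contrapositive is applied: a p that is no
  slope of f over K is eventually missing over K.\<close>

lemma subdiff_limit:
  fixes f :: "'a::euclidean_space \<Rightarrow> real"
  assumes U: "open U" and f: "convex_on U f" and lim: "conv_loc_unif U fs f"
    and K: "compact K" "K \<subseteq> U" and freq: "frequently (\<lambda>k. \<exists>x\<in>K. p \<in> subdiff (fs k) U x) sequentially"
  shows "\<exists>x\<in>K. p \<in> subdiff f U x"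
proof -
  have cont: "continuous_on U f" using U f by (rule convex_on_continuous)
  define S where "S = {k. \<exists>x\<in>K. p \<in> subdiff (fs k) U x}"
  have "infinite S"
    using freq unfolding S_def frequently_def eventually_sequentially infinite_nat_iff_unbounded_le by auto
  define s where "s = enumerate S"
  have s: "strict_mono s" unfolding s_def by (rule strict_mono_enumerate[OF \<open>infinite S\<close>])
  have "s n \<in> S" for n unfolding s_def by (rule enumerate_in_set[OF \<open>infinite S\<close>])
  then have "\<forall>n. \<exists>x. x \<in> K \<and> p \<in> subdiff (fs (s n)) U x" unfolding S_def by blast
  from choice[OF this] obtain x where x: "\<And>n. x n \<in> K" "\<And>n. p \<in> subdiff (fs (s n)) U (x n)" by blast
  obtain x0 r where r: "x0 \<in> K" "strict_mono (r :: nat \<Rightarrow> nat)" "(x \<circ> r) \<longlonglongrightarrow> x0"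
    using K(1)[unfolded compact_def, rule_format, of x] x(1) by blast
  define t where "t = s \<circ> r"
  have t: "strict_mono t" unfolding t_def using s r(2) by (rule strict_mono_o)
  have pt: "(\<lambda>n. fs (t n) y) \<longlonglongrightarrow> f y" if "y \<in> U" for y
  proof -
    have "(\<lambda>n. fs n y) \<longlonglongrightarrow> f y"
      using lim[unfolded conv_loc_unif_def, rule_format, of "{y}"] that by simp
    then show ?thesis using LIMSEQ_subseq_LIMSEQ[OF _ t] by (simp add: o_def)
  qed
  have fx: "(\<lambda>n. fs (t n) (x (r n))) \<longlonglongrightarrow> f x0"
  proof -
    have "(\<lambda>n. f ((x \<circ> r) n)) \<longlonglongrightarrow> f x0"
      using r(1) x(1) K(2) by (intro continuous_on_tendsto_compose[OF cont r(3)]) (auto simp: subset_iff)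
    moreover have "(\<lambda>n. fs (t n) (x (r n)) - f (x (r n))) \<longlonglongrightarrow> 0"
    proof (rule tendstoI)
      fix e :: real assume "e > 0"
      have "uniform_limit K fs f sequentially" using lim K unfolding conv_loc_unif_def by auto
      then have "eventually (\<lambda>n. \<forall>y\<in>K. dist (fs n y) (f y) < e) sequentially"
        using \<open>e > 0\<close> unfolding uniform_limit_iff by simp
      then have "eventually (\<lambda>n. \<forall>y\<in>K. dist (fs (t n) y) (f y) < e) sequentially"
        by (rule eventually_compose_filterlim[OF _ filterlim_subseq[OF t]])
      then show "eventually (\<lambda>n. dist (fs (t n) (x (r n)) - f (x (r n))) 0 < e) sequentially"
        by eventually_elim (use x(1) in \<open>auto simp: dist_real_def\<close>)
    qed
    ultimately have "(\<lambda>n. (fs (t n) (x (r n)) - f (x (r n))) + f ((x \<circ> r) n)) \<longlonglongrightarrow> 0 + f x0"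
      by (intro tendsto_add)
    then show ?thesis by simp
  qed
  have "p \<in> subdiff f U x0"
    unfolding subdiff_def
  proof safe
    fix y assume y: "y \<in> U"
    have "(\<lambda>n. fs (t n) (x (r n)) + p \<bullet> (y - (x \<circ> r) n)) \<longlonglongrightarrow> f x0 + p \<bullet> (y - x0)"
      by (intro tendsto_intros fx r)
    moreover have "fs (t n) (x (r n)) + p \<bullet> (y - (x \<circ> r) n) \<le> fs (t n) y" for n
      using x(2)[of "r n"] y by (auto simp: subdiff_def t_def)
    ultimately show "f x0 + p \<bullet> (y - x0) \<le> f y"
      using pt[OF y] by (intro LIMSEQ_le) auto
  qed
  then show ?thesis using r by blast
qed

text \<open>Outside a null set of slopes, p either is a slope of f and its contact points converge,
  or it is eventually no slope over K. Slopes over K stay bounded for large k, so a multiple of the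
  indicator of a ball dominates.\<close>

lemma integral_MA_tendsto:
  fixes f :: "'a::euclidean_space \<Rightarrow> real" and g :: "'a \<Rightarrow> complex"
  assumes U: "open U" and f: "convex_on U f" and fs: "\<And>k. convex_on U (fs k)" and lim: "conv_loc_unif U fs f"
    and g: "g \<in> borel_measurable borel" "continuous_on U g" and K: "compact K" "K \<subseteq> U" "\<And>x. x \<notin> K \<Longrightarrow> g x = 0"
  shows "(\<lambda>k. \<integral>x. g x \<partial>MA U (fs k)) \<longlonglongrightarrow> (\<integral>x. g x \<partial>MA U f)"
proof -
  define \<Phi> where "\<Phi> h p = indicator (slopes h U) p *\<^sub>R g (slope_point h U p)" for h p
  have "compact (g ` K)" using g K by (auto intro!: compact_continuous_image intro: continuous_on_subset)
  then obtain c where c: "\<forall>y\<in>g ` K. norm y \<le> c"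
    using compact_imp_bounded[of "g ` K"] unfolding bounded_iff by blast
  define c' where "c' = max c 0"
  have c': "norm (g x) \<le> c'" for x using c K(3)[of x] by (cases "x \<in> K") (auto simp: c'_def le_max_iff_disj)
  obtain d K' where d: "d > 0" "compact K'" "K' \<subseteq> U" "\<And>x. x \<in> K \<Longrightarrow> cball x d \<subseteq> K'"
    using compact_neighbourhood[OF K(1) U K(2)] by metis
  have "compact (f ` K')" using convex_on_continuous[OF U f] d
    by (auto intro!: compact_continuous_image intro: continuous_on_subset)
  then obtain M where M: "\<forall>y\<in>f ` K'. \<bar>y\<bar> \<le> M"
    using compact_imp_bounded[of "f ` K'"] unfolding bounded_real by blast
  have "uniform_limit K' fs f sequentially" using lim d unfolding conv_loc_unif_def by auto
  then have "eventually (\<lambda>k. \<forall>y\<in>K'. dist (fs k y) (f y) < 1) sequentially"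
    unfolding uniform_limit_iff by simp
  then obtain N where N: "\<And>k y. k \<ge> N \<Longrightarrow> y \<in> K' \<Longrightarrow> dist (fs k y) (f y) < 1"
    unfolding eventually_sequentially by blast
  \<comment> \<open>For k \<ge> N the functions are bounded by M + 1 on K', which contains the
    d-balls around points of K; this is the bound of \<open>norm_subdiff_le\<close>.\<close>
  define R where "R = 2 * (M + 1) / d"
  have bnd: "norm p \<le> R" if "k \<ge> N" "x \<in> K" "p \<in> subdiff (fs k) U x" for k x p
    unfolding R_def
  proof (rule norm_subdiff_le[OF that(3) d(1)])
    show "cball x d \<subseteq> U" using d(3) d(4)[OF that(2)] by blast
    fix y assume "y \<in> cball x d"
    then have y: "y \<in> K'" using d(4)[OF that(2)] by blast
    then have "\<bar>f y\<bar> \<le> M" using M by blast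
    then show "\<bar>fs k y\<bar> \<le> M + 1" using N[OF that(1) y] by (simp add: dist_real_def)
  qed
  have bPhi: "norm (\<Phi> (fs k) p) \<le> c' * indicator (cball 0 R) p" if k: "k \<ge> N" for k p
  proof (cases "p \<in> slopes (fs k) U \<and> slope_point (fs k) U p \<in> K")
    case True
    then have "norm p \<le> R" using slope_point[of p "fs k" U] bnd[OF k] by blast
    then show ?thesis using True c' by (simp add: \<Phi>_def)
  next
    case False
    then have "\<Phi> (fs k) p = 0" unfolding \<Phi>_def using K(3) by (auto simp: indicator_def)
    moreover have "c' \<ge> 0" by (simp add: c'_def)
    ultimately show ?thesis by simp
  qed
  have null: "negligible (multi_slopes f U \<union> (\<Union>k. multi_slopes (fs k) U))"
    by (intro negligible_Un negligible_Union_nat negligible_multi_slopes U f fs)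
  have ptw: "(\<lambda>k. \<Phi> (fs k) p) \<longlonglongrightarrow> \<Phi> f p"
    if p: "p \<notin> multi_slopes f U \<union> (\<Union>k. multi_slopes (fs k) U)" for p
  proof (cases "p \<in> slopes f U")
    case True
    define x where "x = slope_point f U p"
    have x: "x \<in> U" "p \<in> subdiff f U x" using slope_point[OF True] by (auto simp: x_def)
    have "isCont g x" using g(2) x(1) U by (simp add: continuous_on_eq_continuous_at)
    show ?thesis
    proof (rule tendstoI)
      fix e :: real assume e: "e > 0"
      obtain r1 where r1: "r1 > 0" "\<And>y. dist y x < r1 \<Longrightarrow> dist (g y) (g x) < e"
        using \<open>isCont g x\<close> e unfolding continuous_at_eps_delta by blast
      obtain r2 where r2: "r2 > 0" "cball x r2 \<subseteq> U" using U x(1) open_contains_cball by blast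
      define r where "r = min (r1/2) r2"
      have r: "r > 0" "cball x r \<subseteq> U" "r < r1" using r1 r2 by (auto simp: r_def)
      have "eventually (\<lambda>k. \<exists>y\<in>cball x r. p \<in> subdiff (fs k) U y) sequentially"
        using p by (intro subdiff_stable[OF U f fs lim x _ r(1,2)]) auto
      then show "eventually (\<lambda>k. dist (\<Phi> (fs k) p) (\<Phi> f p) < e) sequentially"
      proof eventually_elim
        case (elim k)
        then obtain y where y: "y \<in> cball x r" "p \<in> subdiff (fs k) U y" by blast
        have yU: "y \<in> U" using y r by blast
        have pk: "p \<notin> multi_slopes (fs k) U" using p by blast
        note * = slope_point_eq[OF yU y(2) pk]
        have "dist (g y) (g x) < e" using y(1) r by (intro r1(2)) (simp add: dist_commute)
        then show ?case using * True by (simp add: \<Phi>_def x_def)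
      qed
    qed
  next
    case False
    have "\<not> frequently (\<lambda>k. \<exists>x\<in>K. p \<in> subdiff (fs k) U x) sequentially"
    proof
      assume "frequently (\<lambda>k. \<exists>x\<in>K. p \<in> subdiff (fs k) U x) sequentially"
      from subdiff_limit[OF U f lim K(1,2) this] obtain x where "x \<in> K" "p \<in> subdiff f U x" by blast
      then have "p \<in> slopes f U" using p K(2) unfolding slopes_def by blast
      then show False using False by simp
    qed
    then have "eventually (\<lambda>k. \<not> (\<exists>x\<in>K. p \<in> subdiff (fs k) U x)) sequentially"
      by (simp add: not_frequently)
    then have "eventually (\<lambda>k. \<Phi> (fs k) p = 0) sequentially"
    proof eventually_elim
      case (elim k)
      show ?case
      proof (cases "p \<in> slopes (fs k) U")
        case True
        then have "slope_point (fs k) U p \<notin> K" using slope_point[OF True] elim by blast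
        then show ?thesis using K(3) by (simp add: \<Phi>_def)
      qed (simp add: \<Phi>_def)
    qed
    moreover have "\<Phi> f p = 0" using False by (simp add: \<Phi>_def)
    ultimately show ?thesis by (simp add: tendsto_eventually)
  qed
  \<comment> \<open>Domination is available from index N on only, hence the shifted
    sequence.\<close>
  have "(\<lambda>k. \<integral>p. \<Phi> (fs (k + N)) p \<partial>lebesgue) \<longlonglongrightarrow> (\<integral>p. \<Phi> f p \<partial>lebesgue)"
  proof (rule integral_dominated_convergence[where w = "\<lambda>p. c' * indicator (cball 0 R) p"])
    show "\<Phi> f \<in> borel_measurable lebesgue" "\<And>k. \<Phi> (fs (k + N)) \<in> borel_measurable lebesgue"
      unfolding \<Phi>_def by (intro integral_MA(2) U f fs g)+
    have "(cball 0 R :: 'a set) \<in> lmeasurable" by (intro lmeasurable_compact compact_cball)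
    then show "integrable lebesgue (\<lambda>p. c' * indicator (cball (0::'a) R) p)"
      by (intro integrable_mult_right) (simp add: lmeasurable_iff_integrable)
    show "AE p in lebesgue. (\<lambda>k. \<Phi> (fs (k + N)) p) \<longlonglongrightarrow> \<Phi> f p"
    proof (rule AE_I')
      show "multi_slopes f U \<union> (\<Union>k. multi_slopes (fs k) U) \<in> null_sets lebesgue"
        using null by (simp add: negligible_iff_null_sets)
      show "{p \<in> space lebesgue. \<not> (\<lambda>k. \<Phi> (fs (k + N)) p) \<longlonglongrightarrow> \<Phi> f p}
          \<subseteq> multi_slopes f U \<union> (\<Union>k. multi_slopes (fs k) U)"
        using ptw[THEN LIMSEQ_ignore_initial_segment] by blast
    qed
    show "AE p in lebesgue. norm (\<Phi> (fs (k + N)) p) \<le> c' * indicator (cball 0 R) p" for k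
      by (intro AE_I2 bPhi) simp
  qed
  then have "(\<lambda>k. \<integral>p. \<Phi> (fs k) p \<partial>lebesgue) \<longlonglongrightarrow> (\<integral>p. \<Phi> f p \<partial>lebesgue)" by (rule LIMSEQ_offset)
  then show ?thesis unfolding \<Phi>_def integral_MA(1)[OF U fs g(1)] integral_MA(1)[OF U f g(1)] .
qed

section \<open>Convex functions as limits of maxima of affine functions\<close>

text \<open>A hyperplane separates (x, f x) from the strict epigraph; it is not vertical because U
  contains a ball around x.\<close>

lemma subdiff_nonempty:
  fixes f :: "'a::euclidean_space \<Rightarrow> real"
  assumes U: "open U" and f: "convex_on U f" and x: "x \<in> U"
  shows "subdiff f U x \<noteq> {}"
proof -
  define E where "E = {z :: 'a \<times> real. fst z \<in> U \<and> f (fst z) < snd z}"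
  have cU: "convex U" using f by (simp add: convex_on_def)
  have "convex E"
  proof (rule convexI)
    fix z w :: "'a \<times> real" and u v :: real
    assume zw: "z \<in> E" "w \<in> E" and uv: "0 \<le> u" "0 \<le> v" "u + v = 1"
    have "f (u *\<^sub>R fst z + v *\<^sub>R fst w) \<le> u * f (fst z) + v * f (fst w)"
      using f zw uv unfolding convex_on_def E_def by auto
    also have "\<dots> < u * snd z + v * snd w"
    proof (cases "u = 0")
      case True then show ?thesis using zw uv by (simp add: E_def)
    next
      case False
      then have "u * f (fst z) < u * snd z" using zw uv by (simp add: E_def)
      moreover have "v * f (fst w) \<le> v * snd w" using zw uv by (intro mult_left_mono) (auto simp: E_def)
      ultimately show ?thesis by simp
    qed
    finally show "u *\<^sub>R z + v *\<^sub>R w \<in> E"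
      using cU zw uv by (auto simp: E_def convex_def)
  qed
  moreover have "E \<noteq> {}" using x by (auto simp: E_def intro!: exI[of _ x] exI[of _ "f x + 1"])
  moreover have "{(x, f x)} \<inter> E = {}" by (auto simp: E_def)
  ultimately obtain a b where ab: "a \<noteq> 0" "\<forall>z\<in>{(x, f x)}. a \<bullet> z \<le> b" "\<forall>z\<in>E. b \<le> a \<bullet> z"
    using separating_hyperplane_sets[of "{(x, f x)}" E] by auto
  obtain \<alpha> \<beta> where [simp]: "a = (\<alpha>, \<beta>)" by (cases a)
  have ineq: "\<alpha> \<bullet> x + \<beta> * f x \<le> \<alpha> \<bullet> y + \<beta> * t" if "y \<in> U" "f y < t" for y t
  proof -
    have "(y, t) \<in> E" using that by (simp add: E_def)
    then have "b \<le> \<alpha> \<bullet> y + \<beta> * t" using ab(3) by force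
    moreover have "\<alpha> \<bullet> x + \<beta> * f x \<le> b" using ab(2) by simp
    ultimately show ?thesis by simp
  qed
  have "\<beta> \<ge> 0" using ineq[OF x, of "f x + 1"] by (simp add: algebra_simps)
  moreover have "\<beta> \<noteq> 0"
  proof
    assume b0: "\<beta> = 0"
    obtain e where e: "e > 0" "ball x e \<subseteq> U" using U x open_contains_ball by blast
    have "\<alpha> \<noteq> 0" using ab(1) b0 by (auto simp: zero_prod_def)
    let ?y = "x - (e / (2 * norm \<alpha>)) *\<^sub>R \<alpha>"
    have "?y \<in> U" using e \<open>\<alpha> \<noteq> 0\<close> by (intro subsetD[OF e(2)]) (simp add: dist_norm)
    from ineq[OF this, of "f ?y + 1"] have "(e / (2 * norm \<alpha>)) * (\<alpha> \<bullet> \<alpha>) \<le> 0" using b0 by (simp add: inner_diff_right)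
    moreover have "(e / (2 * norm \<alpha>)) * (\<alpha> \<bullet> \<alpha>) > 0" using e \<open>\<alpha> \<noteq> 0\<close> by (intro mult_pos_pos) auto
    ultimately show False by simp
  qed
  ultimately have pos: "\<beta> > 0" by simp
  have "- (1 / \<beta>) *\<^sub>R \<alpha> \<in> subdiff f U x"
    unfolding subdiff_def
  proof safe
    fix y assume y: "y \<in> U"
    show "f x + (- (1 / \<beta>) *\<^sub>R \<alpha>) \<bullet> (y - x) \<le> f y"
    \<comment> \<open>The strict epigraph contains (y, f y + e) for e > 0 but not (y, f y)
      itself.\<close>
    proof (rule field_le_epsilon)
      fix e :: real assume "e > 0"
      from ineq[OF y, of "f y + e"] this have "\<beta> * f x - \<alpha> \<bullet> (y - x) \<le> \<beta> * (f y + e)"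
        by (simp add: inner_diff_right algebra_simps)
      then have "(\<beta> * f x - \<alpha> \<bullet> (y - x)) / \<beta> \<le> f y + e" using pos by (simp add: field_simps)
      then show "f x + (- (1 / \<beta>) *\<^sub>R \<alpha>) \<bullet> (y - x) \<le> f y + e" using pos by (simp add: diff_divide_distrib)
    qed
  qed
  then show ?thesis by blast
qed

section \<open>Maxima of finitely many affine functions\<close>

definition max_affine :: "('a::euclidean_space \<times> real) set \<Rightarrow> 'a \<Rightarrow> real" where
  "max_affine L y = Max ((\<lambda>(p, c). p \<bullet> y + c) ` L)"

lemma max_affine_ge: "finite L \<Longrightarrow> (p, c) \<in> L \<Longrightarrow> p \<bullet> y + c \<le> max_affine L y"
  unfolding max_affine_def by (rule Max_ge) force+

lemma max_affine_le: "finite L \<Longrightarrow> L \<noteq> {} \<Longrightarrow> (\<And>p c. (p, c) \<in> L \<Longrightarrow> p \<bullet> y + c \<le> b) \<Longrightarrow> max_affine L y \<le> b"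
  unfolding max_affine_def by (subst Max_le_iff) auto

lemma max_affine_attained:
  assumes "finite L" "L \<noteq> {}"
  obtains p c where "(p, c) \<in> L" "max_affine L y = p \<bullet> y + c"
proof -
  have "max_affine L y \<in> (\<lambda>(p, c). p \<bullet> y + c) ` L"
    unfolding max_affine_def by (rule Max_in) (use assms in auto)
  then show ?thesis using that by auto
qed

lemma convex_on_max_affine:
  assumes "finite L" "L \<noteq> {}" "convex U"
  shows "convex_on U (max_affine L)"
proof (rule convex_onI)
  fix t x y assume t: "0 < (t::real)" "t < 1"
  show "max_affine L ((1 - t) *\<^sub>R x + t *\<^sub>R y) \<le> (1 - t) * max_affine L x + t * max_affine L y"
  proof (rule max_affine_le[OF assms(1,2)])
    fix p c assume pc: "(p, c) \<in> L"
    have "p \<bullet> ((1 - t) *\<^sub>R x + t *\<^sub>R y) + c = (1 - t) * (p \<bullet> x + c) + t * (p \<bullet> y + c)"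
      by (simp add: inner_add_right algebra_simps)
    also have "\<dots> \<le> (1 - t) * max_affine L x + t * max_affine L y"
      using t max_affine_ge[OF assms(1) pc] by (intro add_mono mult_left_mono) auto
    finally show "p \<bullet> ((1 - t) *\<^sub>R x + t *\<^sub>R y) + c \<le> \<dots>" .
  qed
qed fact

text \<open>Affine functions that are inactive at x stay below one fixed active function near x, so
  there the maximum runs over the active slopes S only.\<close>

lemma max_affine_local:
  fixes L :: "('a::euclidean_space \<times> real) set"
  assumes L: "finite L" "L \<noteq> {}" and S_def: "S = {p. \<exists>c. (p, c) \<in> L \<and> p \<bullet> x + c = max_affine L x}"
  obtains V where "open V" "x \<in> V" "finite S" "S \<noteq> {}"
    "\<And>y. y \<in> V \<Longrightarrow> max_affine L y = support_fun (convex hull S) (y - x) + max_affine L x"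
proof -
  have "S \<subseteq> fst ` L" unfolding S_def by force
  then have finS: "finite S" using L(1) finite_subset by blast
  obtain p0 c0 where pc0: "(p0, c0) \<in> L" "max_affine L x = p0 \<bullet> x + c0" by (rule max_affine_attained[OF L])
  then have S0: "p0 \<in> S" unfolding S_def by auto
  have bS: "bounded S" using finS finite_imp_bounded by blast
  define I where "I = {(p, c) \<in> L. p \<bullet> x + c < max_affine L x}"
  define V where "V = (\<Inter>(p, c)\<in>I. {y. p \<bullet> y + c < p0 \<bullet> y + c0})"
  have "finite I" using L(1) unfolding I_def by (rule rev_finite_subset) auto
  then have "open V"
    unfolding V_def by (intro open_INT) (auto intro!: open_Collect_less continuous_intros)
  moreover have "x \<in> V" unfolding V_def I_def using pc0(2) by auto
  moreover have "max_affine L y = support_fun (convex hull S) (y - x) + max_affine L x" if y: "y \<in> V" for y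
  proof (rule antisym)
    have sup: "support_fun (convex hull S) (y - x) = support_fun S (y - x)"
      using bS S0 by (intro support_fun_convex_hull) auto
    show "max_affine L y \<le> support_fun (convex hull S) (y - x) + max_affine L x"
    proof (rule max_affine_le[OF L])
      fix p c assume pc: "(p, c) \<in> L"
      have act: "q \<bullet> y + d \<le> support_fun (convex hull S) (y - x) + max_affine L x"
        if "(q, d) \<in> L" "q \<bullet> x + d = max_affine L x" for q d
      proof -
        have "q \<in> S" using that unfolding S_def by blast
        then have "q \<bullet> (y - x) \<le> support_fun S (y - x)" using bS by (intro support_fun_upper)
        then show ?thesis using that(2) sup by (simp add: inner_diff_right)
      qed
      show "p \<bullet> y + c \<le> support_fun (convex hull S) (y - x) + max_affine L x"
      proof (cases "p \<bullet> x + c = max_affine L x")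
        case True then show ?thesis using act[OF pc] by blast
      next
        case False
        then have "(p, c) \<in> I" using pc max_affine_ge[OF L(1) pc, of x] by (auto simp: I_def)
        then have "p \<bullet> y + c < p0 \<bullet> y + c0" using y unfolding V_def by auto
        then show ?thesis using act[OF pc0(1)] pc0(2) by simp
      qed
    qed
    have "support_fun S (y - x) \<le> max_affine L y - max_affine L x"
    proof (rule support_fun_least)
      fix p assume "p \<in> S"
      then obtain c where c: "(p, c) \<in> L" "p \<bullet> x + c = max_affine L x" unfolding S_def by blast
      then show "p \<bullet> (y - x) \<le> max_affine L y - max_affine L x"
        using max_affine_ge[OF L(1) c(1), of y] by (simp add: inner_diff_right)
    qed (use S0 in blast)
    then show "support_fun (convex hull S) (y - x) + max_affine L x \<le> max_affine L y" using sup by simp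
  qed
  moreover have "S \<noteq> {}" using S0 by blast
  ultimately show ?thesis using that finS by blast
qed

text \<open>Tangents at the points of a countable dense set, taken up one after another. They lie
  below f, and a tangent at a point within \<eta> of y falls short of f y by at most 2 R \<eta>,
  where R bounds the slopes near K.\<close>

lemma convex_approx_max_affine:
  fixes f :: "'a::euclidean_space \<Rightarrow> real"
  assumes U: "open U" "U \<noteq> {}" and f: "convex_on U f"
  obtains L :: "nat \<Rightarrow> ('a \<times> real) set" where "\<And>k. finite (L k)" "\<And>k. L k \<noteq> {}" "conv_loc_unif U (\<lambda>k. max_affine (L k)) f"
proof -
  obtain D where D: "countable D" "D \<subseteq> U" "U \<subseteq> closure D" using separable[of U] .
  have "D \<noteq> {}" using D(3) U(2) by auto
  define d where "d = from_nat_into D"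
  have dU: "d j \<in> U" for j using D(2) from_nat_into[OF \<open>D \<noteq> {}\<close>] by (auto simp: d_def)
  have rd: "range d = D" using D(1) \<open>D \<noteq> {}\<close> by (simp add: d_def range_from_nat_into)
  have "\<forall>j. \<exists>p. p \<in> subdiff f U (d j)" using subdiff_nonempty[OF U(1) f dU] by blast
  from choice[OF this] obtain p where p: "\<And>j. p j \<in> subdiff f U (d j)" by blast
  define L where "L k = (\<lambda>j. (p j, f (d j) - p j \<bullet> d j)) ` {..k}" for k :: nat
  have L: "finite (L k)" "L k \<noteq> {}" for k by (auto simp: L_def)
  have upper: "max_affine (L k) y \<le> f y" if "y \<in> U" for k y
  proof (rule max_affine_le[OF L])
    fix q c assume "(q, c) \<in> L k"
    then obtain j where "q = p j" "c = f (d j) - p j \<bullet> d j" by (auto simp: L_def)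
    then show "q \<bullet> y + c \<le> f y" using p[of j] that by (auto simp: subdiff_def inner_diff_right algebra_simps)
  qed
  have "conv_loc_unif U (\<lambda>k. max_affine (L k)) f"
    unfolding conv_loc_unif_def
  proof (intro allI impI, elim conjE)
    fix K assume K: "compact K" "K \<subseteq> U"
    obtain r K' where r: "r > 0" "compact K'" "K' \<subseteq> U" "\<And>x. x \<in> K \<Longrightarrow> cball x r \<subseteq> K'"
      using compact_neighbourhood[OF K(1) U(1) K(2)] by metis
    have "bounded (\<Union>x\<in>K'. subdiff f U x)"
      by (intro compact_imp_bounded compact_subdiff_image[OF U(1) f] r)
    then obtain R where R: "\<And>x q. x \<in> K' \<Longrightarrow> q \<in> subdiff f U x \<Longrightarrow> norm q \<le> R" "R > 0"
      unfolding bounded_pos by blast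
    show "uniform_limit K (\<lambda>k. max_affine (L k)) f sequentially"
      unfolding uniform_limit_iff
    proof (intro allI impI)
      fix e :: real assume e: "e > 0"
      \<comment> \<open>\<eta> \<le> r keeps the tangent points inside K', where R is valid; the
        factor 4 brings 2 R \<eta> down to at most e/2.\<close>
      define \<eta> where "\<eta> = min r (e / (4 * R))"
      have eta: "\<eta> > 0" "\<eta> \<le> r" "2 * R * \<eta> < e"
      proof -
        show "\<eta> > 0" "\<eta> \<le> r" using r e R by (auto simp: \<eta>_def)
        have "2 * R * \<eta> \<le> 2 * R * (e / (4 * R))" using R by (intro mult_left_mono) (auto simp: \<eta>_def)
        also have "\<dots> = e / 2" using R by simp
        finally show "2 * R * \<eta> < e" using e by simp
      qed
      have cover: "K \<subseteq> (\<Union>j\<in>UNIV. ball (d j) \<eta>)"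
      proof
        fix x assume "x \<in> K"
        then have "x \<in> closure D" using K D by blast
        then obtain z where "z \<in> D" "dist z x < \<eta>" using eta unfolding closure_approachable by blast
        then show "x \<in> (\<Union>j. ball (d j) \<eta>)" using rd by auto
      qed
      obtain J where "J \<subseteq> UNIV" and J: "finite J" "K \<subseteq> (\<Union>j\<in>J. ball (d j) \<eta>)"
        by (rule compactE_image[OF K(1) open_ball cover])
      obtain N where N: "\<forall>j\<in>J. j \<le> N" using J(1) unfolding finite_nat_set_iff_bounded_le by blast
      have "dist (max_affine (L k) y) (f y) < e" if k: "k \<ge> N" and y: "y \<in> K" for k y
      proof -
        obtain j where j: "j \<in> J" "dist (d j) y < \<eta>" using J(2) y by auto
        have yU: "y \<in> U" using y K by blast
        have dK: "d j \<in> K'" using r(4)[OF y] j eta by (auto simp: dist_commute)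
        have yK: "y \<in> K'" using r(4)[OF y] r(1) by auto
        have "(p j, f (d j) - p j \<bullet> d j) \<in> L k" using N j(1) k by (force simp: L_def)
        then have 1: "p j \<bullet> y + (f (d j) - p j \<bullet> d j) \<le> max_affine (L k) y" by (rule max_affine_ge[OF L(1)])
        obtain q where q: "q \<in> subdiff f U y" using subdiff_nonempty[OF U(1) f yU] by blast
        have 2: "f (d j) \<ge> f y + q \<bullet> (d j - y)" using q dU by (auto simp: subdiff_def)
        have "\<bar>q \<bullet> (d j - y)\<bar> \<le> norm q * norm (d j - y)" by (rule Cauchy_Schwarz_ineq2)
        also have "\<dots> \<le> R * \<eta>" using R(1)[OF yK q] R(2) j(2) by (intro mult_mono) (auto simp: dist_norm)
        finally have 3: "\<bar>q \<bullet> (d j - y)\<bar> \<le> R * \<eta>" .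
        have "\<bar>p j \<bullet> (y - d j)\<bar> \<le> norm (p j) * norm (y - d j)" by (rule Cauchy_Schwarz_ineq2)
        also have "\<dots> \<le> R * \<eta>" using R(1)[OF dK p] R(2) j(2) by (intro mult_mono) (auto simp: dist_norm norm_minus_commute)
        finally have 4: "\<bar>p j \<bullet> (y - d j)\<bar> \<le> R * \<eta>" .
        have "f y - max_affine (L k) y \<le> 2 * R * \<eta>"
          using 1 2 3 4 by (simp add: inner_diff_right abs_le_iff)
        then show ?thesis using upper[OF yU, of k] eta(3) by (simp add: dist_real_def)
      qed
      then show "eventually (\<lambda>k. \<forall>y\<in>K. dist (max_affine (L k) y) (f y) < e) sequentially"
        unfolding eventually_sequentially by blast
    qed
  qed
  then show ?thesis using that L by blast
qed

section \<open>Locally determined valuations\<close>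

lemma unit_cube_subset_cball:
  obtains R where "R > 0" "(unit_cube :: 'a::euclidean_space set) \<subseteq> cball 0 R"
proof -
  obtain R where "R > 0" "(unit_cube :: 'a set) \<subseteq> ball 0 R"
    using bounded_subset_ballD[OF bounded_cbox, of 0 "One :: 'a" 0] by auto
  then show ?thesis by (intro that[of R] order_trans[OF _ ball_subset_cball])
qed

lemma unit_cube_nonempty: "(unit_cube :: 'a::euclidean_space set) \<noteq> {}"
  by (simp add: box_ne_empty)

abbreviation cone :: "'a::euclidean_space set \<Rightarrow> 'a \<Rightarrow> 'a \<Rightarrow> real" where
  "cone P x \<equiv> \<lambda>y. support_fun P (y - x)"

locale local_valuation =
  fixes U :: "(real^'n) set" and \<Psi> :: "(real^'n \<Rightarrow> real) \<Rightarrow> (real^'n) cmeasure"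
  assumes U: "open U" "convex U" and Psi: "VConv_meas U \<Psi>" and loc: "locally_determined U \<Psi>"
begin

lemmas VConv = Psi[unfolded VConv_meas_def]

lemma radon: "convex_on U f \<Longrightarrow> cradon_on U (\<Psi> f)"
  by (rule VConv[THEN conjunct1, rule_format])

lemma valuation:
  "convex_on U f \<Longrightarrow> convex_on U g \<Longrightarrow> convex_on U (\<lambda>x. min (f x) (g x)) \<Longrightarrow> relcompact_borel U B \<Longrightarrow>
   cmeas (\<Psi> (\<lambda>x. max (f x) (g x))) B + cmeas (\<Psi> (\<lambda>x. min (f x) (g x))) B = cmeas (\<Psi> f) B + cmeas (\<Psi> g) B"
  by (rule VConv[THEN conjunct2, THEN conjunct2, THEN conjunct1, rule_format]) (intro conjI)

lemma continuity:
  "(\<And>k. convex_on U (fs k)) \<Longrightarrow> convex_on U f \<Longrightarrow> conv_loc_unif U fs f \<Longrightarrow> test_fun U \<phi> \<Longrightarrow>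
   (\<lambda>k. cint (\<Psi> (fs k)) \<phi>) \<longlonglongrightarrow> cint (\<Psi> f) \<phi>"
  by (rule VConv[THEN conjunct2, THEN conjunct2, THEN conjunct2, THEN conjunct1, rule_format]) (intro conjI allI)

lemma affine_invariant:
  "convex_on U f \<Longrightarrow> relcompact_borel U B \<Longrightarrow> cmeas (\<Psi> (\<lambda>x. f x + (a \<bullet> x + c))) B = cmeas (\<Psi> f) B"
  by (rule VConv[THEN conjunct2, THEN conjunct2, THEN conjunct2, THEN conjunct2, THEN conjunct1, unfolded ceq_on_def, rule_format])

lemma homogeneous:
  "convex_on U f \<Longrightarrow> t \<ge> 0 \<Longrightarrow> relcompact_borel U B \<Longrightarrow>
   cmeas (\<Psi> (\<lambda>x. t * f x)) B = complex_of_real (t ^ CARD('n)) * cmeas (\<Psi> f) B"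
  by (rule VConv[THEN conjunct2, THEN conjunct2, THEN conjunct2, THEN conjunct2, THEN conjunct2, rule_format]) (intro conjI)

lemma locality:
  assumes "convex_on U f" "convex_on U h" "open V" "V \<subseteq> U" "\<And>x. x \<in> V \<Longrightarrow> f x = h x"
    and "relcompact_borel U C" "C \<subseteq> V"
  shows "cmeas (\<Psi> f) C = cmeas (\<Psi> h) C"
proof -
  have "C \<inter> V = C" using assms(7) by blast
  moreover have "cmeas (\<Psi> f) (C \<inter> V) = cmeas (\<Psi> h) (C \<inter> V)"
    by (rule loc[unfolded locally_determined_def, rule_format]) (use assms in auto)
  ultimately show ?thesis by simp
qed

section \<open>Test integrals of cones as a valuation on convex bodies\<close>

lemma convex_zero: "convex_on U (\<lambda>x. 0)"
  by (rule convex_onI) (use U in auto)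

lemma convex_add_affine:
  assumes "convex_on U f"
  shows "convex_on U (\<lambda>x. f x + (a \<bullet> x + c))"
proof (rule convex_on_add[OF assms])
  show "convex_on U (\<lambda>x. a \<bullet> x + c)"
    by (rule convex_onI) (use U in \<open>auto simp: inner_add_right algebra_simps\<close>)
qed

text \<open>Homogeneity at t = 0, with 0^n = 0 because n \<ge> 1.\<close>

lemma cmeas_zero: "relcompact_borel U B \<Longrightarrow> cmeas (\<Psi> (\<lambda>x. 0)) B = 0"
  using homogeneous[OF convex_zero, of 0 B] by (simp add: power_0_left)

lemma cint_zero: "test_fun U \<phi> \<Longrightarrow> cint (\<Psi> (\<lambda>x. 0)) \<phi> = 0"
  using cint_scaleI[of U \<phi> "\<Psi> (\<lambda>x. 0)" "\<Psi> (\<lambda>x. 0)" 0] radon[OF convex_zero] cmeas_zero by simp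

text \<open>The empty set is treated separately: its support function has no meaning, while cutting
  along a grid needs the value 0.\<close>

definition cone_val :: "real^'n \<Rightarrow> (real^'n \<Rightarrow> real) \<Rightarrow> (real^'n) set \<Rightarrow> complex" where
  "cone_val x \<phi> P = (if P = {} then 0 else cint (\<Psi> (cone P x)) \<phi>)"

lemma convex_cone: "compact P \<Longrightarrow> P \<noteq> {} \<Longrightarrow> convex_on U (cone P x)"
  using U by (intro convex_on_support_fun compact_imp_bounded)

lemma cone_val_valuation:
  assumes phi: "test_fun U \<phi>" and P: "compact P" "compact Q" "P \<noteq> {}" "Q \<noteq> {}" "convex (P \<union> Q)"
  shows "cone_val x \<phi> (P \<union> Q) + cone_val x \<phi> (P \<inter> Q) = cone_val x \<phi> P + cone_val x \<phi> Q"
proof -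
  have ne: "P \<inter> Q \<noteq> {}" by (rule convex_Un_Int_nonempty[OF P])
  have Un: "(cone (P \<union> Q) x) = (\<lambda>y. max (support_fun P (y - x)) (support_fun Q (y - x)))"
    using P by (simp add: support_fun_Un compact_imp_bounded)
  have In: "(cone (P \<inter> Q) x) = (\<lambda>y. min (support_fun P (y - x)) (support_fun Q (y - x)))"
    using P by (simp add: support_fun_Int)
  have cU: "convex_on U (cone (P \<union> Q) x)" and cI: "convex_on U (cone (P \<inter> Q) x)"
    using P ne by (auto intro!: convex_cone compact_Int)
  have c: "convex_on U (cone P x)" "convex_on U (cone Q x)"
    using P by (auto intro!: convex_cone)
  have "cint (\<Psi> (cone (P \<union> Q) x)) \<phi> + cint (\<Psi> (cone (P \<inter> Q) x)) \<phi>
     = cint (\<Psi> (cone P x)) \<phi> + cint (\<Psi> (cone Q x)) \<phi>"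
  proof (rule cint_add_eqI[OF phi])
    fix B assume "relcompact_borel U B"
    then show "cmeas (\<Psi> (cone (P \<union> Q) x)) B + cmeas (\<Psi> (cone (P \<inter> Q) x)) B
     = cmeas (\<Psi> (cone P x)) B + cmeas (\<Psi> (cone Q x)) B"
      using valuation[OF c] cI unfolding Un In by blast
  qed (intro radon cU cI c)+
  then show ?thesis using P ne by (simp add: cone_val_def)
qed

lemma cone_val_bounded:
  assumes phi: "test_fun U \<phi>"
  obtains C where "\<And>P. compact P \<Longrightarrow> convex P \<Longrightarrow> P \<subseteq> unit_cube \<Longrightarrow> norm (cone_val x \<phi> P) \<le> C"
proof (rule ccontr)
  assume no: "\<not> thesis"
  \<comment> \<open>The threshold (k+1)^n is exactly what homogeneity takes away when the function
    is divided by k + 1, so the images keep norm above 1 although the scaled functions tend to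
    0.\<close>
  have "\<exists>P. compact P \<and> P \<subseteq> unit_cube \<and> norm (cone_val x \<phi> P) > real (Suc k) ^ CARD('n)" for k
  proof (rule ccontr)
    assume "\<not> ?thesis"
    then show False using no that[of "real (Suc k) ^ CARD('n)"] by (meson not_le)
  qed
  then have "\<forall>k. \<exists>P. compact P \<and> P \<subseteq> unit_cube \<and> norm (cone_val x \<phi> P) > real (Suc k) ^ CARD('n)" by blast
  from choice[OF this] obtain P where P: "\<And>k. compact (P k)" "\<And>k. P k \<subseteq> unit_cube"
    "\<And>k. norm (cone_val x \<phi> (P k)) > real (Suc k) ^ CARD('n)" by blast
  have ne: "P k \<noteq> {}" for k
  proof
    assume "P k = {}"
    then have "real (Suc k) ^ CARD('n) < 0" using P(3)[of k] by (simp add: cone_val_def)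
    moreover have "real (Suc k) ^ CARD('n) \<ge> 0" by simp
    ultimately show False by linarith
  qed
  obtain R where R: "R > 0" "(unit_cube :: (real^'n) set) \<subseteq> cball 0 R" by (rule unit_cube_subset_cball)
  define f where "f k = (\<lambda>y. inverse (real (Suc k)) * support_fun (P k) (y - x))" for k
  have fc: "convex_on U (f k)" for k
    unfolding f_def by (intro convex_on_cmul convex_cone P ne) simp
  have lim: "conv_loc_unif U f (\<lambda>y. 0)"
    unfolding conv_loc_unif_def
  proof (intro allI impI, elim conjE)
    fix K :: "(real^'n) set" assume "compact K"
    then have "bounded ((\<lambda>y. y - x) ` K)" by (intro compact_imp_bounded compact_continuous_image continuous_intros)
    then obtain b where b: "\<And>y. y \<in> K \<Longrightarrow> norm (y - x) \<le> b" unfolding bounded_iff by blast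
    have "(\<lambda>k. (R * b) * inverse (real (Suc k))) \<longlonglongrightarrow> (R * b) * 0"
      by (intro tendsto_mult tendsto_const LIMSEQ_inverse_real_of_nat)
    then have 0: "(\<lambda>k. (R * b) * inverse (real (Suc k))) \<longlonglongrightarrow> 0" by simp
    show "uniform_limit K f (\<lambda>y. 0) sequentially"
      unfolding uniform_limit_iff
    proof (intro allI impI)
      fix e :: real assume "e > 0"
      then have "eventually (\<lambda>k. (R * b) * inverse (real (Suc k)) < e) sequentially"
        using order_tendstoD(2)[OF 0] by blast
      then show "eventually (\<lambda>k. \<forall>y\<in>K. dist (f k y) 0 < e) sequentially"
      proof eventually_elim
        case (elim k)
        show ?case
        proof
          fix y assume y: "y \<in> K"
          have "\<bar>support_fun (P k) (y - x)\<bar> \<le> R * norm (y - x)"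
            using P(2)[of k] R ne by (intro abs_support_fun_le) auto
          also have "\<dots> \<le> R * b" using b[OF y] R by (intro mult_left_mono) auto
          finally have "inverse (real (Suc k)) * \<bar>support_fun (P k) (y - x)\<bar> \<le> inverse (real (Suc k)) * (R * b)"
            by (intro mult_left_mono) auto
          then have "\<bar>f k y\<bar> \<le> (R * b) * inverse (real (Suc k))"
            unfolding f_def abs_mult by (simp add: mult.commute)
          then show "dist (f k y) 0 < e" using elim by simp
        qed
      qed
    qed
  qed
  have "(\<lambda>k. cint (\<Psi> (f k)) \<phi>) \<longlonglongrightarrow> 0"
    using continuity[OF fc convex_zero lim phi] cint_zero[OF phi] by simp
  from tendstoD[OF this zero_less_one] have "eventually (\<lambda>k. norm (cint (\<Psi> (f k)) \<phi>) < 1) sequentially"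
    by simp
  then obtain k where k: "norm (cint (\<Psi> (f k)) \<phi>) < 1" using eventually_happens by fastforce
  have "cint (\<Psi> (f k)) \<phi> = complex_of_real (inverse (real (Suc k)) ^ CARD('n)) * cint (\<Psi> (cone (P k) x)) \<phi>"
    by (rule cint_scaleI[OF phi radon[OF fc] radon[OF convex_cone[OF P(1) ne]]], unfold f_def)
       (rule homogeneous[OF convex_cone[OF P(1) ne]], simp_all)
  then have "norm (cint (\<Psi> (f k)) \<phi>) = inverse (real (Suc k)) ^ CARD('n) * norm (cone_val x \<phi> (P k))"
    using ne[of k] by (simp only: cone_val_def if_False norm_mult norm_of_real abs_of_nonneg zero_le_power
        inverse_nonnegative_iff_nonnegative of_nat_0_le_iff)
  moreover have "inverse (real (Suc k)) ^ CARD('n) * norm (cone_val x \<phi> (P k)) > inverse (real (Suc k)) ^ CARD('n) * real (Suc k) ^ CARD('n)"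
    using P(3)[of k] by (intro mult_strict_left_mono) auto
  moreover have "inverse (real (Suc k)) ^ CARD('n) * real (Suc k) ^ CARD('n) = 1"
    by (simp flip: power_mult_distrib del: of_nat_Suc)
  ultimately show False using k by linarith
qed

lemma cone_val_volume:
  assumes phi: "test_fun U \<phi>" and P: "compact P" "convex P"
  shows "cone_val x \<phi> P = complex_of_real (measure lebesgue P) * cone_val x \<phi> unit_cube"
proof -
  obtain C where C: "\<And>P. compact P \<Longrightarrow> convex P \<Longrightarrow> P \<subseteq> unit_cube \<Longrightarrow> norm (cone_val x \<phi> P) \<le> C"
    using cone_val_bounded[OF phi, of x] by blast
  interpret volume_valuation "cone_val x \<phi>" C
  proof
    show "cone_val x \<phi> {} = 0" by (simp add: cone_val_def)
    show "cone_val x \<phi> P + cone_val x \<phi> (P \<inter> {p. p \<bullet> i = a}) =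
        cone_val x \<phi> (P \<inter> {p. p \<bullet> i \<le> a}) + cone_val x \<phi> (P \<inter> {p. a \<le> p \<bullet> i})"
      if P: "compact P" "convex P" and i: "i \<in> Basis" for P i a
    proof -
      let ?A = "P \<inter> {p. p \<bullet> i \<le> a}" and ?B = "P \<inter> {p. a \<le> p \<bullet> i}"
      have eq: "?A \<union> ?B = P" "?A \<inter> ?B = P \<inter> {p. p \<bullet> i = a}" by auto
      have c: "compact ?A" "compact ?B"
        using P by (auto simp: inner_commute[of _ i] intro!: compact_Int_closed closed_halfspace_le closed_halfspace_ge)
      show ?thesis
      proof (cases "?A = {} \<or> ?B = {}")
        \<comment> \<open>A one-sided cut: the other half is all of P, and the hyperplane misses
          P.\<close>
        case True
        then have "(?A = {} \<and> ?B = P \<or> ?A = P \<and> ?B = {}) \<and> P \<inter> {p. p \<bullet> i = a} = {}" using eq by blast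
        then show ?thesis by (auto simp: cone_val_def)
      next
        case False
        then show ?thesis using cone_val_valuation[OF phi c, of x] P(2) eq by simp
      qed
    qed
    show "cone_val x \<phi> ((+) a ` P) = cone_val x \<phi> P" if P: "compact P" "convex P" for P a
    proof (cases "P = {}")
      case False
      \<comment> \<open>Translating the body adds the affine function a \<bullet> (y - x), which
        affine invariance discards.\<close>
      have eq: "(cone ((+) a ` P) x) = (\<lambda>y. support_fun P (y - x) + (a \<bullet> y + (- (a \<bullet> x))))"
        using support_fun_translation[OF compact_imp_bounded[OF P(1)] False] by (simp add: inner_diff_right)
      have "cint (\<Psi> (cone ((+) a ` P) x)) \<phi> = 1 * cint (\<Psi> (cone P x)) \<phi>"
      proof (rule cint_scaleI[OF phi])
        show "cmeas (\<Psi> (cone ((+) a ` P) x)) B = 1 * cmeas (\<Psi> (cone P x)) B"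
          if "relcompact_borel U B" for B
          unfolding eq by (simp only: affine_invariant[OF convex_cone[OF P(1) False] that] mult_1_left)
      qed (auto intro!: radon convex_cone compact_translation P simp: False)
      then show ?thesis using False by (simp add: cone_val_def)
    qed simp
    show "cone_val x \<phi> ((*\<^sub>R) t ` P) = complex_of_real (t ^ DIM(real^'n)) * cone_val x \<phi> P"
      if P: "compact P" "convex P" and t: "t > 0" for P t
    proof (cases "P = {}")
      case False
      have eq: "(cone ((*\<^sub>R) t ` P) x) = (\<lambda>y. t * support_fun P (y - x))"
        using support_fun_scaleR[OF compact_imp_bounded[OF P(1)] False t] by simp
      have "cint (\<Psi> (cone ((*\<^sub>R) t ` P) x)) \<phi> = complex_of_real (t ^ CARD('n)) * cint (\<Psi> (cone P x)) \<phi>"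
      proof (rule cint_scaleI[OF phi])
        show "cmeas (\<Psi> (cone ((*\<^sub>R) t ` P) x)) B = complex_of_real (t ^ CARD('n)) * cmeas (\<Psi> (cone P x)) B"
          if "relcompact_borel U B" for B
          unfolding eq using t by (intro homogeneous[OF convex_cone[OF P(1) False] _ that]) simp
      qed (auto intro!: radon convex_cone compact_scaling P simp: False)
      then show ?thesis using False by (simp add: cone_val_def)
    qed (simp add: cone_val_def)
  qed (rule C)
  show ?thesis by (rule eq_volume[OF P])
qed

end

lemma MA_add_const: "MA U (\<lambda>z. h z + c) = MA U h"
  by (simp add: MA_def subdiff_def)

text \<open>Makes the local description of maxima available for the cone over the cube.\<close>

lemma support_fun_eq_max_affine:
  assumes "finite S" "S \<noteq> {}"
  shows "support_fun S (y - x) = max_affine ((\<lambda>p. (p, - (p \<bullet> x))) ` S) y"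
proof (rule antisym)
  have b: "bounded S" using assms(1) by (rule finite_imp_bounded)
  show "support_fun S (y - x) \<le> max_affine ((\<lambda>p. (p, - (p \<bullet> x))) ` S) y"
  proof (rule support_fun_least[OF assms(2)])
    fix p assume "p \<in> S"
    then have "p \<bullet> y + - (p \<bullet> x) \<le> max_affine ((\<lambda>p. (p, - (p \<bullet> x))) ` S) y"
      using assms by (intro max_affine_ge) auto
    then show "p \<bullet> (y - x) \<le> max_affine ((\<lambda>p. (p, - (p \<bullet> x))) ` S) y" by (simp add: inner_diff_right)
  qed
  show "max_affine ((\<lambda>p. (p, - (p \<bullet> x))) ` S) y \<le> support_fun S (y - x)"
  proof (rule max_affine_le)
    fix p c assume "(p, c) \<in> (\<lambda>p. (p, - (p \<bullet> x))) ` S"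
    then have "p \<in> S" "c = - (p \<bullet> x)" by auto
    then show "p \<bullet> y + c \<le> support_fun S (y - x)"
      using support_fun_upper[OF b, of p "y - x"] by (simp add: inner_diff_right)
  qed (use assms in auto)
qed

section \<open>The mass of cones at their apex and the density\<close>

context local_valuation
begin

text \<open>Zero volume makes every test integral vanish, and test integrals determine the
  measure.\<close>

lemma cone_null:
  assumes P: "compact P" "convex P" "P \<noteq> {}" "negligible P" and B: "relcompact_borel U B"
  shows "cmeas (\<Psi> (cone P x)) B = 0"
proof -
  have "ceq_on U (\<Psi> (cone P x)) (\<Psi> (\<lambda>y. 0))"
  proof (rule ceq_on_if_cint_eq[OF U(1)])
    fix \<phi> assume phi: "test_fun U \<phi>"
    show "cint (\<Psi> (cone P x)) \<phi> = cint (\<Psi> (\<lambda>y. 0)) \<phi>"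
      using cone_val_volume[OF phi P(1,2), of x] negligible_imp_measure0[OF P(4)] cint_zero[OF phi] P(3)
      by (simp add: cone_val_def)
  qed (intro radon convex_cone convex_zero P)+
  then show ?thesis using B cmeas_zero[OF B] by (simp add: ceq_on_def)
qed

text \<open>Near x the maximum is the cone over its active slopes plus a constant: locality passes
  to this description, and affine invariance removes the constant.\<close>

lemma max_affine_cone:
  assumes L: "finite L" "L \<noteq> {}" and S_def: "S = {p. \<exists>c. (p, c) \<in> L \<and> p \<bullet> x + c = max_affine L x}" and x: "x \<in> U"
  obtains V where "open V" "x \<in> V" "V \<subseteq> U" "finite S" "S \<noteq> {}"
    "\<And>y. y \<in> V \<Longrightarrow> max_affine L y = support_fun (convex hull S) (y - x) + max_affine L x"
    "\<And>C. relcompact_borel U C \<Longrightarrow> C \<subseteq> V \<Longrightarrow>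
       cmeas (\<Psi> (max_affine L)) C = cmeas (\<Psi> (cone (convex hull S) x)) C"
proof -
  obtain V where V: "open V" "x \<in> V" "finite S" "S \<noteq> {}"
    "\<And>y. y \<in> V \<Longrightarrow> max_affine L y = support_fun (convex hull S) (y - x) + max_affine L x"
    by (rule max_affine_local[OF L S_def]) blast
  have c: "compact (convex hull S)" "convex hull S \<noteq> {}"
    using V(3,4) by (auto intro: finite_imp_compact_convex_hull)
  have cc: "convex_on U (cone (convex hull S) x)" by (rule convex_cone[OF c])
  show ?thesis
  proof (rule that[of "V \<inter> U"])
    fix C assume C: "relcompact_borel U C" "C \<subseteq> V \<inter> U"
    have "cmeas (\<Psi> (max_affine L)) C
      = cmeas (\<Psi> (\<lambda>y. support_fun (convex hull S) (y - x) + (0 \<bullet> y + max_affine L x))) C"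
    proof (rule locality[where V = "V \<inter> U"])
      show "open (V \<inter> U)" using V(1) U(1) by (rule open_Int)
      show "max_affine L y = support_fun (convex hull S) (y - x) + (0 \<bullet> y + max_affine L x)"
        if "y \<in> V \<inter> U" for y using that V(5)[of y] by simp
      show "convex_on U (\<lambda>y. support_fun (convex hull S) (y - x) + (0 \<bullet> y + max_affine L x))"
        by (rule convex_add_affine[OF cc])
    qed (use C convex_on_max_affine[OF L U(2)] in auto)
    also have "\<dots> = cmeas (\<Psi> (cone (convex hull S) x)) C"
      by (rule affine_invariant[OF cc C(1)])
    finally show "cmeas (\<Psi> (max_affine L)) C = cmeas (\<Psi> (cone (convex hull S) x)) C" .
  next
    show "open (V \<inter> U)" using V(1) U(1) by (rule open_Int)
    show "max_affine L y = support_fun (convex hull S) (y - x) + max_affine L x" if "y \<in> V \<inter> U" for y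
      using that by (intro V(5)) simp
  qed (use V(2-4) x in auto)
qed

text \<open>The cube stands in for the ball of the theorem: with volume 1 it needs no normalisation,
  and with finitely many vertices its cone is a maximum of finitely many affine functions.\<close>

definition psi :: "real^'n \<Rightarrow> complex" where
  "psi x = cmeas (\<Psi> (cone unit_cube x)) {x}"

text \<open>At y \<noteq> x the active vertices of the cube all lie in one hyperplane orthogonal to
  y - x. Their hull is null, so the cone has no mass near y, and the local statements add up to no
  mass off x.\<close>

lemma cube_concentrated:
  assumes x: "x \<in> U" and B: "relcompact_borel U B"
  shows "cmeas (\<Psi> (cone unit_cube x)) B = (if x \<in> B then psi x else 0)"
proof -
  let ?h = "\<lambda>y. support_fun unit_cube (y - x)"
  have rh: "cradon_on U (\<Psi> ?h)" by (intro radon convex_cone compact_cbox unit_cube_nonempty)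
  obtain S0 :: "(real^'n) set" where S0: "finite S0" "unit_cube = convex hull S0" by (rule unit_cube_convex_hull)
  have S0ne: "S0 \<noteq> {}" using S0(2) unit_cube_nonempty[where 'a = "real^'n"] by auto
  define L where "L = (\<lambda>p. (p, - (p \<bullet> x))) ` S0"
  have L: "finite L" "L \<noteq> {}" using S0 S0ne by (auto simp: L_def)
  have hL: "?h = max_affine L"
  proof
    fix y show "?h y = max_affine L y"
      unfolding L_def using support_fun_eq_max_affine[OF S0(1) S0ne, of y x]
        support_fun_convex_hull[OF finite_imp_bounded[OF S0(1)] S0ne, of "y - x"] S0(2) by simp
  qed
  have zero: "cmeas (\<Psi> ?h) B' = 0" if B': "relcompact_borel U B'" "x \<notin> B'" for B'
  proof -
    have "cmeas (\<Psi> ?h) B' = cmeas (\<Psi> (\<lambda>y. 0)) B'"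
    proof (rule cmeas_eq_if_locally_eq[OF rh radon[OF convex_zero] B'(1)])
      fix y assume y: "y \<in> B'"
      then have "y \<noteq> x" using B' by auto
      have yU: "y \<in> U" using y B'(1) closure_subset[of B'] unfolding relcompact_borel_def by auto
      define S where "S = {p. \<exists>c. (p, c) \<in> L \<and> p \<bullet> y + c = max_affine L y}"
      obtain V where V: "open V" "y \<in> V" "V \<subseteq> U" "finite S" "S \<noteq> {}"
        "\<And>C. relcompact_borel U C \<Longrightarrow> C \<subseteq> V \<Longrightarrow>
          cmeas (\<Psi> (max_affine L)) C = cmeas (\<Psi> (cone (convex hull S) y)) C"
        by (rule max_affine_cone[OF L S_def yU]) blast
      have "S \<subseteq> {p. (y - x) \<bullet> p = max_affine L y}"
        unfolding S_def L_def by (auto simp: inner_commute[of "y - x"] inner_diff_right)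
      then have "convex hull S \<subseteq> {p. (y - x) \<bullet> p = max_affine L y}"
        by (rule hull_minimal) (rule convex_hyperplane)
      moreover have "negligible {p. (y - x) \<bullet> p = max_affine L y}"
        using \<open>y \<noteq> x\<close> by (intro negligible_hyperplane) auto
      ultimately have "negligible (convex hull S)" using negligible_subset by blast
      then have null: "cmeas (\<Psi> (cone (convex hull S) y)) C = 0" if "relcompact_borel U C" for C
        using V(4,5) that by (intro cone_null finite_imp_compact_convex_hull) auto
      have "cmeas (\<Psi> ?h) C = cmeas (\<Psi> (\<lambda>y. 0)) C" if "relcompact_borel U C" "C \<subseteq> V \<inter> B'" for C
        using V(6)[OF that(1)] that(2) null[OF that(1)] cmeas_zero[OF that(1)] by (simp add: hL)
      then show "\<exists>V. open V \<and> y \<in> V \<and> (\<forall>C. relcompact_borel U C \<and> C \<subseteq> V \<inter> B' \<longrightarrow>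
          cmeas (\<Psi> ?h) C = cmeas (\<Psi> (\<lambda>y. 0)) C)"
        using V(1,2) by blast
    qed
    then show ?thesis using cmeas_zero[OF B'(1)] by simp
  qed
  show ?thesis
  proof (cases "x \<in> B")
    case True
    have Bs: "B \<in> sets borel" using B by (simp add: relcompact_borel_def)
    have r1: "relcompact_borel U {x}" using x by (intro relcompact_borel_compact) auto
    have r2: "relcompact_borel U (B - {x})" using Bs by (intro relcompact_borel_subset[OF B]) auto
    have "cmeas (\<Psi> ?h) ({x} \<union> (B - {x})) = cmeas (\<Psi> ?h) {x} + cmeas (\<Psi> ?h) (B - {x})"
      by (rule cmeas_Un[OF rh r1 r2]) auto
    moreover have "{x} \<union> (B - {x}) = B" using True by auto
    ultimately show ?thesis using True zero[OF r2] by (simp add: psi_def)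
  next
    case False then show ?thesis using zero[OF B] by simp
  qed
qed

text \<open>The point mass at x is known for the cube and carried over to P by proportionality to
  volume.\<close>

lemma cint_cone:
  assumes phi: "test_fun U \<phi>" and x: "x \<in> U" and P: "compact P" "convex P" "P \<noteq> {}"
  shows "cint (\<Psi> (cone P x)) \<phi> = complex_of_real (measure lebesgue P) * (complex_of_real (\<phi> x) * psi x)"
proof -
  have "cint (\<Psi> (cone unit_cube x)) \<phi> = complex_of_real (\<phi> x) * psi x"
    by (rule cint_point_mass[OF phi]) (intro radon convex_cone compact_cbox unit_cube_nonempty cube_concentrated[OF x])+
  then show ?thesis using cone_val_volume[OF phi P(1,2), of x] P(3) unit_cube_nonempty by (simp add: cone_val_def)
qed

text \<open>The integral of a tent \<phi> against the cone over the cube is \<phi> times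
  \<open>psi\<close> at the apex, and it depends continuously on the apex. Near x the tent is
  positive and can be divided out.\<close>

lemma continuous_on_psi: "continuous_on U psi"
  unfolding continuous_on_sequentially
proof (intro allI ballI impI, elim conjE)
  fix s x assume x: "x \<in> U" and s: "\<forall>n. s n \<in> U" "s \<longlonglongrightarrow> x"
  obtain r where r: "r > 0" "cball x r \<subseteq> U" using U(1) x open_contains_cball by blast
  define \<phi> where "\<phi> y = max 0 (r - dist y x)" for y
  have cphi: "continuous_on UNIV \<phi>" unfolding \<phi>_def by (intro continuous_intros)
  have "closure {y. \<phi> y \<noteq> 0} \<subseteq> cball x r"
    by (intro closure_minimal) (auto simp: \<phi>_def dist_commute max_def split: if_splits)
  then have phi: "test_fun U \<phi>" unfolding test_fun_def
    using cphi r compact_Int_closed[OF compact_cball[of x r] closed_closure[of "{y. \<phi> y \<noteq> 0}"]]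
    by (auto simp: Int_absorb1)
  obtain R where R: "R > 0" "(unit_cube :: (real^'n) set) \<subseteq> cball 0 R" by (rule unit_cube_subset_cball)
  let ?Q = "unit_cube :: (real^'n) set"
  \<comment> \<open>Moving the apex changes the cone by at most R times the displacement, uniformly
    on the whole space.\<close>
  have lim: "conv_loc_unif U (\<lambda>k y. support_fun ?Q (y - s k)) (cone ?Q x)"
    unfolding conv_loc_unif_def uniform_limit_iff
  proof (intro allI impI)
    fix K :: "(real^'n) set" and e :: real assume "e > 0"
    then have "e / R > 0" using R by simp
    then have "eventually (\<lambda>k. dist (s k) x < e / R) sequentially" using s(2) by (rule tendstoD[rotated])
    then show "eventually (\<lambda>k. \<forall>y\<in>K. dist (support_fun ?Q (y - s k)) (support_fun ?Q (y - x)) < e) sequentially"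
    proof eventually_elim
      case (elim k)
      have "dist (support_fun ?Q (y - s k)) (support_fun ?Q (y - x)) < e" for y
      proof -
        have "dist (support_fun ?Q (y - s k)) (support_fun ?Q (y - x)) \<le> R * norm (y - s k - (y - x))"
          unfolding dist_real_def by (intro support_fun_lipschitz R unit_cube_nonempty)
        also have "\<dots> = R * dist (s k) x" by (simp add: dist_norm norm_minus_commute)
        also have "\<dots> < e" using elim R by (simp add: field_simps)
        finally show ?thesis .
      qed
      then show ?case by blast
    qed
  qed
  have c: "compact ?Q" "convex ?Q" "?Q \<noteq> {}" using unit_cube_nonempty by auto
  have vol: "measure lebesgue ?Q = 1" by (simp add: measure_completion)
  have "(\<lambda>k. cint (\<Psi> (cone ?Q (s k))) \<phi>) \<longlonglongrightarrow> cint (\<Psi> (cone ?Q x)) \<phi>"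
    by (intro continuity[OF _ _ lim phi] convex_cone c)
  then have 1: "(\<lambda>k. complex_of_real (\<phi> (s k)) * psi (s k)) \<longlonglongrightarrow> complex_of_real (\<phi> x) * psi x"
    using s(1) by (simp add: cint_cone[OF phi _ c] x vol)
  have 2: "(\<lambda>k. \<phi> (s k)) \<longlonglongrightarrow> \<phi> x"
    by (rule continuous_on_tendsto_compose[OF cphi s(2)]) auto
  have nz: "\<phi> x > 0" using r by (simp add: \<phi>_def)
  have "(\<lambda>k. complex_of_real (\<phi> (s k)) * psi (s k) / complex_of_real (\<phi> (s k)))
      \<longlonglongrightarrow> complex_of_real (\<phi> x) * psi x / complex_of_real (\<phi> x)"
    using nz by (intro tendsto_divide 1 tendsto_of_real 2) auto
  then have 3: "(\<lambda>k. complex_of_real (\<phi> (s k)) * psi (s k) / complex_of_real (\<phi> (s k))) \<longlonglongrightarrow> psi x"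
    using nz by simp
  have "eventually (\<lambda>k. \<phi> (s k) > 0) sequentially" using order_tendstoD(1)[OF 2 nz] .
  then have "eventually (\<lambda>k. complex_of_real (\<phi> (s k)) * psi (s k) / complex_of_real (\<phi> (s k)) = (psi \<circ> s) k) sequentially"
    by eventually_elim simp
  then show "(psi \<circ> s) \<longlonglongrightarrow> psi x" using 3 by (rule Lim_transform_eventually[rotated])
qed

section \<open>The integral representation\<close>

text \<open>Both measures are point masses at x, of size \<open>psi x\<close> times the volume of
  P.\<close>

lemma cone_representation:
  assumes x: "x \<in> U" and P: "compact P" "convex P" "P \<noteq> {}"
  shows "ceq_on U (\<Psi> (cone P x)) (density_cmeasure U (MA U (cone P x)) psi)"
proof (rule ceq_on_if_cint_eq[OF U(1)])
  let ?M = "MA U (cone P x)"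
  have pr: "pos_radon_on U ?M" by (intro pos_radon_MA U convex_cone P)
  show "cradon_on U (\<Psi> (cone P x))" by (intro radon convex_cone P)
  show "cradon_on U (density_cmeasure U ?M psi)" by (intro cradon_density U pr continuous_on_psi)
  fix \<phi> assume phi: "test_fun U \<phi>"
  have em: "emeasure ?M B = (if x \<in> B then emeasure lebesgue P else 0)" if "B \<in> sets borel" for B
    by (rule emeasure_MA_support_fun[OF U x P that])
  have fin: "emeasure lebesgue P < \<infinity>" using lmeasurable_compact[OF P(1)] by (simp only: fmeasurable_def mem_Collect_eq infinity_ennreal_def)
  have "(\<integral>y. \<phi> y *\<^sub>R psi y \<partial>?M) = (\<integral>y. indicator UNIV y *\<^sub>R (\<phi> y *\<^sub>R psi y) \<partial>?M)" by simp
  also have "\<dots> = measure ?M (UNIV \<inter> {x}) *\<^sub>R (\<phi> x *\<^sub>R psi x)"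
  proof (rule integral_concentrated)
    have "\<phi> y = 0" if "y \<notin> U" for y
      using that phi closure_subset[of "{x. \<phi> x \<noteq> 0}"] unfolding test_fun_def by auto
    \<comment> \<open>Measurability is known for \<open>psi\<close> cut off to U; the test function
      vanishes outside U and so allows the cut-off to be inserted.\<close>
    then have eq: "(\<lambda>y. indicator UNIV y *\<^sub>R (\<phi> y *\<^sub>R psi y)) = (\<lambda>y. \<phi> y *\<^sub>R (indicator U y *\<^sub>R psi y))"
      by (auto simp: fun_eq_iff indicator_def)
    show "(\<lambda>y. indicator UNIV y *\<^sub>R (\<phi> y *\<^sub>R psi y)) \<in> borel_measurable borel"
      unfolding eq using phi
      by (intro borel_measurable_scaleR measurable_indicator_psi U continuous_on_psi)
         (auto simp: test_fun_def intro: borel_measurable_continuous_onI)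
    have "UNIV - {x} \<in> sets borel" by (intro sets.Diff) auto
    then show "emeasure ?M (UNIV - {x}) = 0" by (simp add: em)
    show "emeasure ?M {x} < \<infinity>" using em[of "{x}"] fin by simp
  qed auto
  also have "measure ?M (UNIV \<inter> {x}) = measure lebesgue P"
    using em[of "{x}"] by (simp add: measure_def)
  finally show "cint (\<Psi> (cone P x)) \<phi> = cint (density_cmeasure U ?M psi) \<phi>"
    unfolding cint_density_cmeasure[OF U(1) pr continuous_on_psi phi]
    by (simp add: cint_cone[OF phi x P] scaleR_conv_of_real)
qed

text \<open>Both sides are determined locally, so near each point the maximum may be replaced by the
  cone over its active slopes.\<close>

lemma max_affine_representation:
  assumes L: "finite L" "L \<noteq> {}"
  shows "ceq_on U (\<Psi> (max_affine L)) (density_cmeasure U (MA U (max_affine L)) psi)"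
  unfolding ceq_on_def
proof (intro allI impI)
  let ?f = "max_affine L"
  have cf: "convex_on U ?f" by (rule convex_on_max_affine[OF L U(2)])
  have pf: "pos_radon_on U (MA U ?f)" by (rule pos_radon_MA[OF U(1) cf])
  fix B assume B: "relcompact_borel U B"
  show "cmeas (\<Psi> ?f) B = cmeas (density_cmeasure U (MA U ?f) psi) B"
  proof (rule cmeas_eq_if_locally_eq[OF radon[OF cf] cradon_density[OF U(1) pf continuous_on_psi] B])
    fix y assume "y \<in> B"
    then have y: "y \<in> U" using B closure_subset[of B] unfolding relcompact_borel_def by auto
    define S where "S = {p. \<exists>c. (p, c) \<in> L \<and> p \<bullet> y + c = max_affine L y}"
    obtain V where V: "open V" "y \<in> V" "V \<subseteq> U" "finite S" "S \<noteq> {}"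
      "\<And>z. z \<in> V \<Longrightarrow> max_affine L z = support_fun (convex hull S) (z - y) + max_affine L y"
      "\<And>C. relcompact_borel U C \<Longrightarrow> C \<subseteq> V \<Longrightarrow>
          cmeas (\<Psi> (max_affine L)) C = cmeas (\<Psi> (cone (convex hull S) y)) C"
      by (rule max_affine_cone[OF L S_def y]) blast
    define P where "P = convex hull S"
    have P: "compact P" "convex P" "P \<noteq> {}" using V(4,5) by (auto simp: P_def finite_imp_compact_convex_hull)
    let ?h = "\<lambda>z. support_fun P (z - y)"
    have ch: "convex_on U ?h" by (rule convex_cone[OF P(1,3)])
    have ph: "pos_radon_on U (MA U ?h)" by (rule pos_radon_MA[OF U(1) ch])
    have same: "emeasure (MA U ?f) C = emeasure (MA U ?h) C" if "C \<in> sets borel" "C \<subseteq> V" for C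
    proof -
      have "convex_on U (\<lambda>z. ?h z + ?f y)" using convex_add_affine[OF ch, of 0 "?f y"] by simp
      then have "emeasure (MA U ?f) C = emeasure (MA U (\<lambda>z. ?h z + ?f y)) C"
        using V(6) that by (intro emeasure_MA_cong_local[OF U(1) cf _ V(1,3)]) (auto simp: P_def)
      then show ?thesis by (simp only: MA_add_const)
    qed
    have em: "emeasure (MA U ?h) C = (if y \<in> C then emeasure lebesgue P else 0)" if "C \<in> sets borel" for C
      by (rule emeasure_MA_support_fun[OF U y P that])
    have fin: "emeasure lebesgue P < \<infinity>" using lmeasurable_compact[OF P(1)] by (simp only: fmeasurable_def mem_Collect_eq infinity_ennreal_def)
    have "cmeas (\<Psi> ?f) C = cmeas (density_cmeasure U (MA U ?f) psi) C"
      if C: "relcompact_borel U C" "C \<subseteq> V \<inter> B" for C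
    proof -
      have Cs: "C \<in> sets borel" using C by (simp add: relcompact_borel_def)
      have sub: "C - {y} \<in> sets borel" "C \<inter> {y} \<in> sets borel" using Cs by (auto intro!: sets.Diff sets.Int)
      have meas: "(\<lambda>x. indicator C x *\<^sub>R psi x) \<in> borel_measurable borel"
        using C(2) V(3) by (intro borel_measurable_continuous_on_indicator Cs continuous_on_subset[OF continuous_on_psi]) auto
      have y1: "{y} \<in> sets borel" "{y} \<subseteq> V" using V(2) by auto
      \<comment> \<open>The two Monge-Ampere measures are known to agree on subsets of V only, so
        the integrals over C are compared through their atoms at y.\<close>
      have i1: "(\<integral>x. indicator C x *\<^sub>R psi x \<partial>MA U ?h) = measure (MA U ?h) (C \<inter> {y}) *\<^sub>R psi y"
        using em[OF sub(1)] em[OF y1(1)] fin by (intro integral_concentrated Cs meas) auto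
      have i2: "(\<integral>x. indicator C x *\<^sub>R psi x \<partial>MA U ?f) = measure (MA U ?f) (C \<inter> {y}) *\<^sub>R psi y"
        using em[OF sub(1)] em[OF y1(1)] fin same[OF sub(1)] same[OF y1] C(2)
        by (intro integral_concentrated Cs meas) auto
      have "C \<inter> {y} \<subseteq> V" using C(2) by blast
      then have m: "measure (MA U ?f) (C \<inter> {y}) = measure (MA U ?h) (C \<inter> {y})"
        using same[OF sub(2)] by (simp add: measure_def)
      have "cmeas (\<Psi> ?f) C = cmeas (\<Psi> ?h) C" using V(7)[OF C(1)] C(2) by (simp add: P_def)
      also have "\<dots> = cmeas (density_cmeasure U (MA U ?h) psi) C"
        using cone_representation[OF y P] C(1) by (simp add: ceq_on_def)
      also have "\<dots> = (\<integral>x. indicator C x *\<^sub>R psi x \<partial>MA U ?h)"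
        unfolding cmeas_density_cmeasure[OF U(1) ph continuous_on_psi C(1)] set_lebesgue_integral_def ..
      also have "\<dots> = (\<integral>x. indicator C x *\<^sub>R psi x \<partial>MA U ?f)" by (simp only: i1 i2 m)
      also have "\<dots> = cmeas (density_cmeasure U (MA U ?f) psi) C"
        unfolding cmeas_density_cmeasure[OF U(1) pf continuous_on_psi C(1)] set_lebesgue_integral_def ..
      finally show ?thesis .
    qed
    then show "\<exists>V. open V \<and> y \<in> V \<and> (\<forall>C. relcompact_borel U C \<and> C \<subseteq> V \<inter> B \<longrightarrow>
        cmeas (\<Psi> ?f) C = cmeas (density_cmeasure U (MA U ?f) psi) C)"
      using V(1,2) by blast
  qed
qed

lemma representation:
  assumes f: "convex_on U f" and B: "relcompact_borel U B"
  shows "cmeas (\<Psi> f) B = set_lebesgue_integral (MA U f) B psi"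
proof (cases "U = {}")
  \<comment> \<open>The approximation by maxima needs a point of tangency in U; for empty U there is
    only B = {}.\<close>
  case True
  then have "B = {}" using B closure_subset[of B] unfolding relcompact_borel_def by auto
  then show ?thesis by (simp add: set_lebesgue_integral_def)
next
  case False
  obtain L :: "nat \<Rightarrow> ((real^'n) \<times> real) set" where L: "\<And>k. finite (L k)" "\<And>k. L k \<noteq> {}"
    and lim: "conv_loc_unif U (\<lambda>k. max_affine (L k)) f"
    using convex_approx_max_affine[OF U(1) False f] by blast
  have cL: "convex_on U (max_affine (L k))" for k by (rule convex_on_max_affine[OF L U(2)])
  have pf: "pos_radon_on U (MA U f)" by (rule pos_radon_MA[OF U(1) f])
  have "ceq_on U (\<Psi> f) (density_cmeasure U (MA U f) psi)"
  proof (rule ceq_on_if_cint_eq[OF U(1) radon[OF f] cradon_density[OF U(1) pf continuous_on_psi]])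
    fix \<phi> assume phi: "test_fun U \<phi>"
    define K where "K = closure {x. \<phi> x \<noteq> 0}"
    have K: "compact K" "K \<subseteq> U" using phi by (auto simp: K_def test_fun_def)
    have out: "\<phi> x = 0" if "x \<notin> K" for x
      using that closure_subset[of "{x. \<phi> x \<noteq> 0}"] by (auto simp: K_def)
    have cphi: "continuous_on UNIV \<phi>" using phi by (simp add: test_fun_def)
    have eqk: "cint (\<Psi> (max_affine (L k))) \<phi> = (\<integral>x. \<phi> x *\<^sub>R psi x \<partial>MA U (max_affine (L k)))" for k
    proof -
      have pk: "pos_radon_on U (MA U (max_affine (L k)))" by (rule pos_radon_MA[OF U(1) cL])
      have "cint (\<Psi> (max_affine (L k))) \<phi> = 1 * cint (density_cmeasure U (MA U (max_affine (L k))) psi) \<phi>"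
        using max_affine_representation[OF L, of k]
        by (intro cint_scaleI[OF phi] radon cL cradon_density U pk continuous_on_psi) (simp add: ceq_on_def)
      then show ?thesis using cint_density_cmeasure[OF U(1) pk continuous_on_psi phi] by simp
    qed
    have "(\<lambda>k. \<integral>x. \<phi> x *\<^sub>R psi x \<partial>MA U (max_affine (L k))) \<longlonglongrightarrow> (\<integral>x. \<phi> x *\<^sub>R psi x \<partial>MA U f)"
    proof (rule integral_MA_tendsto[OF U(1) f cL lim _ _ K])
      have eq: "(\<lambda>x. \<phi> x *\<^sub>R psi x) = (\<lambda>x. \<phi> x *\<^sub>R (indicator U x *\<^sub>R psi x))"
      proof
        fix x show "\<phi> x *\<^sub>R psi x = \<phi> x *\<^sub>R (indicator U x *\<^sub>R psi x)"
          using out[of x] K by (cases "x \<in> U") auto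
      qed
      show "(\<lambda>x. \<phi> x *\<^sub>R psi x) \<in> borel_measurable borel"
        unfolding eq
        by (intro borel_measurable_scaleR measurable_indicator_psi U continuous_on_psi borel_measurable_continuous_onI cphi)
      show "continuous_on U (\<lambda>x. \<phi> x *\<^sub>R psi x)"
        by (intro continuous_on_scaleR continuous_on_psi continuous_on_subset[OF cphi]) auto
      show "\<phi> x *\<^sub>R psi x = 0" if "x \<notin> K" for x using out[OF that] by simp
    qed
    moreover have "(\<lambda>k. cint (\<Psi> (max_affine (L k))) \<phi>) \<longlonglongrightarrow> cint (\<Psi> f) \<phi>"
      by (rule continuity[OF cL f lim phi])
    ultimately have "cint (\<Psi> f) \<phi> = (\<integral>x. \<phi> x *\<^sub>R psi x \<partial>MA U f)"
      unfolding eqk using LIMSEQ_unique by blast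
    then show "cint (\<Psi> f) \<phi> = cint (density_cmeasure U (MA U f) psi) \<phi>"
      by (simp only: cint_density_cmeasure[OF U(1) pf continuous_on_psi phi])
  qed
  then show ?thesis using B cmeas_density_cmeasure[OF U(1) pf continuous_on_psi B] by (simp add: ceq_on_def)
qed

end

text \<open>The norm is the support function of the unit ball, so the Monge-Ampere measure has at x
  an atom of the volume of the ball. The closed ball appears here and the open one in
  \<open>omega\<close>, with equal volumes.\<close>

lemma set_integral_MA_norm:
  fixes \<psi> :: "real^'n \<Rightarrow> complex"
  assumes U: "open U" "convex U" and x: "x \<in> U"
  shows "set_lebesgue_integral (MA U (\<lambda>y. norm (y - x))) {x} \<psi> = omega TYPE(real^'n) *\<^sub>R \<psi> x"
proof -
  let ?M = "MA U (\<lambda>y. norm (y - x))"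
  have em: "emeasure ?M {x} = emeasure lebesgue (cball (0 :: real^'n) 1)"
    using emeasure_MA_support_fun[OF U x, of "cball 0 1" "{x}"] by (simp add: support_fun_cball)
  have "(\<integral>y. indicator {x} y *\<^sub>R \<psi> y \<partial>?M) = measure ?M ({x} \<inter> {x}) *\<^sub>R \<psi> x"
  proof (rule integral_concentrated)
    show "emeasure ?M {x} < \<infinity>"
      using em lmeasurable_compact[OF compact_cball, of "0 :: real^'n" 1] by (simp only: fmeasurable_def mem_Collect_eq infinity_ennreal_def)
    \<comment> \<open>\<psi> is an arbitrary function here; cut off to a single point it is a
      constant times an indicator, hence measurable.\<close>
    have "(\<lambda>y. indicator {x} y *\<^sub>R \<psi> x) \<in> borel_measurable borel" by (intro borel_measurable_scaleR borel_measurable_indicator) auto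
    moreover have "(\<lambda>y. indicator {x} y *\<^sub>R \<psi> y) = (\<lambda>y. indicator {x} y *\<^sub>R \<psi> x)" by (auto simp: indicator_def)
    ultimately show "(\<lambda>y. indicator {x} y *\<^sub>R \<psi> y) \<in> borel_measurable borel" by simp
  qed auto
  also have "measure ?M ({x} \<inter> {x}) = measure lebesgue (cball (0 :: real^'n) 1)" using em by (simp add: measure_def)
  also have "\<dots> = omega TYPE(real^'n)"
    unfolding omega_def by (simp add: measure_completion content_cball content_ball)
  finally show ?thesis by (simp add: set_lebesgue_integral_def)
qed

text \<open>Uniqueness on U and the explicit formula are one statement: evaluating any
  representation at the function |. - x| and the set {x} determines \<psi> at x.\<close>

theorem theorem4p8:
  fixes U :: "(real^'n) set"
    and \<Psi> :: "(real^'n \<Rightarrow> real) \<Rightarrow> (real^'n) cmeasure"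
  assumes "open U" and "convex U"
    and "VConv_meas U \<Psi>"
    and "locally_determined U \<Psi>"
  shows "(\<exists>\<psi> :: real^'n \<Rightarrow> complex. continuous_on U \<psi> \<and>
            (\<forall>f. convex_on U f \<longrightarrow> (\<forall>B. relcompact_borel U B \<longrightarrow>
               cmeas (\<Psi> f) B = set_lebesgue_integral (MA U f) B \<psi>)))
       \<and> (\<forall>\<psi> :: real^'n \<Rightarrow> complex. continuous_on U \<psi> \<and>
            (\<forall>f. convex_on U f \<longrightarrow> (\<forall>B. relcompact_borel U B \<longrightarrow>
               cmeas (\<Psi> f) B = set_lebesgue_integral (MA U f) B \<psi>))
          \<longrightarrow> (\<forall>x\<in>U. \<psi> x = cmeas (\<Psi> (\<lambda>y. norm (y - x))) {x} / complex_of_real (omega TYPE(real^'n))))"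
proof -
  interpret local_valuation U \<Psi> by unfold_locales fact+
  show ?thesis
  proof (intro conjI allI impI ballI)
    show "\<exists>\<psi> :: real^'n \<Rightarrow> complex. continuous_on U \<psi> \<and>
            (\<forall>f. convex_on U f \<longrightarrow> (\<forall>B. relcompact_borel U B \<longrightarrow>
               cmeas (\<Psi> f) B = set_lebesgue_integral (MA U f) B \<psi>))"
      using continuous_on_psi representation by (intro exI[of _ psi]) auto
  next
    fix \<psi> :: "real^'n \<Rightarrow> complex" and x
    assume rep: "continuous_on U \<psi> \<and> (\<forall>f. convex_on U f \<longrightarrow> (\<forall>B. relcompact_borel U B \<longrightarrow>
        cmeas (\<Psi> f) B = set_lebesgue_integral (MA U f) B \<psi>))" and x: "x \<in> U"
    have "convex_on U (\<lambda>y. norm (y - x))"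
      using convex_cone[of "cball 0 1" x] by (simp add: support_fun_cball)
    moreover have "relcompact_borel U {x}" using x by (intro relcompact_borel_compact) auto
    ultimately have "cmeas (\<Psi> (\<lambda>y. norm (y - x))) {x} = omega TYPE(real^'n) *\<^sub>R \<psi> x"
      using rep set_integral_MA_norm[OF assms(1,2) x, of \<psi>] by simp
    moreover have "omega TYPE(real^'n) > 0" by (simp add: omega_def)
    ultimately show "\<psi> x = cmeas (\<Psi> (\<lambda>y. norm (y - x))) {x} / complex_of_real (omega TYPE(real^'n))"
      by (simp add: scaleR_conv_of_real)
  qed
qed

end
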